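(* There exists a family of positive finite constants $(\mathbf{C}(d_1,d_2))_{d_1\ge 1,\,d_2\ge 0}$ such that for every $d\ge 2$ and every $z\in\mathbb{R}^d\setminus\{0\}$, \[ \boldsymbol{\mu}_\epsilon(z)=\|z\|_1-\mathbf{C}\big(d_1(z),d_2(z)\big)\,\gamma(z)\,\epsilon^{1/d_1(z)}+o\big(\epsilon^{1/d_1(z)}\big)\quad\text{as }\epsilon\to 0 . \]
   Context: Bernoulli bond first-passage percolation on $\mathbb{Z}^d$, $d\ge 2$, $\epsilon\in[0,1]$: $\mathbb{E}^d$ is the set of edges between vertices of $\mathbb{Z}^d$ at Euclidean distance $1$; $(\boldsymbol{\tau}_\epsilon(u))_{u\in\mathbb{E}^d}$ are i.i.d. with $\mathbb{P}(\boldsymbol{\tau}_\epsilon(u)=1)=1-\epsilon$, $\mathbb{P}(\boldsymbol{\tau}_\epsilon(u)=0)=\epsilon$; an edge is open if its passage time is $0$. For a nearest-neighbour path $\pi$ with edges $u_1,\dots,u_n$, $\boldsymbol{\tau}_\epsilon(\pi)=\sum_{i=1}^n\boldsymbol{\tau}_\epsilon(u_i)$ and $\mathbf{T}_\epsilon(x,y)=\inf_{\pi:x\to y}\boldsymbol{\tau}_\epsilon(\pi)$. For $z\in\mathbb{R}^d\setminus\{0\}$, $\boldsymbol{\mu}_\epsilon(z)=\lim_{n\to\infty}\mathbf{T}_\epsilon(0,\lfloor nz\rfloor)/n$ (a.s. and in $L^1$; equivalently the limit of $\frac1n\mathbb{E}[\mathbf{T}_\epsilon(0,\lfloor nz\rfloor)]$),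 where $\lfloor\cdot\rfloor$ is the coordinatewise integer part. For $z=(z_1,\dots,z_d)$: $d_1(z)=\#\{i:z_i\neq 0\}$, $d_2(z)=d-d_1(z)$, and $\gamma(z)=\prod_{i:z_i\neq0}|z_i|^{1/d_1(z)}$. *)

theory Defs
  imports "HOL-Probability.Probability" "HOL-Library.Landau_Symbols"
begin

text \<open>Vertices of Z^d are integer lists of length d. The edge between x and x + e_i
  (i < d) is indexed by the pair (x, i); this is a bijection onto the set E^d of
  nearest-neighbour edge_set.\<close>

definition vertices :: "nat \<Rightarrow> int list set" where
  "vertices d = {x. length x = d}"

definition edge_set :: "nat \<Rightarrow> (int list \<times> nat) set" where
  "edge_set d = {(x, i). length x = d \<and> i < d}"

definition step_up :: "int list \<Rightarrow> nat \<Rightarrow> int list" where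
  "step_up x i = x[i := x ! i + 1]"

definition adjacent :: "nat \<Rightarrow> int list \<Rightarrow> int list \<Rightarrow> bool" where
  "adjacent d u v \<longleftrightarrow> length u = d \<and> length v = d \<and>
     (\<Sum>i<d. \<bar>u ! i - v ! i\<bar>) = 1"

definition edge_between :: "int list \<Rightarrow> int list \<Rightarrow> int list \<times> nat" where
  "edge_between u v = (THE ed. ed \<in> edge_set (length u) \<and>
      ((u = fst ed \<and> v = step_up (fst ed) (snd ed)) \<or> (v = fst ed \<and> u = step_up (fst ed) (snd ed))))"

definition is_path :: "nat \<Rightarrow> int list \<Rightarrow> int list \<Rightarrow> int list list \<Rightarrow> bool" where
  "is_path d x y p \<longleftrightarrow> p \<noteq> [] \<and> hd p = x \<and> last p = y \<and>
     (\<forall>k < length p - 1. adjacent d (p ! k) (p ! Suc k))"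

definition path_time :: "(int list \<times> nat \<Rightarrow> nat) \<Rightarrow> int list list \<Rightarrow> nat" where
  "path_time \<tau> p = (\<Sum>k < length p - 1. \<tau> (edge_between (p ! k) (p ! Suc k)))"

definition passage_time :: "nat \<Rightarrow> (int list \<times> nat \<Rightarrow> nat) \<Rightarrow> int list \<Rightarrow> int list \<Rightarrow> nat" where
  "passage_time d \<tau> x y = Inf {path_time \<tau> p | p. is_path d x y p}"

definition edge_law :: "real \<Rightarrow> nat measure" where
  "edge_law eps = measure_pmf (map_pmf (\<lambda>b. if b then 0 else 1) (bernoulli_pmf eps))"

definition env :: "nat \<Rightarrow> real \<Rightarrow> (int list \<times> nat \<Rightarrow> nat) measure" where
  "env d eps = (\<Pi>\<^sub>M e \<in> edge_set d. edge_law eps)"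

definition origin :: "nat \<Rightarrow> int list" where
  "origin d = replicate d 0"

definition floor_vec :: "real list \<Rightarrow> int list" where
  "floor_vec z = map (\<lambda>t. \<lfloor>t\<rfloor>) z"

definition time_const :: "nat \<Rightarrow> real \<Rightarrow> real list \<Rightarrow> real" where
  "time_const d eps z = lim (\<lambda>n::nat.
      (\<integral>\<tau>. real (passage_time d \<tau> (origin d) (floor_vec (map (\<lambda>t. real n * t) z))) \<partial>env d eps)
      / real n)"

definition l1norm :: "real list \<Rightarrow> real" where
  "l1norm z = (\<Sum>t\<leftarrow>z. \<bar>t\<bar>)"

definition dim1 :: "real list \<Rightarrow> nat" where
  "dim1 z = card {i. i < length z \<and> z ! i \<noteq> 0}"

definition dim2 :: "real list \<Rightarrow> nat" where
  "dim2 z = length z - dim1 z"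

definition gamma_fac :: "real list \<Rightarrow> real" where
  "gamma_fac z = (\<Prod>i \<in> {i. i < length z \<and> z ! i \<noteq> 0}. \<bar>z ! i\<bar> powr (1 / real (dim1 z)))"

end

theory Submission
  imports Defs "HOL-Real_Asymp.Real_Asymp"
begin

text \<open>
  Write the gain of a direction as the difference between its l1-norm and its time constant.
  By lattice symmetries all coordinates of z may be taken nonnegative, positive exactly on a set
  I of d1 coordinates. Merge the lattice into boxes of sides k i along I and call an edge of the
  coarse lattice open if one of the prod k parallel fine edges that it represents is open. The
  coarse edges are again i.i.d., open with probability at most eps * prod k, and a fine path is
  turned into a coarse path that keeps its gain, except for those open edges that are used within
  one slab of the previously used one. Summing over all chains of open edges bounds the expected
  number of these exceptions by lam * |z| / t, where lam is of order eps^(1/d1) and t tends to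
  infinity as eps^(1/d1) * k tends to 0.

  So the gain of z at eps is at most the gain of z/k at eps * prod k, up to an error that is
  negligible when eps * prod k is small. The rescaled gain is therefore almost monotone in eps,
  which gives its convergence, with a finite limit, and comparing two directions through
  anisotropic boxes shows that the limit depends on z only through the geometric mean. Collecting
  a single open edge in a box of side eps^(-1/d1) shows that the limit is positive.
\<close>

section \<open>Paths and passage times\<close>

text \<open>A coarse edge is open as soon as any fine edge with lower end in its cell is, so a fine
  path can use an open edge without changing its cell. The coarse path then has to run one cell
  ahead, and meanwhile it misses the open edges that the fine path meets. This is where gain is
  lost, and it only happens at gaps that are not long in some direction of I.

  The losses are controlled by an exponential first moment. A path with nonnegative gain has at most
  as much wasted length as open edges, so each open edge may carry a weight e times exp of minus the
  cost of its gap. The sum over all gaps is of order lam^(-d1), which forces lam of order eps^(1/d1)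
  if the weight per open edge is to stay below 1/2. A gap that is short in one direction has about k
  choices there instead of 1/lam, so a bad gap can be rewarded by exp t as long as exp t * lam * k
  stays bounded. Thus t grows like log(1/(lam * k)), and the relative error decays only
  logarithmically. This suffices because errors are not accumulated over scales: one fixed parameter
  is compared directly with all much smaller ones.\<close>

definition dist1 :: "int list \<Rightarrow> int list \<Rightarrow> int" where
  "dist1 x y = (\<Sum>i<length x. \<bar>x ! i - y ! i\<bar>)"

definition step_down :: "int list \<Rightarrow> nat \<Rightarrow> int list" where
  "step_down x i = x[i := x ! i - 1]"

lemma length_step [simp]: "length (step_up x i) = length x" "length (step_down x i) = length x"
  by (simp_all add: step_up_def step_down_def)

lemma nth_step_up: "i < length x \<Longrightarrow> step_up x j ! i = x ! i + (if i = j then 1 else 0)"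
  by (auto simp: step_up_def nth_list_update)

lemma nth_step_down: "i < length x \<Longrightarrow> step_down x j ! i = x ! i - (if i = j then 1 else 0)"
  by (auto simp: step_down_def nth_list_update)

lemma step_up_down [simp]: "step_up (step_down x j) j = x" "step_down (step_up x j) j = x"
  by (cases "j < length x"; simp add: step_up_def step_down_def list_update_beyond)+

lemma length_origin [simp]: "length (origin d) = d"
  by (simp add: origin_def)

lemma nth_origin [simp]: "i < d \<Longrightarrow> origin d ! i = 0"
  by (simp add: origin_def)

lemma step_up_inj: 
  assumes "i < length x" "step_up x i = step_up x j" shows "i = j"
  using assms nth_step_up[of i x i] nth_step_up[of i x j] by (auto split: if_splits)

lemma step_up_neq2: 
  assumes "j < length x" "i < length x" shows "step_up (step_up x j) i \<noteq> x"
proof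
  assume "step_up (step_up x j) i = x"
  then have "step_up (step_up x j) i ! i = x ! i" by simp
  then show False using assms by (simp add: nth_step_up split: if_splits)
qed

lemma sum_abs_eq_1:
  fixes f :: "nat \<Rightarrow> int"
  assumes "(\<Sum>i<d. \<bar>f i\<bar>) = 1"
  obtains j where "j < d" "\<bar>f j\<bar> = 1" "\<And>i. i < d \<Longrightarrow> i \<noteq> j \<Longrightarrow> f i = 0"
proof -
  obtain j where j: "j < d" "f j \<noteq> 0"
    using assms sum.neutral[of "{..<d}" "\<lambda>i. \<bar>f i\<bar>"] that by (cases "\<exists>j<d. f j \<noteq> 0") auto
  have eq: "(\<Sum>i<d. \<bar>f i\<bar>) = \<bar>f j\<bar> + (\<Sum>i\<in>{..<d}-{j}. \<bar>f i\<bar>)"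
    using j by (simp add: sum.remove)
  have nn: "(\<Sum>i\<in>{..<d}-{j}. \<bar>f i\<bar>) \<ge> 0" by (simp add: sum_nonneg)
  have "\<bar>f j\<bar> \<ge> 1" using j by linarith
  with eq nn assms have 1: "\<bar>f j\<bar> = 1" "(\<Sum>i\<in>{..<d}-{j}. \<bar>f i\<bar>) = 0" by linarith+
  have "f i = 0" if "i < d" "i \<noteq> j" for i
    using 1(2) that by (subst (asm) sum_nonneg_eq_0_iff) auto
  with j 1 show ?thesis using that by blast
qed

lemma adjacentE:
  assumes "adjacent d u v"
  obtains j where "j < d" "v = step_up u j" | j where "j < d" "u = step_up v j"
proof -
  from assms have l: "length u = d" "length v = d" and s: "(\<Sum>i<d. \<bar>u ! i - v ! i\<bar>) = 1"
    by (auto simp: adjacent_def)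
  from sum_abs_eq_1[OF s] obtain j where j: "j < d" "\<bar>u ! j - v ! j\<bar> = 1"
     "\<And>i. i < d \<Longrightarrow> i \<noteq> j \<Longrightarrow> u ! i - v ! i = 0" by blast
  from j(2) consider "v ! j = u ! j + 1" | "u ! j = v ! j + 1" by linarith
  then show ?thesis
  proof cases
    case 1
    have "v = step_up u j"
      by (rule nth_equalityI) (use l j 1 in \<open>auto simp: nth_step_up\<close>)
    then show ?thesis using j that by blast
  next
    case 2
    have "u = step_up v j"
      by (rule nth_equalityI) (use l j 2 in \<open>auto simp: nth_step_up\<close>)
    then show ?thesis using j that by blast
  qed
qed

lemma adjacent_sym: "adjacent d u v \<Longrightarrow> adjacent d v u"
  by (simp add: adjacent_def abs_minus_commute)

lemma adjacent_step_up: "length x = d \<Longrightarrow> j < d \<Longrightarrow> adjacent d x (step_up x j)"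
  by (simp add: adjacent_def nth_step_up if_distrib cong: if_cong)

lemma adjacent_length: "adjacent d u v \<Longrightarrow> length u = d \<and> length v = d"
  by (simp add: adjacent_def)

text \<open>The description behind \<open>edge_between\<close> admits both orientations; it is
  unique because two upward steps never return to their start.\<close>

lemma edge_between_up [simp]:
  assumes "length x = d" "j < d"
  shows "edge_between x (step_up x j) = (x, j)" "edge_between (step_up x j) x = (x, j)"
proof -
  have a: "y = x \<and> i = j"
    if "i < d" "(x = y \<and> step_up x j = step_up y i) \<or> (step_up x j = y \<and> x = step_up y i)" for y i
    using that(2)
  proof (elim disjE conjE)
    assume "x = y" "step_up x j = step_up y i"
    then show ?thesis using assms step_up_inj[of j x i] by blast
  next
    assume "step_up x j = y" "x = step_up y i"
    then show ?thesis using assms that(1) step_up_neq2[of j x i] by auto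
  qed
  show "edge_between x (step_up x j) = (x, j)"
    unfolding edge_between_def
  proof (rule the_equality, goal_cases)
    case 1 then show ?case using assms by (simp add: edge_set_def)
  next
    case (2 ed)
    then show ?case using a[of "snd ed" "fst ed"] assms by (simp add: edge_set_def prod_eq_iff split_beta mem_Times_iff)
  qed
  show "edge_between (step_up x j) x = (x, j)"
    unfolding edge_between_def
  proof (rule the_equality, goal_cases)
    case 1 then show ?case using assms by (simp add: edge_set_def)
  next
    case (2 ed)
    then have "(x = fst ed \<and> step_up x j = step_up (fst ed) (snd ed)) \<or> (step_up x j = fst ed \<and> x = step_up (fst ed) (snd ed))"
      by blast
    then show ?case using 2 a[of "snd ed" "fst ed"] assms by (simp add: edge_set_def prod_eq_iff split_beta mem_Times_iff)
  qed
qed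

lemma edge_between_in: "adjacent d u v \<Longrightarrow> edge_between u v \<in> edge_set d"
proof -
  assume a: "adjacent d u v"
  then have l: "length u = d" "length v = d" by (auto dest: adjacent_length)
  from a show ?thesis
  proof (cases rule: adjacentE)
    case (1 j) then show ?thesis using l by (simp add: edge_set_def)
  next
    case (2 j) then show ?thesis using l by (simp add: edge_set_def)
  qed
qed

section \<open>Concatenation and splitting of paths, optimal paths\<close>

lemma is_path_single [simp]: "is_path d x y [z] \<longleftrightarrow> z = x \<and> z = y"
  by (auto simp: is_path_def)

lemma path_time_single [simp]: "path_time \<tau> [z] = 0"
  by (simp add: path_time_def)

lemma sum_lessThan_add:
  fixes f :: "nat \<Rightarrow> 'a :: comm_monoid_add"
  shows "(\<Sum>k<m + n. f k) = (\<Sum>k<m. f k) + (\<Sum>k<n. f (m + k))"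
  by (induction n) (simp_all add: ac_simps)

lemma is_path_append:
  assumes "is_path d x y p" "is_path d y z q"
  shows "is_path d x z (p @ tl q)" "path_time \<tau> (p @ tl q) = path_time \<tau> p + path_time \<tau> q"
proof -
  obtain q' where q: "q = y # q'" using assms(2) by (cases q) (auto simp: is_path_def)
  obtain p' where p: "p = p' @ [y]" using assms(1) by (cases p rule: rev_cases) (auto simp: is_path_def)
  let ?r = "p @ tl q"
  have r: "?r = p' @ q" by (simp add: p q)
  have n1: "?r ! k = p ! k" if "k < length p" for k using that by (simp add: nth_append)
  have n2: "?r ! (length p' + k) = q ! k" for k unfolding r by simp
  have len: "length ?r - 1 = (length p - 1) + (length q - 1)" by (simp add: p q)
  have l2: "length p - 1 = length p'" by (simp add: p)
  show "is_path d x z ?r"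
    unfolding is_path_def
  proof (intro conjI allI impI)
    show "?r \<noteq> []" by (simp add: p)
    show "hd ?r = x" using assms(1) by (simp add: is_path_def)
    show "last ?r = z" using assms(2) unfolding r by (simp add: q is_path_def)
    fix k assume k: "k < length ?r - 1"
    show "adjacent d (?r ! k) (?r ! Suc k)"
    proof (cases "k < length p - 1")
      case True then show ?thesis using assms(1) by (simp add: n1 is_path_def)
    next
      case False
      then obtain m where m: "k = length p' + m" using l2 by (metis le_Suc_ex not_less)
      then show ?thesis using assms(2) k len n2[of m] n2[of "Suc m"] by (simp add: is_path_def p)
    qed
  qed
  have "path_time \<tau> ?r = (\<Sum>k<(length p - 1) + (length q - 1). \<tau> (edge_between (?r ! k) (?r ! Suc k)))"
    unfolding path_time_def len ..
  also have "\<dots> = (\<Sum>k<length p - 1. \<tau> (edge_between (?r ! k) (?r ! Suc k)))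
     + (\<Sum>k<length q - 1. \<tau> (edge_between (?r ! (length p - 1 + k)) (?r ! Suc (length p - 1 + k))))"
    by (rule sum_lessThan_add)
  also have "\<dots> = path_time \<tau> p + path_time \<tau> q"
  proof -
    have "?r ! (length p - 1 + k) = q ! k" "?r ! Suc (length p - 1 + k) = q ! Suc k" for k
      using n2[of k] n2[of "Suc k"] l2 by simp_all
    then show ?thesis unfolding path_time_def by (simp add: n1)
  qed
  finally show "path_time \<tau> ?r = path_time \<tau> p + path_time \<tau> q" .
qed

lemma is_path_pair: "adjacent d u v \<Longrightarrow> is_path d u v [u, v]"
  by (auto simp: is_path_def)

lemma path_time_pair [simp]: "path_time \<tau> [u, v] = \<tau> (edge_between u v)"
  by (simp add: path_time_def)

lemma is_path_snoc:
  assumes "q \<noteq> []"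
  shows "is_path d x y (q @ [v]) \<longleftrightarrow> v = y \<and> is_path d x (last q) q \<and> adjacent d (last q) y"
proof
  assume a: "is_path d x y (q @ [v])"
  obtain q' w where q: "q = q' @ [w]" using assms by (cases q rule: rev_cases) auto
  have v: "v = y" using a by (simp add: is_path_def)
  have ad: "adjacent d ((q @ [v]) ! k) ((q @ [v]) ! Suc k)" if "k < length q" for k
    using a that by (auto simp: is_path_def)
  have "adjacent d (q ! k) (q ! Suc k)" if "k < length q - 1" for k
  proof -
    have "k < length q" "Suc k < length q" using that by linarith+
    then show ?thesis using ad[of k] by (simp add: nth_append)
  qed
  moreover have "adjacent d (last q) v" using ad[of "length q'"] by (simp add: q nth_append)
  ultimately show "v = y \<and> is_path d x (last q) q \<and> adjacent d (last q) y"
    using a assms v by (simp add: is_path_def)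
next
  assume "v = y \<and> is_path d x (last q) q \<and> adjacent d (last q) y"
  then show "is_path d x y (q @ [v])"
    using is_path_append(1)[of d x "last q" q y "[last q, y]"] is_path_pair by simp
qed

lemma path_time_snoc: "q \<noteq> [] \<Longrightarrow> path_time \<tau> (q @ [v]) = path_time \<tau> q + \<tau> (edge_between (last q) v)"
proof -
  assume "q \<noteq> []"
  then obtain q' w where q: "q = q' @ [w]" by (cases q rule: rev_cases) auto
  have "(\<Sum>k<length q'. \<tau> (edge_between ((q @ [v]) ! k) ((q @ [v]) ! Suc k))) =
     (\<Sum>k<length q'. \<tau> (edge_between (q ! k) (q ! Suc k)))"
    by (rule sum.cong) (auto simp: nth_append q)
  then show ?thesis by (simp add: path_time_def q nth_append)
qed

lemma is_path_split:
  "is_path d x y (as @ v # bs) \<Longrightarrow> is_path d x v (as @ [v]) \<and> is_path d v y (v # bs)"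
proof (induction bs arbitrary: y rule: rev_induct)
  case Nil
  then have "v = y" by (simp add: is_path_def)
  with Nil show ?case by simp
next
  case (snoc w bs)
  then have "is_path d x y ((as @ v # bs) @ [w])" by simp
  then have 1: "w = y" "is_path d x (last (v # bs)) (as @ v # bs)" "adjacent d (last (v # bs)) y"
    by (subst (asm) is_path_snoc; simp)+
  from snoc.IH[OF 1(2)] 1 show ?case
    using is_path_snoc[of "v # bs" d v y w] by simp
qed

lemma passage_time_le: "is_path d x y p \<Longrightarrow> passage_time d \<tau> x y \<le> path_time \<tau> p"
  unfolding passage_time_def by (rule cInf_lower) auto

lemma path_exists:
  assumes "length x = d" "length y = d"
  shows "\<exists>p. is_path d x y p \<and> int (length p) = dist1 x y + 1"
  using assms
proof (induction "nat (dist1 x y)" arbitrary: x)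
  case 0
  have nn: "dist1 x y \<ge> 0" by (simp add: dist1_def sum_nonneg)
  then have "dist1 x y = 0" using 0 by simp
  then have "x ! i = y ! i" if "i < d" for i
    using that 0(2) unfolding dist1_def by (subst (asm) sum_nonneg_eq_0_iff) auto
  then have "x = y" using 0 by (intro nth_equalityI) auto
  then show ?case using \<open>dist1 x y = 0\<close> by (intro exI[of _ "[x]"]) simp
next
  case (Suc n)
  then have D: "dist1 x y = int (Suc n)" by simp
  then obtain j where j: "j < d" "x ! j \<noteq> y ! j"
    using sum.neutral[of "{..<d}" "\<lambda>i. \<bar>x ! i - y ! i\<bar>"] Suc.prems that unfolding dist1_def
    by (cases "\<exists>j<d. x ! j \<noteq> y ! j") auto
  define x' where "x' = (if x ! j < y ! j then step_up x j else step_down x j)"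
  have lx: "length x' = d" using Suc.prems by (simp add: x'_def)
  have ad: "adjacent d x x'"
    using Suc.prems j adjacent_step_up[of x d j] adjacent_step_up[of "step_down x j" d j]
    by (auto simp: x'_def intro: adjacent_sym)
  have s: "dist1 u y = \<bar>u ! j - y ! j\<bar> + (\<Sum>i\<in>{..<d}-{j}. \<bar>u ! i - y ! i\<bar>)" if "length u = d" for u
    using j that by (simp add: dist1_def sum.remove)
  have "(\<Sum>i\<in>{..<d}-{j}. \<bar>x ! i - y ! i\<bar>) = (\<Sum>i\<in>{..<d}-{j}. \<bar>x' ! i - y ! i\<bar>)"
    using Suc.prems by (intro sum.cong) (auto simp: x'_def nth_step_up nth_step_down)
  moreover have "\<bar>x ! j - y ! j\<bar> = \<bar>x' ! j - y ! j\<bar> + 1"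
    using Suc.prems j by (auto simp: x'_def nth_step_up nth_step_down)
  ultimately have D': "dist1 x' y = int n" using s[of x] s[of x'] D lx Suc.prems by simp
  from Suc.hyps(1)[of x'] D' lx Suc.prems obtain p where p: "is_path d x' y p" "int (length p) = dist1 x' y + 1"
    by auto
  have "is_path d x y ([x, x'] @ tl p)"
    by (rule is_path_append(1)[OF is_path_pair[OF ad] p(1)])
  moreover have "int (length ([x, x'] @ tl p)) = dist1 x y + 1" using p D D' by simp
  ultimately show ?case by blast
qed

text \<open>Path times are natural numbers, so the infimum is a minimum once some path exists.
  Optimal paths can therefore be used directly, without approximation.\<close>

lemma passage_time_attained:
  assumes "length x = d" "length y = d"
  shows "\<exists>p. is_path d x y p \<and> passage_time d \<tau> x y = path_time \<tau> p"
proof -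
  obtain p0 where "is_path d x y p0" using path_exists[OF assms] by blast
  then have "{path_time \<tau> p | p. is_path d x y p} \<noteq> {}" by blast
  from Inf_nat_def1[OF this] show ?thesis unfolding passage_time_def by blast
qed

lemma path_time_cong:
  assumes "is_path d x y p" "\<And>e. e \<in> edge_set d \<Longrightarrow> \<tau> e = \<tau>' e"
  shows "path_time \<tau> p = path_time \<tau>' p"
  unfolding path_time_def
  by (rule sum.cong) (use assms edge_between_in in \<open>auto simp: is_path_def\<close>)

lemma passage_time_cong:
  assumes "\<And>e. e \<in> edge_set d \<Longrightarrow> \<tau> e = \<tau>' e"
  shows "passage_time d \<tau> x y = passage_time d \<tau>' x y"
  unfolding passage_time_def
proof (rule arg_cong[of _ _ Inf])
  have "path_time \<tau> p = path_time \<tau>' p" if "is_path d x y p" for p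
    using path_time_cong[OF that] assms by blast
  then show "{path_time \<tau> p | p. is_path d x y p} = {path_time \<tau>' p | p. is_path d x y p}"
    by (intro Collect_cong iff_exI) auto
qed

lemma path_time_mono:
  assumes "is_path d x y p" "\<And>e. e \<in> edge_set d \<Longrightarrow> \<tau> e \<le> \<tau>' e"
  shows "path_time \<tau> p \<le> path_time \<tau>' p"
  unfolding path_time_def
  by (rule sum_mono) (use assms edge_between_in in \<open>auto simp: is_path_def\<close>)

lemma passage_time_mono:
  assumes "length x = d" "length y = d" "\<And>e. e \<in> edge_set d \<Longrightarrow> \<tau> e \<le> \<tau>' e"
  shows "passage_time d \<tau> x y \<le> passage_time d \<tau>' x y"
proof -
  obtain p where p: "is_path d x y p" "passage_time d \<tau>' x y = path_time \<tau>' p"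
    using passage_time_attained[OF assms(1,2), of \<tau>'] by blast
  have "path_time \<tau> p \<le> path_time \<tau>' p" by (rule path_time_mono[OF p(1)]) (rule assms(3))
  then show ?thesis using p(2) passage_time_le[OF p(1), of \<tau>] by linarith
qed

lemma passage_time_self [simp]: "passage_time d \<tau> x x = 0"
  using passage_time_le[of d x x "[x]" \<tau>] by (simp del: is_path_single add: is_path_def)

lemma passage_time_triangle:
  assumes "length x = d" "length y = d" "length z = d"
  shows "passage_time d \<tau> x z \<le> passage_time d \<tau> x y + passage_time d \<tau> y z"
proof -
  obtain p where p: "is_path d x y p" "passage_time d \<tau> x y = path_time \<tau> p"
    using passage_time_attained[OF assms(1,2), of \<tau>] by blast
  obtain q where q: "is_path d y z q" "passage_time d \<tau> y z = path_time \<tau> q"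
    using passage_time_attained[OF assms(2,3), of \<tau>] by blast
  show ?thesis
    using passage_time_le[OF is_path_append(1)[OF p(1) q(1)], of \<tau>] is_path_append(2)[OF p(1) q(1), of \<tau>] p q
    by simp
qed

lemma passage_time_edge: "adjacent d u v \<Longrightarrow> passage_time d \<tau> u v \<le> \<tau> (edge_between u v)"
  using passage_time_le[OF is_path_pair] by simp

lemma passage_time_le_dist1:
  assumes "length x = d" "length y = d" "\<And>e. e \<in> edge_set d \<Longrightarrow> \<tau> e \<le> 1"
  shows "int (passage_time d \<tau> x y) \<le> dist1 x y"
proof -
  obtain p where p: "is_path d x y p" "int (length p) = dist1 x y + 1"
    using path_exists[OF assms(1,2)] by blast
  have "path_time \<tau> p \<le> (\<Sum>k<length p - 1. 1)" unfolding path_time_def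
    by (rule sum_mono) (use p assms(3) edge_between_in in \<open>auto simp: is_path_def\<close>)
  then have "path_time \<tau> p \<le> length p - 1" by simp
  moreover have "length p \<noteq> 0" using p(1) by (simp add: is_path_def)
  ultimately have "int (path_time \<tau> p) \<le> dist1 x y" using p(2) by linarith
  then show ?thesis using passage_time_le[OF p(1), of \<tau>] by linarith
qed

text \<open>A shortest list among the optimal paths has no loop, since excising a loop does not
  increase the time. A path without repeated vertices uses each edge at most once, which later makes
  the states of the collected open edges independent.\<close>

lemma passage_time_simple_path:
  assumes "length x = d" "length y = d"
  obtains p where "is_path d x y p" "distinct p" "passage_time d \<tau> x y = path_time \<tau> p"
proof -
  define P where "P p \<longleftrightarrow> is_path d x y p \<and> path_time \<tau> p = passage_time d \<tau> x y" for p
  obtain p0 where "is_path d x y p0" "passage_time d \<tau> x y = path_time \<tau> p0"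
    using passage_time_attained[OF assms, of \<tau>] by blast
  then have "P p0" by (simp add: P_def)
  from ex_has_least_nat[of P, OF this, of length]
  obtain p where p: "P p" "\<And>q. P q \<Longrightarrow> length p \<le> length q" by blast
  have "distinct p"
  proof (rule ccontr)
    assume "\<not> distinct p"
    then obtain as bs cs v where dec: "p = as @ [v] @ bs @ [v] @ cs" using not_distinct_decomp by blast
    define p1 where "p1 = as @ [v]"
    define p2 where "p2 = v # bs @ [v]"
    define p3 where "p3 = v # cs"
    have "is_path d x y (as @ v # (bs @ v # cs))" using p by (simp add: P_def dec)
    from is_path_split[OF this] have 1: "is_path d x v p1" "is_path d v y ((v # bs) @ v # cs)"
      by (simp_all add: p1_def)
    from is_path_split[OF 1(2)] 1(1) have *: "is_path d x v p1" "is_path d v v p2" "is_path d v y p3"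
      by (simp_all add: p2_def p3_def)
    have "path_time \<tau> p = path_time \<tau> p1 + path_time \<tau> p2 + path_time \<tau> p3"
      using is_path_append(2)[OF *(1,2)] is_path_append(2)[OF is_path_append(1)[OF *(1,2)] *(3)]
      by (simp add: p1_def p2_def p3_def dec)
    then have "path_time \<tau> (p1 @ tl p3) \<le> path_time \<tau> p" using is_path_append(2)[OF *(1,3), of \<tau>] by simp
    moreover have ip': "is_path d x y (p1 @ tl p3)" by (rule is_path_append(1)[OF *(1,3)])
    ultimately have "P (p1 @ tl p3)" using passage_time_le[OF ip', of \<tau>] p(1) unfolding P_def by auto
    from p(2)[OF this] show False by (simp add: dec p1_def p3_def)
  qed
  with p(1) that[of p] show ?thesis by (simp add: P_def)
qed

section \<open>Expected passage times\<close>

definition unif01 :: "real measure" where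
  "unif01 = uniform_measure lborel {0..1}"

text \<open>One family of uniform labels carries the environments of all parameters eps at once: an edge is
  open at level eps if its label is below eps.\<close>

definition unif_env :: "nat \<Rightarrow> (int list \<times> nat \<Rightarrow> real) measure" where
  "unif_env d = (\<Pi>\<^sub>M e \<in> edge_set d. unif01)"

definition block_open :: "(int list \<times> nat \<Rightarrow> (int list \<times> nat) set) \<Rightarrow> real \<Rightarrow> (int list \<times> nat \<Rightarrow> real)
    \<Rightarrow> int list \<times> nat \<Rightarrow> nat" where
  "block_open L eps u e = (if \<exists>f\<in>L e. u f < eps then 0 else 1)"

definition thresh :: "real \<Rightarrow> (int list \<times> nat \<Rightarrow> real) \<Rightarrow> int list \<times> nat \<Rightarrow> nat" where
  "thresh eps u e = (if u e < eps then 0 else 1)"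

lemma block_open_le: "block_open L eps u e \<le> 1"
  by (simp add: block_open_def)

lemma thresh_le: "thresh eps u e \<le> 1"
  by (simp add: thresh_def)

lemma sets_unif01 [simp, measurable_cong]: "sets unif01 = sets borel"
  by (simp add: unif01_def)

lemma space_unif01 [simp]: "space unif01 = UNIV"
  by (simp add: unif01_def)

interpretation unif01: prob_space unif01
  unfolding unif01_def by (rule prob_space_uniform_measure) auto

lemma emeasure_unif01_ge: "0 \<le> eps \<Longrightarrow> eps \<le> 1 \<Longrightarrow> emeasure unif01 {eps..} = ennreal (1 - eps)"
proof -
  assume a: "0 \<le> eps" "eps \<le> 1"
  then have "{0..1} \<inter> {eps..} = {eps..1}" by auto
  then show ?thesis using a by (simp add: unif01_def emeasure_uniform_measure divide_ennreal_def)
qed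

lemma emeasure_unif01_less: "0 \<le> eps \<Longrightarrow> eps \<le> 1 \<Longrightarrow> emeasure unif01 {..<eps} = ennreal eps"
proof -
  assume a: "0 \<le> eps" "eps \<le> 1"
  then have "{0..1} \<inter> {..<eps} = {0..<eps}" by auto
  then show ?thesis using a by (simp add: unif01_def emeasure_uniform_measure divide_ennreal_def)
qed

interpretation unif_prod: product_prob_space "\<lambda>_::int list \<times> nat. unif01" "edge_set d" for d
  by unfold_locales

interpretation unif_env: prob_space "unif_env d" for d
  unfolding unif_env_def by (rule prob_space_PiM) (rule unif01.prob_space_axioms)

lemma sets_edge_law [simp, measurable_cong]: "sets (edge_law eps) = UNIV"
  by (simp add: edge_law_def)

lemma space_edge_law [simp]: "space (edge_law eps) = UNIV"
  by (simp add: edge_law_def)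

lemma emeasure_edge_law:
  assumes "0 \<le> eps" "eps \<le> 1"
  shows "emeasure (edge_law eps) {n} = (if n = 0 then ennreal eps else if n = 1 then ennreal (1 - eps) else 0)"
proof -
  have v: "(\<lambda>b. if b then 0 else 1::nat) -` {n} = (if n = 0 then {True} else if n = 1 then {False} else {})"
    by (auto split: if_splits)
  show ?thesis unfolding edge_law_def emeasure_map_pmf v
    using assms by (simp add: emeasure_pmf_single)
qed

lemma edge_law_eqI:
  assumes "0 \<le> p" "p \<le> 1" "sets N = UNIV"
    "emeasure N {0} = ennreal (1 - p)" "emeasure N {1} = ennreal p" "\<And>n. n \<noteq> 0 \<Longrightarrow> n \<noteq> 1 \<Longrightarrow> emeasure N {n} = 0"
  shows "N = edge_law (1 - p)"
proof (rule measure_eqI_countable[of _ UNIV])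
  fix n :: nat
  show "emeasure N {n} = emeasure (edge_law (1 - p)) {n}"
    using assms by (subst emeasure_edge_law) auto
qed (use assms in auto)

lemma indep_unif_env:
  assumes "d > 0"
  shows "prob_space.indep_vars (unif_env d) (\<lambda>_. unif01) (\<lambda>e u. u e) (edge_set d)"
proof -
  have ne: "edge_set d \<noteq> {}" using assms by (auto simp: edge_set_def intro!: exI[of _ "origin d"])
  have "distr (unif_env d) (\<Pi>\<^sub>M i\<in>edge_set d. unif01) (\<lambda>x. \<lambda>i\<in>edge_set d. x i)
     = distr (unif_env d) (unif_env d) (\<lambda>x. x)"
    by (rule distr_cong) (auto simp: unif_env_def space_PiM)
  also have "\<dots> = (\<Pi>\<^sub>M i\<in>edge_set d. unif01)" by (simp add: unif_env_def)
  also have "\<dots> = (\<Pi>\<^sub>M i\<in>edge_set d. distr (unif_env d) unif01 (\<lambda>u. u i))"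
    unfolding unif_env_def
    by (rule PiM_cong) (auto intro!: distr_PiM_component[symmetric] unif01.prob_space_axioms)
  finally show ?thesis
    by (subst unif_env.indep_vars_iff_distr_eq_PiM'[OF ne]) (auto simp: unif_env_def)
qed

text \<open>Threshold environments, lattice symmetries and coarse-grained environments are all images of
  this form, for singletons and boxes L e respectively.\<close>

lemma block_law:
  assumes eps: "0 \<le> eps" "eps \<le> 1" and d: "d > 0"
    and L: "\<And>e. e \<in> edge_set d \<Longrightarrow> L e \<subseteq> edge_set d \<and> finite (L e) \<and> card (L e) = K"
    and disj: "disjoint_family_on L (edge_set d)"
  shows "distr (unif_env d) (\<Pi>\<^sub>M e\<in>edge_set d. count_space UNIV) (\<lambda>u. \<lambda>e\<in>edge_set d. block_open L eps u e)
    = env d (1 - (1 - eps) ^ K)"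
proof -
  have ne: "edge_set d \<noteq> {}" using d by (auto simp: edge_set_def intro!: exI[of _ "origin d"])
  define Y where "Y e v = (if \<exists>f\<in>L e. v f < eps then 0 else 1::nat)" for e and v :: "int list \<times> nat \<Rightarrow> real"
  have Ym: "Y e \<in> measurable (PiM (L e) (\<lambda>_. unif01)) (count_space UNIV)" if "e \<in> edge_set d" for e
  proof -
    have [measurable]: "finite (L e)" using L that by blast
    show ?thesis unfolding Y_def by measurable
  qed
  have "unif_env.indep_vars d (\<lambda>_. count_space UNIV) (\<lambda>e u. Y e (restrict (\<lambda>i. u i) (L e))) (edge_set d)"
    by (rule unif_env.indep_vars_compose2[OF unif_env.indep_vars_restrict[OF indep_unif_env[OF d] _ disj]])
      (use L Ym in auto)
  moreover have "(\<lambda>u. Y e (restrict (\<lambda>i. u i) (L e))) = (\<lambda>u. block_open L eps u e)" for e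
    by (auto simp: Y_def block_open_def fun_eq_iff)
  ultimately have ind: "unif_env.indep_vars d (\<lambda>_. count_space UNIV) (\<lambda>e u. block_open L eps u e) (edge_set d)"
    by simp
  then have rv: "(\<lambda>u. block_open L eps u e) \<in> measurable (unif_env d) (count_space UNIV)" if "e \<in> edge_set d" for e
    using that by (auto simp: unif_env.indep_vars_def)
  have "distr (unif_env d) (\<Pi>\<^sub>M e\<in>edge_set d. count_space UNIV) (\<lambda>u. \<lambda>e\<in>edge_set d. block_open L eps u e)
     = (\<Pi>\<^sub>M e\<in>edge_set d. distr (unif_env d) (count_space UNIV) (\<lambda>u. block_open L eps u e))"
    using unif_env.indep_vars_iff_distr_eq_PiM'[where X = "\<lambda>e u. block_open L eps u e", OF ne rv] ind by simp
  also have "\<dots> = env d (1 - (1 - eps) ^ K)"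
    unfolding env_def
  proof (rule PiM_cong)
    fix e assume e: "e \<in> edge_set d"
    note [measurable] = rv[OF e]
    have p: "0 \<le> (1 - eps) ^ K" "(1 - eps) ^ K \<le> 1" using eps by (auto intro: power_le_one)
    have "block_open L eps u e = 1 \<longleftrightarrow> (\<forall>i\<in>L e. u i \<in> {eps..})" for u
      by (simp add: block_open_def) (meson not_le)
    then have "(\<lambda>u. block_open L eps u e) -` {1} \<inter> space (unif_env d) = {u \<in> space (unif_env d). \<forall>i\<in>L e. u i \<in> {eps..}}"
      by blast
    then have 1: "emeasure (distr (unif_env d) (count_space UNIV) (\<lambda>u. block_open L eps u e)) {1}
      = (\<Prod>i\<in>L e. emeasure unif01 {eps..})"
      using L[OF e] unif_prod.emeasure_PiM_Collect[of "L e" d "\<lambda>_. {eps..}"]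
      by (subst emeasure_distr[OF rv[OF e]]) (auto simp: unif_env_def)
    also have "\<dots> = ennreal ((1 - eps) ^ K)"
      using L[OF e] eps by (simp add: emeasure_unif01_ge ennreal_power)
    finally have 1: "emeasure (distr (unif_env d) (count_space UNIV) (\<lambda>u. block_open L eps u e)) {1} = ennreal ((1 - eps) ^ K)" .
    interpret N: prob_space "distr (unif_env d) (count_space UNIV) (\<lambda>u. block_open L eps u e)"
      by (rule unif_env.prob_space_distr) simp
    let ?N = "distr (unif_env d) (count_space UNIV) (\<lambda>u. block_open L eps u e)"
    have n: "emeasure ?N {n} = 0" if "n \<noteq> 0" "n \<noteq> 1" for n
    proof -
      have "(\<lambda>u. block_open L eps u e) -` {n} \<inter> space (unif_env d) = {}"
        using that by (auto simp: block_open_def split: if_splits)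
      then show ?thesis by (subst emeasure_distr) auto
    qed
    have "emeasure ?N {0} = emeasure ?N (space ?N - {1})"
    proof -
      have "(\<lambda>u. block_open L eps u e) -` {0} \<inter> space (unif_env d) = (\<lambda>u. block_open L eps u e) -` (UNIV - {1}) \<inter> space (unif_env d)"
        by (auto simp: block_open_def split: if_splits)
      then show ?thesis by (simp add: emeasure_distr)
    qed
    also have "\<dots> = 1 - ennreal ((1 - eps) ^ K)"
      using N.emeasure_space_1 1 by (subst emeasure_compl) auto
    also have "\<dots> = ennreal (1 - (1 - eps) ^ K)" using p
      by (metis ennreal_1 ennreal_minus)
    finally show "?N = edge_law (1 - (1 - eps) ^ K)"
      using p 1 n by (intro edge_law_eqI) auto
  qed simp
  finally show ?thesis .
qed

text \<open>Paths are finite integer lists, hence countably many, and each path time depends on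
  finitely many edges. Written with \<open>LEAST\<close>, the infimum is visibly built from
  countably many measurable conditions.\<close>

lemma measurable_passage_time:
  "(\<lambda>\<tau>. passage_time d \<tau> x y) \<in> measurable (\<Pi>\<^sub>M e\<in>edge_set d. count_space UNIV) (count_space UNIV)"
proof -
  have eq: "passage_time d \<tau> x y = (LEAST n. \<exists>p. is_path d x y p \<and> n = path_time \<tau> p)" for \<tau>
    unfolding passage_time_def Inf_nat_def by (simp add: conj_commute)
  have [measurable]: "(\<lambda>\<tau>. path_time \<tau> p) \<in> measurable (\<Pi>\<^sub>M e\<in>edge_set d. count_space UNIV) (count_space UNIV)"
    if "is_path d x y p" for p
    unfolding path_time_def
    by (rule measurable_sum_nat) (use that edge_between_in in \<open>auto simp: is_path_def intro!: measurable_component_singleton\<close>)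
  have [measurable]: "Measurable.pred (\<Pi>\<^sub>M e\<in>edge_set d. count_space UNIV) (\<lambda>\<tau>. is_path d x y p \<and> n = path_time \<tau> p)" for p n
    by (cases "is_path d x y p") simp_all
  show ?thesis unfolding eq by measurable
qed


lemma block_open_measurable:
  assumes L: "\<And>e. e \<in> edge_set d \<Longrightarrow> L e \<subseteq> edge_set d \<and> finite (L e)"
  shows "(\<lambda>u. \<lambda>e\<in>edge_set d. block_open L eps u e) \<in> measurable (unif_env d) (\<Pi>\<^sub>M e\<in>edge_set d. count_space UNIV)"
proof (rule measurable_restrict)
  fix e assume e: "e \<in> edge_set d"
  have "(\<lambda>u. u f) \<in> borel_measurable (unif_env d)" if "f \<in> L e" for f
    unfolding unif_env_def using L[OF e] that measurable_component_singleton[of f "edge_set d" "\<lambda>_. unif01"] by auto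
  then have [measurable]: "Measurable.pred (unif_env d) (\<lambda>u. u f < eps)" if "f \<in> L e" for f
    using that by (simp add: pred_def)
  have [measurable]: "finite (L e)" using L[OF e] by simp
  show "(\<lambda>u. block_open L eps u e) \<in> measurable (unif_env d) (count_space UNIV)"
    unfolding block_open_def by measurable
qed

lemma passage_block_measurable:
  assumes L: "\<And>e. e \<in> edge_set d \<Longrightarrow> L e \<subseteq> edge_set d \<and> finite (L e)"
  shows "(\<lambda>u. real (passage_time d (block_open L eps u) x y)) \<in> borel_measurable (unif_env d)"
proof -
  have eq: "passage_time d (block_open L eps u) x y = passage_time d (\<lambda>e\<in>edge_set d. block_open L eps u e) x y" for u
    by (rule passage_time_cong) simp
  have "(\<lambda>u. passage_time d (\<lambda>e\<in>edge_set d. block_open L eps u e) x y) \<in> measurable (unif_env d) (count_space UNIV)"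
    by (rule measurable_compose[OF block_open_measurable[OF L] measurable_passage_time])
  then show ?thesis unfolding eq by measurable
qed

lemma passage_block_integrable:
  assumes L: "\<And>e. e \<in> edge_set d \<Longrightarrow> L e \<subseteq> edge_set d \<and> finite (L e)"
    and "length x = d" "length y = d"
  shows "integrable (unif_env d) (\<lambda>u. real (passage_time d (block_open L eps u) x y))"
proof (rule unif_env.integrable_const_bound[where B = "real_of_int (dist1 x y)"])
  show "AE u in unif_env d. norm (real (passage_time d (block_open L eps u) x y)) \<le> real_of_int (dist1 x y)"
  proof (rule AE_I2)
    fix u
    have "int (passage_time d (block_open L eps u) x y) \<le> dist1 x y"
      by (rule passage_time_le_dist1[OF assms(2,3)]) (rule block_open_le)
    then show "norm (real (passage_time d (block_open L eps u) x y)) \<le> real_of_int (dist1 x y)" by simp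
  qed
qed (rule passage_block_measurable[OF L])

text \<open>Turns the identity of laws into one of expectations: the environment of parameter 1 - (1
  - eps)^K may be replaced by a coarse one built from the same labels as the fine environment, so
  that the two can be compared label by label.\<close>

lemma block_expect:
  assumes eps: "0 \<le> eps" "eps \<le> 1" and d: "d > 0"
    and L: "\<And>e. e \<in> edge_set d \<Longrightarrow> L e \<subseteq> edge_set d \<and> finite (L e) \<and> card (L e) = K"
    and disj: "disjoint_family_on L (edge_set d)"
  shows "(\<integral>\<tau>. real (passage_time d \<tau> x y) \<partial>env d (1 - (1 - eps) ^ K))
    = (\<integral>u. real (passage_time d (block_open L eps u) x y) \<partial>unif_env d)"
proof -
  have "(\<integral>\<tau>. real (passage_time d \<tau> x y) \<partial>env d (1 - (1 - eps) ^ K))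
    = (\<integral>u. real (passage_time d (\<lambda>e\<in>edge_set d. block_open L eps u e) x y) \<partial>unif_env d)"
  proof -
    have "(\<lambda>\<tau>. real (passage_time d \<tau> x y)) \<in> borel_measurable (\<Pi>\<^sub>M e\<in>edge_set d. count_space UNIV)"
      by (rule measurable_compose[OF measurable_passage_time]) simp
    moreover have "(\<lambda>u. \<lambda>e\<in>edge_set d. block_open L eps u e) \<in> measurable (unif_env d) (\<Pi>\<^sub>M e\<in>edge_set d. count_space UNIV)"
      by (rule block_open_measurable) (use L in blast)
    moreover have "env d (1 - (1 - eps) ^ K) = distr (unif_env d) (\<Pi>\<^sub>M e\<in>edge_set d. count_space UNIV) (\<lambda>u. \<lambda>e\<in>edge_set d. block_open L eps u e)"
      by (rule block_law[OF eps d L disj, symmetric])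
    ultimately show ?thesis by (simp add: integral_distr)
  qed
  also have "\<dots> = (\<integral>u. real (passage_time d (block_open L eps u) x y) \<partial>unif_env d)"
    by (intro Bochner_Integration.integral_cong refl arg_cong[of _ _ real] passage_time_cong) simp
  finally show ?thesis .
qed

section \<open>Mean passage times: symmetries, subadditivity, monotonicity in eps\<close>

definition mean_time :: "nat \<Rightarrow> real \<Rightarrow> int list \<Rightarrow> int list \<Rightarrow> real" where
  "mean_time d eps x y = (\<integral>u. real (passage_time d (thresh eps u) x y) \<partial>unif_env d)"

lemma thresh_block: "thresh eps u = block_open (\<lambda>e. {e}) eps u"
  by (simp add: thresh_def block_open_def fun_eq_iff)

lemma passage_thresh_integrable:
  "length x = d \<Longrightarrow> length y = d \<Longrightarrow> integrable (unif_env d) (\<lambda>u. real (passage_time d (thresh eps u) x y))"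
  unfolding thresh_block by (rule passage_block_integrable) auto

lemma env_expect:
  assumes "0 \<le> eps" "eps \<le> 1" "d > 0"
  shows "(\<integral>\<tau>. real (passage_time d \<tau> x y) \<partial>env d eps) = mean_time d eps x y"
  using block_expect[OF assms, of "\<lambda>e. {e}" 1] unfolding mean_time_def thresh_block
  by (simp add: disjoint_family_on_def)

lemma edge_between_ends:
  assumes "adjacent d u v"
  shows "{fst (edge_between u v), step_up (fst (edge_between u v)) (snd (edge_between u v))} = {u, v}"
proof -
  have l: "length u = d" "length v = d" using assms by (auto dest: adjacent_length)
  from assms show ?thesis by (cases rule: adjacentE) (use l in auto)
qed

text \<open>A lattice symmetry may reverse the orientation of an edge. Identifying an edge with its
  unordered pair of ends makes the action on edges visibly injective.\<close>

lemma edge_ends_inj: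
  assumes "e \<in> edge_set d" "e' \<in> edge_set d"
    "{fst e, step_up (fst e) (snd e)} = {fst e', step_up (fst e') (snd e')}"
  shows "e = e'"
proof -
  obtain x i y j where e: "e = (x, i)" "e' = (y, j)" by (cases e, cases e')
  have l: "length x = d" "length y = d" "i < d" "j < d" using assms(1,2) by (auto simp: e edge_set_def)
  have "{x, step_up x i} = {y, step_up y j}" using assms(3) by (simp add: e)
  then have "x = y \<and> step_up x i = step_up y j \<or> x = step_up y j \<and> y = step_up x i"
    unfolding doubleton_eq_iff by metis
  then show ?thesis
  proof (elim disjE conjE)
    assume "x = y" "step_up x i = step_up y j"
    then show ?thesis using step_up_inj[of i x j] l by (simp add: e)
  next
    assume a: "x = step_up y j" "y = step_up x i"
    then have "step_up (step_up y j) i = y" by simp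
    then show ?thesis using step_up_neq2[of j y i] l by simp
  qed
qed

text \<open>Being injective, \<open>f\<close> acts injectively on edges, so the labels read at image
  edges form again an i.i.d. environment. An optimal path from x to y in that environment is carried
  to a path of the same time between the image points. For a symmetry, the reverse inequality comes
  from its inverse.\<close>

lemma mean_time_image_le:
  assumes eps: "0 \<le> eps" "eps \<le> 1" and d: "d > 0" and xy: "length x = d" "length y = d"
    and adj: "\<And>u v. adjacent d u v \<Longrightarrow> adjacent d (f u) (f v)" and inj: "inj_on f {v. length v = d}"
  shows "mean_time d eps (f x) (f y) \<le> mean_time d eps x y"
proof -
  have lf: "length (f v) = d" if "length v = d" for v
    using adj[OF adjacent_step_up[OF that d]] by (simp add: adjacent_def)
  define F where "F e = edge_between (f (fst e)) (f (step_up (fst e) (snd e)))" for e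
  have adjF: "adjacent d (f (fst e)) (f (step_up (fst e) (snd e)))" if "e \<in> edge_set d" for e
    using that by (intro adj adjacent_step_up) (auto simp: edge_set_def)
  have F_in: "F e \<in> edge_set d" if "e \<in> edge_set d" for e
    unfolding F_def by (rule edge_between_in[OF adjF[OF that]])
  have F_ends: "{fst (F e), step_up (fst (F e)) (snd (F e))} = f ` {fst e, step_up (fst e) (snd e)}"
    if "e \<in> edge_set d" for e
    using edge_between_ends[OF adjF[OF that]] by (simp add: F_def)
  have F_inj: "e = e'" if "e \<in> edge_set d" "e' \<in> edge_set d" "F e = F e'" for e e'
  proof (rule edge_ends_inj[OF that(1,2)])
    have "f ` {fst e, step_up (fst e) (snd e)} = f ` {fst e', step_up (fst e') (snd e')}"
      using F_ends[OF that(1)] F_ends[OF that(2)] that(3) by simp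
    then show "{fst e, step_up (fst e) (snd e)} = {fst e', step_up (fst e') (snd e')}"
      by (subst (asm) inj_on_image_eq_iff[OF inj]) (use that(1,2) in \<open>auto simp: edge_set_def\<close>)
  qed
  let ?L = "\<lambda>e. {F e}"
  have bl: "block_open ?L eps u e = thresh eps u (F e)" for u e
    by (simp add: block_open_def thresh_def)
  have le: "passage_time d (thresh eps u) (f x) (f y) \<le> passage_time d (block_open ?L eps u) x y" for u
  proof -
    obtain p where p: "is_path d x y p" "passage_time d (block_open ?L eps u) x y = path_time (block_open ?L eps u) p"
      using passage_time_attained[OF xy, of "block_open ?L eps u"] by blast
    have ip: "is_path d (f x) (f y) (map f p)"
      using p(1) adj by (auto simp: is_path_def hd_map last_map)
    have "path_time (thresh eps u) (map f p) = path_time (block_open ?L eps u) p"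
      unfolding path_time_def length_map
    proof (rule sum.cong[OF refl])
      fix k assume "k \<in> {..<length p - 1}"
      then have k: "k < length p" "Suc k < length p" and a: "adjacent d (p ! k) (p ! Suc k)"
        using p(1) by (auto simp: is_path_def)
      have "F (edge_between (p ! k) (p ! Suc k)) = edge_between (f (p ! k)) (f (p ! Suc k))"
      proof (rule edge_ends_inj[OF F_in[OF edge_between_in[OF a]] edge_between_in[OF adj[OF a]]])
        show "{fst (F (edge_between (p ! k) (p ! Suc k))), step_up (fst (F (edge_between (p ! k) (p ! Suc k)))) (snd (F (edge_between (p ! k) (p ! Suc k))))}
          = {fst (edge_between (f (p ! k)) (f (p ! Suc k))), step_up (fst (edge_between (f (p ! k)) (f (p ! Suc k)))) (snd (edge_between (f (p ! k)) (f (p ! Suc k))))}"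
          unfolding F_ends[OF edge_between_in[OF a]] edge_between_ends[OF adj[OF a]] edge_between_ends[OF a] by simp
      qed
      then show "thresh eps u (edge_between (map f p ! k) (map f p ! Suc k)) = block_open ?L eps u (edge_between (p ! k) (p ! Suc k))"
        using k by (simp add: bl)
    qed
    then show ?thesis using passage_time_le[OF ip, of "thresh eps u"] p(2) by simp
  qed
  have "mean_time d eps (f x) (f y) \<le> (\<integral>u. real (passage_time d (block_open ?L eps u) x y) \<partial>unif_env d)"
    unfolding mean_time_def
    by (rule integral_mono[OF passage_thresh_integrable passage_block_integrable])
      (use lf xy F_in le in auto)
  also have "\<dots> = (\<integral>\<tau>. real (passage_time d \<tau> x y) \<partial>env d (1 - (1 - eps) ^ 1))"
    by (rule block_expect[OF eps d, symmetric])
      (use F_in F_inj in \<open>auto simp: disjoint_family_on_def\<close>)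
  also have "\<dots> = mean_time d eps x y" using env_expect[OF eps d] by simp
  finally show ?thesis .
qed

lemma mean_time_triangle:
  assumes "length x = d" "length y = d" "length z = d"
  shows "mean_time d eps x z \<le> mean_time d eps x y + mean_time d eps y z"
proof -
  have "mean_time d eps x z \<le> (\<integral>u. real (passage_time d (thresh eps u) x y) + real (passage_time d (thresh eps u) y z) \<partial>unif_env d)"
    unfolding mean_time_def
    by (intro integral_mono Bochner_Integration.integrable_add passage_thresh_integrable assms)
      (use passage_time_triangle[OF assms] in \<open>simp flip: of_nat_add\<close>)
  also have "\<dots> = mean_time d eps x y + mean_time d eps y z"
    unfolding mean_time_def
    by (intro Bochner_Integration.integral_add passage_thresh_integrable assms)
  finally show ?thesis .
qed

lemma mean_time_nonneg: "mean_time d eps x y \<ge> 0"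
  unfolding mean_time_def by simp

lemma mean_time_le_dist1:
  assumes "length x = d" "length y = d"
  shows "mean_time d eps x y \<le> real_of_int (dist1 x y)"
proof -
  have "mean_time d eps x y \<le> (\<integral>u. real_of_int (dist1 x y) \<partial>unif_env d)"
    unfolding mean_time_def
  proof (intro integral_mono passage_thresh_integrable assms)
    fix u
    have "int (passage_time d (thresh eps u) x y) \<le> dist1 x y"
      by (rule passage_time_le_dist1[OF assms]) (rule thresh_le)
    then show "real (passage_time d (thresh eps u) x y) \<le> real_of_int (dist1 x y)" by linarith
  qed simp
  then show ?thesis by (simp add: unif_env.prob_space)
qed

lemma mean_time_antimono:
  assumes "length x = d" "length y = d" "eps \<le> eps'"
  shows "mean_time d eps' x y \<le> mean_time d eps x y"
  unfolding mean_time_def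
  by (intro integral_mono passage_thresh_integrable assms of_nat_mono passage_time_mono)
    (use assms(3) in \<open>auto simp: thresh_def\<close>)

definition vadd :: "int list \<Rightarrow> int list \<Rightarrow> int list" where
  "vadd x y = map (\<lambda>i. x ! i + y ! i) [0..<length x]"

lemma length_vadd [simp]: "length (vadd x y) = length x"
  by (simp add: vadd_def)

lemma nth_vadd [simp]: "i < length x \<Longrightarrow> vadd x y ! i = x ! i + y ! i"
  by (simp add: vadd_def)

lemma mean_time_translate:
  assumes eps: "0 \<le> eps" "eps \<le> 1" and d: "d > 0" and xy: "length x = d" "length y = d"
  shows "mean_time d eps x (vadd x y) \<le> mean_time d eps (origin d) y"
proof -
  have "mean_time d eps (vadd x (origin d)) (vadd x y) \<le> mean_time d eps (origin d) y"
  proof (rule mean_time_image_le[OF eps d])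
    show "inj_on (vadd x) {v. length v = d}"
    proof (rule inj_onI)
      fix u v assume a: "u \<in> {v. length v = d}" "v \<in> {v. length v = d}" "vadd x u = vadd x v"
      have "u ! i = v ! i" if "i < d" for i
        using arg_cong[OF a(3), of "\<lambda>w. w ! i"] that xy by simp
      then show "u = v" using a by (intro nth_equalityI) auto
    qed
  qed (use xy in \<open>auto simp: adjacent_def\<close>)
  moreover have "vadd x (origin d) = x" by (rule nth_equalityI) (use xy in auto)
  ultimately show ?thesis by simp
qed

lemma mean_time_subadd:
  assumes "0 \<le> eps" "eps \<le> 1" "d > 0" "length x = d" "length y = d"
  shows "mean_time d eps (origin d) (vadd x y) \<le> mean_time d eps (origin d) x + mean_time d eps (origin d) y"
  using mean_time_triangle[of "origin d" d x "vadd x y" eps] mean_time_translate[OF assms] assms by simp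

lemma mean_time_lipschitz:
  assumes "length x = d" "length y = d"
  shows "mean_time d eps (origin d) y \<le> mean_time d eps (origin d) x + real_of_int (dist1 x y)"
  using mean_time_triangle[of "origin d" d x y eps] mean_time_le_dist1[of x d y eps] assms by simp

section \<open>The time constant\<close>

text \<open>Fekete's lemma. Nonnegativity makes the infimum of \<open>a n / n\<close> over n \<ge> 1
  finite, and this infimum is the limit.\<close>

lemma subadditive_convergent:
  fixes a :: "nat \<Rightarrow> real"
  assumes sub: "\<And>m n. a (m + n) \<le> a m + a n" and nn: "\<And>n. a n \<ge> 0"
  shows "\<exists>L. (\<lambda>n. a n / real n) \<longlonglongrightarrow> L"
proof -
  define S where "S = (\<lambda>n. a n / real n) ` {1..}"
  define L where "L = Inf S"
  have bdd: "bdd_below S" unfolding S_def using nn by (intro bdd_belowI[of _ 0]) auto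
  have ne: "S \<noteq> {}" by (auto simp: S_def)
  have lower: "L \<le> a n / real n" if "n \<ge> 1" for n
    unfolding L_def using bdd that by (intro cInf_lower) (auto simp: S_def)
  have "(\<lambda>n. a n / real n) \<longlonglongrightarrow> L"
  proof (rule LIMSEQ_I)
    fix e :: real assume e: "e > 0"
    obtain s where "s \<in> S" "s < L + e / 2"
      using cInf_lessD[OF ne, of "L + e / 2"] e by (auto simp: L_def)
    then obtain m where m: "m \<ge> 1" "a m / real m < L + e / 2" by (auto simp: S_def)
    have qr: "a (q * m + r) \<le> real q * a m + a r" for q r
    proof (induction q)
      case (Suc q)
      have "a (Suc q * m + r) = a (m + (q * m + r))" by (simp add: algebra_simps)
      also have "\<dots> \<le> a m + a (q * m + r)" by (rule sub)
      also have "\<dots> \<le> a m + (real q * a m + a r)" using Suc by simp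
      finally show ?case by (simp add: algebra_simps)
    qed simp
    \<comment> \<open>One bound for all remainders of a division by m; the sum serves as a crude
      maximum.\<close>
    define M where "M = (\<Sum>r<m. a r)"
    have M: "a r \<le> M" if "r < m" for r unfolding M_def using that nn by (intro member_le_sum) auto
    have M0: "M \<ge> 0" unfolding M_def by (intro sum_nonneg nn)
    obtain N :: nat where N0: "real N > max 1 (2 * M / e)" using reals_Archimedean2 by blast
    then have N: "real N > 2 * M / e" "N \<ge> 1" by auto
    show "\<exists>no. \<forall>n\<ge>no. norm (a n / real n - L) < e"
    proof (intro exI allI impI)
      fix n assume n: "n \<ge> N"
      then have n1: "n \<ge> 1" "real n > 0" using N by auto
      have "a n \<le> real (n div m) * a m + M"
        using qr[of "n div m" "n mod m"] M[of "n mod m"] m by (simp add: mult.commute)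
      also have "real (n div m) * a m \<le> real n / real m * a m"
        using nn by (intro mult_right_mono of_nat_div_le_of_nat) auto
      finally have "a n / real n \<le> (real n / real m * a m + M) / real n"
        using n1 by (intro divide_right_mono) auto
      also have "\<dots> = a m / real m + M / real n" using n1 by (simp add: field_simps)
      finally have 1: "a n / real n \<le> a m / real m + M / real n" .
      have "2 * M / e < real n" using N n by linarith
      then have "M / real n < e / 2" using e n1 by (simp add: field_simps)
      with 1 m have "a n / real n < L + e" by linarith
      with lower[OF n1(1)] e show "norm (a n / real n - L) < e" unfolding real_norm_def by linarith
    qed
  qed
  then show ?thesis ..
qed

definition nvec :: "nat \<Rightarrow> real list \<Rightarrow> int list" where
  "nvec n z = floor_vec (map (\<lambda>t. real n * t) z)"

lemma length_nvec [simp]: "length (nvec n z) = length z"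
  by (simp add: nvec_def floor_vec_def)

lemma nth_nvec [simp]: "i < length z \<Longrightarrow> nvec n z ! i = \<lfloor>real n * z ! i\<rfloor>"
  by (simp add: nvec_def floor_vec_def)

abbreviation mean_time0 :: "nat \<Rightarrow> real \<Rightarrow> int list \<Rightarrow> real" where
  "mean_time0 d eps y \<equiv> mean_time d eps (origin d) y"

lemma dist1_le:
  assumes "length x = d" "\<And>i. i < d \<Longrightarrow> \<bar>real_of_int (x ! i) - real_of_int (y ! i)\<bar> \<le> c i"
  shows "real_of_int (dist1 x y) \<le> (\<Sum>i<d. c i)"
  unfolding dist1_def assms(1) of_int_sum
  by (rule sum_mono) (use assms(2) in \<open>auto simp flip: of_int_diff\<close>)

text \<open>\<open>lim\<close> is informative for convergent sequences only, so every property of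
  \<open>time_const\<close> passes through this convergence.\<close>

lemma time_const_LIMSEQ:
  assumes eps: "0 \<le> eps" "eps \<le> 1" and d: "d > 0" and z: "length z = d"
  shows "(\<lambda>n. mean_time0 d eps (nvec n z) / real n) \<longlonglongrightarrow> time_const d eps z"
proof -
  \<comment> \<open>Rounding makes the means subadditive only up to an error of at most 2 per
    coordinate. The added constant 2 * d absorbs it, since the right-hand side of the subadditivity
    inequality carries the constant twice, and it vanishes after division by n.\<close>
  define b where "b n = mean_time0 d eps (nvec n z) + 2 * real d" for n
  have "\<exists>L. (\<lambda>n. b n / real n) \<longlonglongrightarrow> L"
  proof (rule subadditive_convergent)
    fix m n
    have "real_of_int (dist1 (vadd (nvec m z) (nvec n z)) (nvec (m + n) z)) \<le> (\<Sum>i<d. 2)"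
    proof (rule dist1_le)
      fix i assume "i < d"
      then show "\<bar>real_of_int (vadd (nvec m z) (nvec n z) ! i) - real_of_int (nvec (m + n) z ! i)\<bar> \<le> 2"
        using z by (simp add: algebra_simps) linarith
    qed (use z in simp)
    then show "b (m + n) \<le> b m + b n"
      using mean_time_lipschitz[of "vadd (nvec m z) (nvec n z)" d "nvec (m + n) z" eps]
        mean_time_subadd[OF eps d, of "nvec m z" "nvec n z"] z by (simp add: b_def)
  qed (simp add: b_def mean_time_nonneg)
  then obtain L where L: "(\<lambda>n. b n / real n) \<longlonglongrightarrow> L" ..
  have "(\<lambda>n. b n / real n - (2 * real d) / real n) \<longlonglongrightarrow> L - 0"
    by (intro tendsto_diff L lim_const_over_n)
  then have L': "(\<lambda>n. mean_time0 d eps (nvec n z) / real n) \<longlonglongrightarrow> L"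
    by (simp add: b_def add_divide_distrib)
  moreover have "time_const d eps z = L"
    unfolding time_const_def env_expect[OF eps d]
    using limI[OF L'] by (simp add: nvec_def)
  ultimately show ?thesis by simp
qed

text \<open>Carries inequalities between means over to time constants: bounded errors disappear,
  errors linear in n survive with their slope.\<close>

lemma LIMSEQ_linear_le:
  fixes a b :: "nat \<Rightarrow> real"
  assumes "(\<lambda>n. a n / real n) \<longlonglongrightarrow> x" "(\<lambda>n. b n / real n) \<longlonglongrightarrow> y"
    "\<And>n. a n \<le> b n + c * real n + c'"
  shows "x \<le> y + c"
proof -
  have "(\<lambda>n. b n / real n + c + c' / real n) \<longlonglongrightarrow> y + c + 0"
    by (intro tendsto_add assms lim_const_over_n tendsto_const)
  moreover have "\<forall>\<^sub>F n in sequentially. a n / real n \<le> b n / real n + c + c' / real n"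
    using eventually_gt_at_top[of 0]
  proof eventually_elim
    case (elim n)
    then have "a n / real n \<le> (b n + c * real n + c') / real n" using assms(3) by (intro divide_right_mono) auto
    then show ?case using elim by (simp add: add_divide_distrib)
  qed
  ultimately show ?thesis
    using tendsto_le[OF sequentially_bot _ assms(1), of "\<lambda>n. b n / real n + c + c' / real n" "y + c + 0"] by simp
qed

lemma time_const_lipschitz:
  assumes eps: "0 \<le> eps" "eps \<le> 1" and d: "d > 0" and z: "length z = d" "length w = d"
  shows "time_const d eps w \<le> time_const d eps z + (\<Sum>i<d. \<bar>z ! i - w ! i\<bar>)"
proof (rule LIMSEQ_linear_le[OF time_const_LIMSEQ[OF eps d z(2)] time_const_LIMSEQ[OF eps d z(1)]])
  fix n
  have "real_of_int (dist1 (nvec n z) (nvec n w)) \<le> (\<Sum>i<d. real n * \<bar>z ! i - w ! i\<bar> + 1)"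
  proof (rule dist1_le)
    fix i assume i: "i < d"
    have "real n * \<bar>z ! i - w ! i\<bar> = \<bar>real n * z ! i - real n * w ! i\<bar>"
      by (simp add: abs_mult flip: right_diff_distrib)
    then show "\<bar>real_of_int (nvec n z ! i) - real_of_int (nvec n w ! i)\<bar> \<le> real n * \<bar>z ! i - w ! i\<bar> + 1"
      using i z by simp linarith
  qed (use z in simp)
  then show "mean_time0 d eps (nvec n w) \<le> mean_time0 d eps (nvec n z) + (\<Sum>i<d. \<bar>z ! i - w ! i\<bar>) * real n + real d"
    using mean_time_lipschitz[of "nvec n z" d "nvec n w" eps] z
    by (simp add: sum.distrib mult.commute flip: sum_distrib_left)
qed

lemma time_const_antimono:
  assumes eps: "0 \<le> eps" "eps \<le> eps'" "eps' \<le> 1" and d: "d > 0" and z: "length z = d"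
  shows "time_const d eps' z \<le> time_const d eps z"
  using LIMSEQ_linear_le[OF time_const_LIMSEQ[of eps' d z] time_const_LIMSEQ[of eps d z], of 0 0]
    mean_time_antimono[of "origin d" d "nvec _ z" eps eps'] assms by simp

text \<open>For an integer factor, the scaled sequence is exactly a subsequence of the original one,
  without rounding error. Integer factors suffice later because box sides are adapted to an integer
  scale N.\<close>

lemma time_const_nat_scale:
  assumes eps: "0 \<le> eps" "eps \<le> 1" and d: "d > 0" and z: "length z = d" and m: "m > 0"
  shows "time_const d eps (map (\<lambda>t. real m * t) z) = real m * time_const d eps z"
proof (rule LIMSEQ_unique)
  show "(\<lambda>n. mean_time0 d eps (nvec n (map (\<lambda>t. real m * t) z)) / real n) \<longlonglongrightarrow> time_const d eps (map (\<lambda>t. real m * t) z)"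
    using assms by (intro time_const_LIMSEQ) auto
  have "strict_mono (\<lambda>n. n * m)" using m by (simp add: strict_mono_def)
  from LIMSEQ_subseq_LIMSEQ[OF time_const_LIMSEQ[OF eps d z] this]
  have "(\<lambda>n. real m * (mean_time0 d eps (nvec (n * m) z) / real (n * m))) \<longlonglongrightarrow> real m * time_const d eps z"
    by (intro tendsto_mult tendsto_const) (simp add: o_def)
  moreover have "nvec (n * m) z = nvec n (map (\<lambda>t. real m * t) z)" for n
    by (simp add: nvec_def o_def mult.assoc)
  moreover have "real m * (x / real (n * m)) = x / real n" for x n using m by simp
  ultimately show "(\<lambda>n. mean_time0 d eps (nvec n (map (\<lambda>t. real m * t) z)) / real n) \<longlonglongrightarrow> real m * time_const d eps z"
    by simp
qed

text \<open>Multiples of an integer vector need no rounding, so subadditivity applies without error.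
  This is how a finite box yields a lower bound on the gain.\<close>

lemma time_const_le_mean_time:
  assumes eps: "0 \<le> eps" "eps \<le> 1" and d: "d > 0" and y: "length y = d"
  shows "time_const d eps (map real_of_int y) \<le> mean_time0 d eps y"
proof -
  have "mean_time0 d eps (nvec n (map real_of_int y)) \<le> mean_time0 d eps y * real n" for n
  proof (induction n)
    case 0
    have "nvec 0 (map real_of_int y) = origin d" by (rule nth_equalityI) (use y in auto)
    then show ?case using mean_time_le_dist1[of "origin d" d "origin d" eps] by (simp add: dist1_def)
  next
    case (Suc n)
    have "nvec (Suc n) (map real_of_int y) = vadd (nvec n (map real_of_int y)) y"
    proof (rule nth_equalityI)
      fix i assume "i < length (nvec (Suc n) (map real_of_int y))"
      moreover have "\<lfloor>real (Suc n) * real_of_int t\<rfloor> = \<lfloor>real n * real_of_int t\<rfloor> + t" for t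
      proof -
        have "real (Suc n) * real_of_int t = real n * real_of_int t + real_of_int t" by (simp add: algebra_simps)
        then show ?thesis by simp
      qed
      ultimately show "nvec (Suc n) (map real_of_int y) ! i = vadd (nvec n (map real_of_int y)) y ! i" by simp
    qed simp
    then show ?case
      using mean_time_subadd[OF eps d, of "nvec n (map real_of_int y)" y] y Suc by (simp add: algebra_simps)
  qed
  then show ?thesis
    using LIMSEQ_linear_le[OF time_const_LIMSEQ[OF eps d, of "map real_of_int y"], of "\<lambda>_. 0" 0 "mean_time0 d eps y" 0] y
    by simp
qed

lemma time_const_signed_permutation_le:
  fixes s :: "nat \<Rightarrow> int"
  assumes eps: "0 \<le> eps" "eps \<le> 1" and d: "d > 0" and z: "length z = d"
    and s: "\<And>i. \<bar>s i\<bar> = 1" and \<sigma>: "bij_betw \<sigma> {..<d} {..<d}"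
  shows "time_const d eps (map (\<lambda>i. real_of_int (s i) * z ! (\<sigma> i)) [0..<d]) \<le> time_const d eps z"
proof -
  define f where "f v = map (\<lambda>i. s i * v ! (\<sigma> i)) [0..<d]" for v :: "int list"
  let ?w = "map (\<lambda>i. real_of_int (s i) * z ! (\<sigma> i)) [0..<d]"
  have \<sigma>d: "\<sigma> i < d" if "i < d" for i using \<sigma> that by (auto simp: bij_betw_def)
  have im: "mean_time d eps (f (origin d)) (f y) \<le> mean_time d eps (origin d) y" if "length y = d" for y
  proof (rule mean_time_image_le[OF eps d])
    fix u v assume "adjacent d u v"
    then have l: "length u = d" "length v = d" "(\<Sum>i<d. \<bar>u ! i - v ! i\<bar>) = 1" by (auto simp: adjacent_def)
    have "(\<Sum>i<d. \<bar>f u ! i - f v ! i\<bar>) = (\<Sum>i<d. \<bar>u ! \<sigma> i - v ! \<sigma> i\<bar>)"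
      by (rule sum.cong) (use s in \<open>auto simp: f_def abs_mult simp flip: right_diff_distrib\<close>)
    also have "\<dots> = (\<Sum>i<d. \<bar>u ! i - v ! i\<bar>)"
      by (rule sum.reindex_bij_betw[OF \<sigma>])
    finally show "adjacent d (f u) (f v)" using l by (simp add: adjacent_def f_def)
  next
    show "inj_on f {v. length v = d}"
    proof (rule inj_onI)
      fix u v assume a: "u \<in> {v. length v = d}" "v \<in> {v. length v = d}" "f u = f v"
      have "u ! \<sigma> i = v ! \<sigma> i" if "i < d" for i
        using arg_cong[OF a(3), of "\<lambda>w. w ! i"] that s[of i] by (auto simp: f_def)
      then have "u ! i = v ! i" if "i < d" for i
      proof -
        have "i \<in> \<sigma> ` {..<d}" using \<sigma> that by (simp add: bij_betw_def)
        with that show ?thesis using \<open>\<And>i. i < d \<Longrightarrow> u ! \<sigma> i = v ! \<sigma> i\<close> by auto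
      qed
      then show "u = v" using a by (intro nth_equalityI) auto
    qed
  qed (use that in auto)
  have fo: "f (origin d) = origin d" by (rule nth_equalityI) (auto simp: f_def \<sigma>d)
  \<comment> \<open>The integer part does not commute with a change of sign. The discrepancy is at
    most 2 per coordinate and vanishes after division by n.\<close>
  have "mean_time0 d eps (nvec n ?w) \<le> mean_time0 d eps (nvec n z) + 0 * real n + 2 * real d" for n
  proof -
    have "real_of_int (dist1 (f (nvec n z)) (nvec n ?w)) \<le> (\<Sum>i<d. 2)"
    proof (rule dist1_le)
      fix i assume i: "i < d"
      have "s i = 1 \<or> s i = -1" using s[of i] by linarith
      moreover have "\<bar>- real_of_int \<lfloor>t\<rfloor> - real_of_int \<lfloor>- t\<rfloor>\<bar> \<le> 2" for t :: real
        by linarith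
      ultimately show "\<bar>real_of_int (f (nvec n z) ! i) - real_of_int (nvec n ?w ! i)\<bar> \<le> 2"
        using i z \<sigma>d[OF i] by (auto simp: f_def)
    qed (simp add: f_def)
    then show ?thesis
      using mean_time_lipschitz[of "f (nvec n z)" d "nvec n ?w" eps] im[of "nvec n z"] z fo by (simp add: f_def)
  qed
  from LIMSEQ_linear_le[OF time_const_LIMSEQ[OF eps d] time_const_LIMSEQ[OF eps d z] this]
  show ?thesis by simp
qed

section \<open>Coarse-graining of a path\<close>

definition move :: "bool \<Rightarrow> nat \<Rightarrow> int list \<Rightarrow> int list" where
  "move s j x = (if s then step_up x j else step_down x j)"

text \<open>Edges are indexed by their lower end, which for a downward step is the point reached and
  not the point left.\<close>

definition lower_end :: "bool \<Rightarrow> nat \<Rightarrow> int list \<Rightarrow> int list" where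
  "lower_end s j x = (if s then x else step_down x j)"

text \<open>A chain lists, the latest first, the open edges used by a path: (v, j, s) stands for a gap v from
  the end of the previous open edge, followed by a step along axis j, upwards iff s.\<close>

type_synonym chain = "(int list \<times> nat \<times> bool) list"

fun chain_end :: "nat \<Rightarrow> chain \<Rightarrow> int list" where
  "chain_end d [] = origin d"
| "chain_end d ((v, j, s) # c) = move s j (vadd (chain_end d c) v)"

fun chain_edges :: "nat \<Rightarrow> chain \<Rightarrow> (int list \<times> nat) list" where
  "chain_edges d [] = []"
| "chain_edges d ((v, j, s) # c) = (lower_end s j (vadd (chain_end d c) v), j) # chain_edges d c"

definition vnorm :: "int list \<Rightarrow> int" where
  "vnorm v = (\<Sum>i<length v. \<bar>v ! i\<bar>)"

definition vdiff :: "int list \<Rightarrow> int list \<Rightarrow> int list" where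
  "vdiff x y = map (\<lambda>i. x ! i - y ! i) [0..<length x]"

lemma length_vdiff [simp]: "length (vdiff x y) = length x"
  by (simp add: vdiff_def)

lemma nth_vdiff [simp]: "i < length x \<Longrightarrow> vdiff x y ! i = x ! i - y ! i"
  by (simp add: vdiff_def)

lemma length_move [simp]: "length (move s j x) = length x"
  by (simp add: move_def)

lemma length_chain_end [simp]: "length (chain_end d c) = d"
  by (induction c rule: chain_end.induct[of _ d]) auto

lemma vadd_vdiff: "length x = d \<Longrightarrow> length y = d \<Longrightarrow> vadd x (vdiff y x) = y"
  by (rule nth_equalityI) auto

lemma vnorm_vdiff: "length x = d \<Longrightarrow> length y = d \<Longrightarrow> vnorm (vdiff y x) = dist1 x y"
  by (auto simp: vnorm_def dist1_def intro!: sum.cong)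

lemma dist1_step:
  assumes "length x = d" "adjacent d y z"
  shows "dist1 x z \<le> dist1 x y + 1"
proof -
  have l: "length y = d" "length z = d" "(\<Sum>i<d. \<bar>y ! i - z ! i\<bar>) = 1" using assms(2) by (auto simp: adjacent_def)
  have "dist1 x z \<le> (\<Sum>i<d. \<bar>x ! i - y ! i\<bar> + \<bar>y ! i - z ! i\<bar>)"
    unfolding dist1_def assms(1) by (rule sum_mono) linarith
  then show ?thesis using l assms(1) by (simp add: dist1_def sum.distrib)
qed

lemma step_up_commute: "step_up (step_up x i) j = step_up (step_up x j) i"
  by (rule nth_equalityI) (auto simp: nth_step_up)

lemma div_Suc_cases:
  fixes a m :: int
  assumes m: "m \<ge> 1"
  shows "(a + 1) div m = a div m \<or> (a + 1) div m = a div m + 1"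
proof -
  have "a div m \<le> (a + 1) div m" using m by (intro zdiv_mono1) auto
  moreover have "(a + 1) div m \<le> (a + m) div m" using m by (intro zdiv_mono1) auto
  moreover have "(a + m) div m = a div m + 1" using m by simp
  ultimately show ?thesis by linarith
qed

text \<open>Cells are stretched only along I. Consequently a step that does not leave its cell is a
  step along I, so that an advance of the coarse path in the same direction increases its
  height.\<close>

locale coarse =
  fixes d :: nat and I :: "nat set" and k :: "nat \<Rightarrow> int"
  assumes I_sub: "I \<subseteq> {..<d}" and k_pos: "\<And>i. k i \<ge> 1" and k_out: "\<And>i. i \<notin> I \<Longrightarrow> k i = 1"
begin

definition cell :: "int list \<Rightarrow> int list" where
  "cell x = map (\<lambda>i. x ! i div k i) [0..<d]"

text \<open>On nonnegative vectors supported in I this is the l1-norm, so height minus passage time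
  is the gain of a single realization. Elsewhere it ignores transversal displacement and counts
  backward displacement negatively.\<close>

definition height :: "int list \<Rightarrow> int" where
  "height x = (\<Sum>i\<in>I. x ! i)"

text \<open>A gap is bad if it may fail to leave the slab of cells of its starting point in some direction
  of I; it is not required to be short in the other directions.\<close>

definition bad_gap :: "int list \<Rightarrow> bool" where
  "bad_gap v \<longleftrightarrow> (\<exists>i\<in>I. v ! i < k i)"

definition bad_count :: "chain \<Rightarrow> nat" where
  "bad_count c = length (filter (\<lambda>(v, j, s). bad_gap v) c)"

lemma length_cell [simp]: "length (cell x) = d"
  by (simp add: cell_def)

lemma nth_cell [simp]: "i < d \<Longrightarrow> cell x ! i = x ! i div k i"
  by (simp add: cell_def)

lemma finite_I [simp]: "finite I"
  using I_sub finite_subset by blast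

lemma height_step_up:
  assumes "length x = d" "j < d"
  shows "height (step_up x j) = height x + (if j \<in> I then 1 else 0)"
proof -
  have "height (step_up x j) = (\<Sum>i\<in>I. x ! i + (if i = j then 1 else 0))"
    unfolding height_def by (rule sum.cong) (use assms I_sub in \<open>auto simp: nth_step_up\<close>)
  then show ?thesis by (simp add: sum.distrib height_def)
qed

lemma cell_step_up:
  assumes "length x = d" "j < d"
  shows "cell (step_up x j) = cell x \<and> j \<in> I \<or> cell (step_up x j) = step_up (cell x) j"
proof (cases "(x ! j + 1) div k j = x ! j div k j + 1")
  case True
  have "cell (step_up x j) = step_up (cell x) j"
    by (rule nth_equalityI) (use assms True in \<open>auto simp: nth_step_up\<close>)
  then show ?thesis ..
next
  case False
  then have 1: "(x ! j + 1) div k j = x ! j div k j" using div_Suc_cases[OF k_pos] by blast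
  have "cell (step_up x j) = cell x"
    by (rule nth_equalityI) (use assms 1 in \<open>auto simp: nth_step_up\<close>)
  moreover have "j \<in> I" using False k_out[of j] by (cases "j \<in> I") auto
  ultimately show ?thesis by blast
qed

text \<open>The coarse path that follows a fine path stands at the cell of its current vertex x, or one step
  ahead of it in a direction i of I: this happens after an open i-edge inside a cell was used, until
  the fine path leaves the cell upwards. While it is ahead, the coarse path sits in other cells than
  the fine one and misses the open edges used there; but b being the end of the last open edge, the
  gap to the next one is then bad. The number g is the gain that the coarse path has secured.\<close>

definition tracks :: "(int list \<Rightarrow> nat) \<Rightarrow> nat option \<Rightarrow> int list \<Rightarrow> int list \<Rightarrow> int \<Rightarrow> bool" where
  "tracks T S b x g \<longleftrightarrow> (case S of
      None \<Rightarrow> g \<le> height (cell x) - int (T (cell x))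
    | Some i \<Rightarrow> i \<in> I \<and> cell x ! i \<le> cell b ! i \<and> g \<le> height (cell x) + 1 - int (T (step_up (cell x) i)))"

lemma tracks_self: "tracks T S b x g \<Longrightarrow> tracks T S x x g"
  by (simp add: tracks_def split: option.splits)

text \<open>A step charged with one unit of time never destroys the tracking, whether its edge is
  open or closed. If it stays in its cell, the coarse path waits; if it changes the cell, the coarse
  path copies it at a cost of at most 1. When the fine path leaves its cell upwards in the very
  direction in which the coarse path is ahead, it catches up at no cost and the state becomes
  \<open>None\<close>.\<close>

lemma tracks_step:
  assumes T: "\<And>X j. length X = d \<Longrightarrow> j < d \<Longrightarrow> T (step_up X j) \<le> T X + 1 \<and> T X \<le> T (step_up X j) + 1"
    and tr: "tracks T S b x g" and adj: "adjacent d x y"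
  shows "\<exists>S'. tracks T S' b y (g + height y - height x - 1)"
proof -
  have l: "length x = d" "length y = d" using adj by (auto dest: adjacent_length)
  from adj show ?thesis
  proof (cases rule: adjacentE)
    case (1 j)
    have h: "height y = height x + (if j \<in> I then 1 else 0)" using height_step_up[OF l(1) 1(1)] 1 by simp
    have hc: "height (step_up (cell x) j) = height (cell x) + (if j \<in> I then 1 else 0)"
      using height_step_up[of "cell x" j] 1 by simp
    show ?thesis
    proof (cases S)
      case None
      have "tracks T None b y (g + height y - height x - 1)"
        using cell_step_up[OF l(1) 1(1)] T[of "cell x" j] tr h hc 1
        by (auto simp: tracks_def None split: if_splits)
      then show ?thesis ..
    next
      case (Some i)
      then have i: "i \<in> I" "i < d" using tr I_sub by (auto simp: tracks_def)
      from cell_step_up[OF l(1) 1(1)] show ?thesis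
      proof (elim disjE conjE)
        assume "cell (step_up x j) = cell x"
        then have "tracks T (Some i) b y (g + height y - height x - 1)"
          using tr h 1 by (auto simp: tracks_def Some split: if_splits)
        then show ?thesis ..
      next
        assume c: "cell (step_up x j) = step_up (cell x) j"
        show ?thesis
        proof (cases "j = i")
          case True
          then have "tracks T None b y (g + height y - height x - 1)"
            using tr h hc c 1 i by (auto simp: tracks_def Some)
          then show ?thesis ..
        next
          case False
          then have "tracks T (Some i) b y (g + height y - height x - 1)"
            using tr h hc c 1 i T[of "step_up (cell x) i" j] step_up_commute[of "cell x" i j]
            by (auto simp: tracks_def Some nth_step_up split: if_splits)
          then show ?thesis ..
        qed
      qed
    qed
  next
    case (2 j)
    have h: "height x = height y + (if j \<in> I then 1 else 0)" using height_step_up[OF l(2) 2(1)] 2 by simp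
    have hc: "height (step_up (cell y) j) = height (cell y) + (if j \<in> I then 1 else 0)"
      using height_step_up[of "cell y" j] 2 by simp
    show ?thesis
    proof (cases S)
      case None
      have "tracks T None b y (g + height y - height x - 1)"
        using cell_step_up[OF l(2) 2(1)] T[of "cell y" j] tr h hc 2
        by (auto simp: tracks_def None split: if_splits)
      then show ?thesis ..
    next
      case (Some i)
      then have i: "i \<in> I" "i < d" using tr I_sub by (auto simp: tracks_def)
      have "tracks T (Some i) b y (g + height y - height x - 1)"
        using cell_step_up[OF l(2) 2(1)]
      proof (elim disjE conjE)
        assume "cell (step_up y j) = cell y"
        then show ?thesis
          using tr h 2 by (auto simp: tracks_def Some split: if_splits)
      next
        assume c: "cell (step_up y j) = step_up (cell y) j"
        then show ?thesis
          using tr h hc 2 i T[of "step_up (cell y) i" j] step_up_commute[of "cell y" i j]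
          by (auto simp: tracks_def Some nth_step_up split: if_splits)
      qed
      then show ?thesis ..
    qed
  qed
qed

text \<open>If the coarse path is not ahead, the coarse edge represented by an open fine edge can be
  crossed for free. An upward step inside a cell is answered by crossing it anyway, which puts the
  coarse path ahead in that direction; a downward step inside a cell only loses height, so the
  coarse path may wait.\<close>

lemma tracks_open_step:
  assumes T: "\<And>z j. length z = d \<Longrightarrow> j < d \<Longrightarrow> \<tau> (z, j) = 0 \<Longrightarrow> T (step_up (cell z) j) = T (cell z)"
    and tr: "tracks T None b x g" and adj: "adjacent d x y" and op: "\<tau> (edge_between x y) = 0"
  shows "\<exists>S'. tracks T S' y y (g + height y - height x)"
proof -
  have l: "length x = d" "length y = d" using adj by (auto dest: adjacent_length)
  from adj show ?thesis
  proof (cases rule: adjacentE)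
    case (1 j)
    have h: "height y = height x + (if j \<in> I then 1 else 0)" using height_step_up[OF l(1) 1(1)] 1 by simp
    have hc: "height (step_up (cell x) j) = height (cell x) + (if j \<in> I then 1 else 0)"
      using height_step_up[of "cell x" j] 1 by simp
    have t: "T (step_up (cell x) j) = T (cell x)" using T[OF l(1) 1(1)] op 1 l by simp
    from cell_step_up[OF l(1) 1(1)] show ?thesis
    proof (elim disjE conjE)
      assume "cell (step_up x j) = cell x" "j \<in> I"
      then have "tracks T (Some j) y y (g + height y - height x)"
        using tr h t 1 by (simp add: tracks_def)
      then show ?thesis ..
    next
      assume "cell (step_up x j) = step_up (cell x) j"
      then have "tracks T None y y (g + height y - height x)"
        using tr h t hc 1 by (simp add: tracks_def)
      then show ?thesis ..
    qed
  next
    case (2 j)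
    have h: "height x = height y + (if j \<in> I then 1 else 0)" using height_step_up[OF l(2) 2(1)] 2 by simp
    have hc: "height (step_up (cell y) j) = height (cell y) + (if j \<in> I then 1 else 0)"
      using height_step_up[of "cell y" j] 2 by simp
    have t: "T (step_up (cell y) j) = T (cell y)" using T[OF l(2) 2(1)] op 2 l by simp
    have "tracks T None y y (g + height y - height x)"
      using cell_step_up[OF l(2) 2(1)] tr h t hc 2 by (auto simp: tracks_def)
    then show ?thesis ..
  qed
qed

text \<open>V stands for the vertices visited so far: an edge that ends at a new vertex is then
  different from all edges collected before. For the summation over chains V is taken to be
  \<open>UNIV\<close>.\<close>

definition chain_for :: "(int list \<times> nat \<Rightarrow> nat) \<Rightarrow> int list set \<Rightarrow> chain \<Rightarrow> bool" where
  "chain_for \<tau> V c \<longleftrightarrow> (\<forall>(v, j, s)\<in>set c. length v = d \<and> j < d) \<and> distinct (chain_edges d c) \<and>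
     (\<forall>e\<in>set (chain_edges d c). e \<in> edge_set d \<and> \<tau> e = 0 \<and> fst e \<in> V \<and> step_up (fst e) (snd e) \<in> V)"

lemma chain_for_mono: "chain_for \<tau> V c \<Longrightarrow> V \<subseteq> W \<Longrightarrow> chain_for \<tau> W c"
  unfolding chain_for_def by blast

text \<open>The path is followed edge by edge. A closed edge lengthens the current gap by at most
  one and costs one unit of time, which keeps the total gap length below the path time. An open edge
  ends the gap and joins the chain; it is followed for free if the coarse path is not ahead, and is
  otherwise charged to \<open>bad_count\<close>.\<close>

lemma chain_exists:
  assumes \<tau>: "\<And>e. \<tau> e \<le> 1"
    and T0: "T (origin d) = 0"
    and T1: "\<And>X j. length X = d \<Longrightarrow> j < d \<Longrightarrow> T (step_up X j) \<le> T X + 1 \<and> T X \<le> T (step_up X j) + 1"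
    and T2: "\<And>z j. length z = d \<Longrightarrow> j < d \<Longrightarrow> \<tau> (z, j) = 0 \<Longrightarrow> T (step_up (cell z) j) = T (cell z)"
    and "is_path d (origin d) y p" "distinct p"
  shows "\<exists>c S. chain_for \<tau> (set p) c \<and>
    (\<Sum>(v, j, s)\<leftarrow>c. vnorm v) + dist1 (chain_end d c) y \<le> int (path_time \<tau> p) \<and>
    tracks T S (chain_end d c) y (height y - int (path_time \<tau> p) - int (bad_count c))"
  using assms(5,6)
proof (induction p arbitrary: y rule: rev_induct)
  case Nil then show ?case by (simp add: is_path_def)
next
  case (snoc w q)
  show ?case
  proof (cases "q = []")
    case True
    then have y: "y = origin d" "w = y" using snoc.prems by auto
    have "cell (origin d) = origin d" by (rule nth_equalityI) auto
    moreover have "height (origin d) = 0" using I_sub by (auto simp: height_def intro!: sum.neutral)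
    ultimately have "tracks T None (origin d) y (height y - 0 - int (bad_count []))"
      by (simp add: tracks_def y T0 bad_count_def)
    moreover have "chain_for \<tau> (set (q @ [w])) []" by (simp add: chain_for_def)
    ultimately show ?thesis
      by (intro exI[of _ "[]"] exI[of _ None]) (simp add: True dist1_def y)
  next
    case False
    define x where "x = last q"
    have wy: "w = y" and px: "is_path d (origin d) x q" and adj: "adjacent d x y"
      using snoc.prems(1) is_path_snoc[OF False] by (auto simp: x_def)
    have dq: "distinct q" and yq: "y \<notin> set q" using snoc.prems wy by auto
    have xq: "x \<in> set q" using False by (simp add: x_def)
    have l: "length x = d" "length y = d" using adj by (auto dest: adjacent_length)
    from snoc.IH[OF px dq] obtain c S where
      c: "chain_for \<tau> (set q) c"
      and sm: "(\<Sum>(v, j, s)\<leftarrow>c. vnorm v) + dist1 (chain_end d c) x \<le> int (path_time \<tau> q)"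
      and tr: "tracks T S (chain_end d c) x (height x - int (path_time \<tau> q) - int (bad_count c))"
      by blast
    have c': "chain_for \<tau> (set (q @ [w])) c" by (rule chain_for_mono[OF c]) auto
    have pt: "path_time \<tau> (q @ [w]) = path_time \<tau> q + \<tau> (edge_between x y)"
      using path_time_snoc[OF False] wy by (simp add: x_def)
    let ?b = "chain_end d c"
    consider "\<tau> (edge_between x y) = 1" | "\<tau> (edge_between x y) = 0" using \<tau>[of "edge_between x y"] by linarith
    then show ?thesis
    proof cases
      case 1
      from tracks_step[OF T1 tr adj] obtain S' where
        "tracks T S' ?b y (height x - int (path_time \<tau> q) - int (bad_count c) + height y - height x - 1)" by blast
      moreover have "height x - int (path_time \<tau> q) - int (bad_count c) + height y - height x - 1
        = height y - int (path_time \<tau> (q @ [w])) - int (bad_count c)" by (simp add: pt 1)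
      ultimately have "tracks T S' ?b y (height y - int (path_time \<tau> (q @ [w])) - int (bad_count c))"
        by (simp only:)
      moreover have "(\<Sum>(v, j, s)\<leftarrow>c. vnorm v) + dist1 ?b y \<le> int (path_time \<tau> (q @ [w]))"
        using sm dist1_step[of ?b d x y] adj by (simp add: pt 1)
      ultimately show ?thesis using c' by blast
    next
      case 2
      obtain j s where js: "j < d" "y = move s j x" "edge_between x y = (lower_end s j x, j)"
      proof -
        from adj show ?thesis
        proof (cases rule: adjacentE)
          case (1 j) then show ?thesis using that[of j True] l by (simp add: move_def lower_end_def)
        next
          case (2 j) then show ?thesis using that[of j False] l by (simp add: move_def lower_end_def)
        qed
      qed
      define v where "v = vdiff x ?b"
      have v: "length v = d" "vadd ?b v = x" "vnorm v = dist1 ?b x"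
        using l by (simp_all add: v_def vadd_vdiff vnorm_vdiff)
      define c2 where "c2 = (v, j, s) # c"
      have e2: "chain_end d c2 = y" "chain_edges d c2 = edge_between x y # chain_edges d c"
        unfolding c2_def js(3) chain_end.simps chain_edges.simps v(2) using js(2) by simp_all
      have ends: "{fst (edge_between x y), step_up (fst (edge_between x y)) (snd (edge_between x y))} = {x, y}"
        by (rule edge_between_ends[OF adj])
      have new: "edge_between x y \<notin> set (chain_edges d c)"
      proof
        assume "edge_between x y \<in> set (chain_edges d c)"
        then have "{fst (edge_between x y), step_up (fst (edge_between x y)) (snd (edge_between x y))} \<subseteq> set q"
          using c unfolding chain_for_def by blast
        then show False using yq unfolding ends by simp
      qed
      have sub: "{fst (edge_between x y), step_up (fst (edge_between x y)) (snd (edge_between x y))} \<subseteq> set (q @ [w])"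
        unfolding ends using xq wy by simp
      have ch: "chain_for \<tau> (set (q @ [w])) c2"
        unfolding chain_for_def
      proof (intro conjI)
        show "\<forall>(v, j, s)\<in>set c2. length v = d \<and> j < d"
          using c' v(1) js(1) unfolding chain_for_def c2_def by simp
        show "distinct (chain_edges d c2)"
          using c' new unfolding chain_for_def e2 by simp
        show "\<forall>e\<in>set (chain_edges d c2). e \<in> edge_set d \<and> \<tau> e = 0 \<and> fst e \<in> set (q @ [w]) \<and> step_up (fst e) (snd e) \<in> set (q @ [w])"
          using c' sub edge_between_in[OF adj] 2 unfolding chain_for_def e2 by simp
      qed
      have "(\<Sum>(v, j, s)\<leftarrow>c2. vnorm v) = (\<Sum>(v, j, s)\<leftarrow>c. vnorm v) + dist1 ?b x"
        by (simp add: c2_def v)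
      then have sm2: "(\<Sum>(v, j, s)\<leftarrow>c2. vnorm v) + dist1 (chain_end d c2) y \<le> int (path_time \<tau> (q @ [w]))"
        using sm unfolding e2 pt 2 by (simp add: dist1_def)
      have "\<exists>S'. tracks T S' y y (height y - int (path_time \<tau> (q @ [w])) - int (bad_count c2))"
      proof (cases S)
        case None
        have "\<exists>S'. tracks T S' y y (height x - int (path_time \<tau> q) - int (bad_count c) + height y - height x)"
          by (rule tracks_open_step[where \<tau> = \<tau>, OF _ tr[unfolded None] adj 2]) (rule T2)
        then obtain S' where tr': "tracks T S' y y (height x - int (path_time \<tau> q) - int (bad_count c) + height y - height x)" ..
        \<comment> \<open>The gap may be bad although the coarse path is not ahead; counting it then
          only weakens the claim.\<close>
        have "height y - int (path_time \<tau> (q @ [w])) - int (bad_count c2)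
           \<le> height x - int (path_time \<tau> q) - int (bad_count c) + height y - height x"
          by (simp add: pt 2 bad_count_def c2_def)
        with tr' show ?thesis by (auto simp: tracks_def split: option.splits intro!: exI[of _ S'])
      next
        case (Some i)
        then have i: "i \<in> I" "x ! i div k i \<le> ?b ! i div k i" "i < d"
          using tr I_sub by (auto simp: tracks_def subset_eq)
        \<comment> \<open>While the coarse path is ahead in direction i, the fine one has not risen
          above the slab of b, so its i-coordinate exceeds that of b by less than a cell
          side.\<close>
        have "x ! i < k i + ?b ! i"
        proof -
          have "x ! i = k i * (x ! i div k i) + x ! i mod k i" "?b ! i = k i * (?b ! i div k i) + ?b ! i mod k i" by simp_all
          moreover have "x ! i mod k i < k i" "?b ! i mod k i \<ge> 0" using k_pos[of i] by auto
          moreover have "k i * (x ! i div k i) \<le> k i * (?b ! i div k i)" using i k_pos[of i] by (intro mult_left_mono) auto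
          ultimately show ?thesis by linarith
        qed
        then have "bad_gap v" unfolding bad_gap_def v_def using i l by (intro bexI[of _ i]) auto
        then have bc: "bad_count c2 = bad_count c + 1" by (simp add: bad_count_def c2_def)
        \<comment> \<open>The open edge is treated as if it were closed; the additional bad gap pays
          for the lost unit.\<close>
        from tracks_step[OF T1 tr adj] obtain S' where
          "tracks T S' ?b y (height x - int (path_time \<tau> q) - int (bad_count c) + height y - height x - 1)" by blast
        then have "tracks T S' y y (height y - int (path_time \<tau> (q @ [w])) - int (bad_count c2))"
          using tracks_self by (simp add: pt 2 bc algebra_simps)
        then show ?thesis ..
      qed
      then obtain S' where "tracks T S' (chain_end d c2) y (height y - int (path_time \<tau> (q @ [w])) - int (bad_count c2))"
        unfolding e2 ..
      with ch sm2 show ?thesis by blast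
    qed
  qed
qed

text \<open>Running ahead overstates the gain by at most 2: one unit of height, and one unit by
  which T may be smaller at the neighbouring cell.\<close>

lemma cell_gain_bound:
  assumes "tracks T S b y g" "length y = d"
    and T1: "\<And>X j. length X = d \<Longrightarrow> j < d \<Longrightarrow> T (step_up X j) \<le> T X + 1 \<and> T X \<le> T (step_up X j) + 1"
  shows "g \<le> height (cell y) - int (T (cell y)) + 2"
proof (cases S)
  case None then show ?thesis using assms by (simp add: tracks_def)
next
  case (Some i)
  then have "i < d" using assms(1) I_sub by (auto simp: tracks_def)
  then show ?thesis using T1[of "cell y" i] assms(1) by (simp add: tracks_def Some)
qed

lemma height_chain_end:
  assumes "\<forall>(v, j, s)\<in>set c. length v = d \<and> j < d"
  shows "height (chain_end d c) \<le> (\<Sum>(v, j, s)\<leftarrow>c. height v) + int (length c)"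
  using assms
proof (induction c)
  case Nil
  show ?case using I_sub by (auto simp: height_def intro!: sum_nonpos)
next
  case (Cons a c)
  obtain v j s where a: "a = (v, j, s)" by (cases a)
  let ?x = "vadd (chain_end d c) v"
  have "height ?x = height (chain_end d c) + height v"
    using I_sub by (auto simp: height_def subset_eq simp flip: sum.distrib intro!: sum.cong)
  moreover have "height (move s j ?x) \<le> height ?x + 1"
    using height_step_up[of ?x j] height_step_up[of "step_down ?x j" j] Cons.prems by (auto simp: move_def a)
  ultimately show ?case using Cons by (simp add: a)
qed

end

section \<open>Generating functions of chains\<close>

lemma nn_integral_list_Cons:
  assumes "F [] = 0"
  shows "(\<integral>\<^sup>+v. F v \<partial>count_space UNIV) = (\<integral>\<^sup>+x. \<integral>\<^sup>+v. F (x # v) \<partial>count_space UNIV \<partial>count_space UNIV)"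
proof -
  have "(\<integral>\<^sup>+v. F v \<partial>count_space UNIV) = (\<integral>\<^sup>+v. F v \<partial>count_space (UNIV - {[]}))"
    by (rule nn_integral_count_space_eq[symmetric]) (use assms in auto)
  also have "\<dots> = (\<integral>\<^sup>+p. F (fst p # snd p) \<partial>count_space UNIV)"
  proof -
    have "bij_betw (\<lambda>p. fst p # snd p) UNIV (UNIV - {[]})"
      by (rule bij_betwI[where g = "\<lambda>v. (hd v, tl v)"]) auto
    from nn_integral_bij_count_space[OF this, of F] show ?thesis by simp
  qed
  also have "\<dots> = (\<integral>\<^sup>+x. \<integral>\<^sup>+v. F (x # v) \<partial>count_space UNIV \<partial>count_space UNIV)"
    by (subst nn_integral_fst_count_space[symmetric]) simp
  finally show ?thesis .
qed

text \<open>Weights that factor over coordinates have sums that factor. Sums are written as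
  integrals over counting measure with values in \<open>ennreal\<close>, so that no summability has
  to be tracked.\<close>

lemma nn_integral_vectors:
  fixes f :: "nat \<Rightarrow> int \<Rightarrow> ennreal"
  shows "(\<integral>\<^sup>+v. (if length v = d then \<Prod>i<d. f i (v ! i) else 0) \<partial>count_space UNIV)
    = (\<Prod>i<d. \<integral>\<^sup>+n. f i n \<partial>count_space UNIV)"
proof (induction d arbitrary: f)
  case 0
  have "(\<integral>\<^sup>+v. (if length v = 0 then \<Prod>i<0. f i (v ! i) else 0) \<partial>count_space UNIV)
     = (\<integral>\<^sup>+v. indicator {[]} v \<partial>count_space (UNIV :: int list set))"
    by (intro nn_integral_cong) (auto simp: indicator_def)
  then show ?case by simp
next
  case (Suc d)
  have "(\<integral>\<^sup>+v. (if length v = Suc d then \<Prod>i<Suc d. f i (v ! i) else 0) \<partial>count_space UNIV)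
    = (\<integral>\<^sup>+x. \<integral>\<^sup>+v. (if length v = d then \<Prod>i<Suc d. f i ((x # v) ! i) else 0) \<partial>count_space UNIV \<partial>count_space UNIV)"
    by (subst nn_integral_list_Cons) simp_all
  also have "\<dots> = (\<integral>\<^sup>+x. f 0 x * (\<integral>\<^sup>+v. (if length v = d then \<Prod>i<d. f (Suc i) (v ! i) else 0) \<partial>count_space UNIV) \<partial>count_space UNIV)"
    by (subst nn_integral_cmult[symmetric])
      (auto intro!: nn_integral_cong simp: prod.lessThan_Suc_shift simp del: prod.lessThan_Suc)
  also have "\<dots> = (\<integral>\<^sup>+x. f 0 x \<partial>count_space UNIV) * (\<Prod>i<d. \<integral>\<^sup>+n. f (Suc i) n \<partial>count_space UNIV)"
    by (simp add: Suc[of "\<lambda>i. f (Suc i)"] nn_integral_multc)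
  finally show ?case by (simp add: prod.lessThan_Suc_shift del: prod.lessThan_Suc)
qed

text \<open>The lists of length m carry the m-th power of the total weight of a letter, so a
  geometric series of ratio 1/2 bounds the whole.\<close>

lemma nn_integral_lists_le:
  fixes g :: "'a \<Rightarrow> ennreal"
  assumes W: "(\<integral>\<^sup>+a. g a \<partial>count_space UNIV) \<le> ennreal (1/2)"
  shows "(\<integral>\<^sup>+c. prod_list (map g c) \<partial>count_space UNIV) \<le> 2"
proof -
  have len: "(\<integral>\<^sup>+c. (if length c = m then prod_list (map g c) else 0) \<partial>count_space UNIV)
     \<le> ennreal ((1/2) ^ m)" for m
  proof (induction m)
    case 0
    have "(\<integral>\<^sup>+c. (if length c = 0 then prod_list (map g c) else 0) \<partial>count_space UNIV)
       = (\<integral>\<^sup>+c. indicator {[]} c \<partial>count_space (UNIV :: 'a list set))"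
      by (intro nn_integral_cong) (auto simp: indicator_def)
    then show ?case by simp
  next
    case (Suc m)
    have "(\<integral>\<^sup>+c. (if length c = Suc m then prod_list (map g c) else 0) \<partial>count_space UNIV)
      = (\<integral>\<^sup>+x. \<integral>\<^sup>+c. (if length c = m then g x * prod_list (map g c) else 0) \<partial>count_space UNIV \<partial>count_space UNIV)"
      by (subst nn_integral_list_Cons) (auto intro!: nn_integral_cong)
    also have "\<dots> = (\<integral>\<^sup>+x. g x * (\<integral>\<^sup>+c. (if length c = m then prod_list (map g c) else 0) \<partial>count_space UNIV) \<partial>count_space UNIV)"
      by (subst nn_integral_cmult[symmetric]) (auto intro!: nn_integral_cong)
    also have "\<dots> = (\<integral>\<^sup>+x. g x \<partial>count_space UNIV) * (\<integral>\<^sup>+c. (if length c = m then prod_list (map g c) else 0) \<partial>count_space UNIV)"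
      by (simp add: nn_integral_multc)
    also have "\<dots> \<le> ennreal (1/2) * ennreal ((1/2) ^ m)"
      by (rule mult_mono[OF W Suc]) auto
    also have "\<dots> = ennreal ((1/2) * (1/2) ^ m)" by (rule ennreal_mult[symmetric]) auto
    also have "\<dots> = ennreal ((1/2) ^ Suc m)" by simp
    finally show ?case .
  qed
  have "(\<integral>\<^sup>+c. prod_list (map g c) \<partial>count_space UNIV)
     = (\<integral>\<^sup>+c. (\<Sum>m. if length c = m then prod_list (map g c) else 0) \<partial>count_space UNIV)"
  proof (rule nn_integral_cong)
    fix c :: "'a list"
    have "(\<Sum>m. if length c = m then prod_list (map g c) else 0) = (\<Sum>m\<in>{length c}. if length c = m then prod_list (map g c) else 0)"
      by (rule suminf_finite) auto
    then show "prod_list (map g c) = (\<Sum>m. if length c = m then prod_list (map g c) else 0)" by simp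
  qed
  also have "\<dots> = (\<Sum>m. \<integral>\<^sup>+c. (if length c = m then prod_list (map g c) else 0) \<partial>count_space UNIV)"
    by (rule nn_integral_suminf) simp
  also have "\<dots> \<le> (\<Sum>m. ennreal ((1/2) ^ m))" by (rule suminf_le) (use len in auto)
  also have "\<dots> = ennreal 2"
    by (rule suminf_ennreal_eq) (use geometric_sums[of "1/2::real"] in auto)
  finally show ?thesis by simp
qed

section \<open>Exponential sums over one coordinate of a gap\<close>

lemma nn_integral_int_split:
  fixes f :: "int \<Rightarrow> ennreal"
  shows "(\<integral>\<^sup>+n. f n \<partial>count_space UNIV) = (\<Sum>m. f (int m)) + (\<Sum>m. f (- 1 - int m))"
proof -
  have b1: "bij_betw int UNIV {0..}" by (rule bij_betwI[where g = nat]) auto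
  have b2: "bij_betw (\<lambda>m. - 1 - int m) UNIV {..<0}" by (rule bij_betwI[where g = "\<lambda>n. nat (- 1 - n)"]) auto
  have "(\<integral>\<^sup>+n. f n \<partial>count_space UNIV) = (\<integral>\<^sup>+n. f n * indicator {0..} n + f n * indicator {..<0} n \<partial>count_space UNIV)"
    by (intro nn_integral_cong) (auto simp: indicator_def)
  also have "\<dots> = (\<integral>\<^sup>+n. f n \<partial>count_space {0..}) + (\<integral>\<^sup>+n. f n \<partial>count_space {..<0})"
    by (subst nn_integral_add) (auto simp: nn_integral_count_space_indicator)
  also have "(\<integral>\<^sup>+n. f n \<partial>count_space {0..}) = (\<Sum>m. f (int m))"
    using nn_integral_bij_count_space[OF b1, of f] by (simp add: nn_integral_count_space_nat)
  also have "(\<integral>\<^sup>+n. f n \<partial>count_space {..<0}) = (\<Sum>m. f (- 1 - int m))"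
    using nn_integral_bij_count_space[OF b2, of f] by (simp add: nn_integral_count_space_nat)
  finally show ?thesis .
qed

lemma suminf_exp_le:
  assumes "0 < l" "l \<le> (1::real)"
  shows "(\<Sum>m. ennreal (exp (- (l * real m)))) \<le> ennreal (2 / l)"
proof -
  have e: "exp (- l) < 1" using assms by simp
  have "(\<lambda>m. exp (- l) ^ m) sums (1 / (1 - exp (- l)))" using e by (intro geometric_sums) simp
  moreover have "exp (- l) ^ m = exp (- (l * real m))" for m by (simp flip: exp_of_nat_mult add: mult.commute)
  ultimately have "(\<lambda>m. exp (- (l * real m))) sums (1 / (1 - exp (- l)))" by simp
  then have "(\<Sum>m. ennreal (exp (- (l * real m)))) = ennreal (1 / (1 - exp (- l)))"
    by (intro suminf_ennreal_eq) auto
  also have "\<dots> \<le> ennreal (2 / l)"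
  proof (rule ennreal_leI)
    have "exp (- l) \<le> 1 / (1 + l)" using exp_ge_add_one_self[of l] assms by (simp add: exp_minus divide_simps)
    then have "1 - exp (- l) \<ge> l / (1 + l)" using assms by (simp add: field_simps)
    moreover have "l / (1 + l) \<ge> l / 2" using assms by (intro divide_left_mono) auto
    ultimately have "1 - exp (- l) \<ge> l / 2" by linarith
    then have "1 / (1 - exp (- l)) \<le> 1 / (l / 2)" using assms by (intro divide_left_mono) auto
    then show "1 / (1 - exp (- l)) \<le> 2 / l" by simp
  qed
  finally show ?thesis .
qed

lemma suminf_exp_Suc_le: "(\<Sum>m. ennreal (exp (- (1 + real m)))) \<le> 1"
proof -
  have "(\<Sum>m. ennreal (exp (- (1 + real m)))) = (\<Sum>m. ennreal (exp (-1)) * ennreal (exp (- (1 * real m))))"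
    by (intro suminf_cong) (simp flip: ennreal_mult exp_add)
  also have "\<dots> = ennreal (exp (-1)) * (\<Sum>m. ennreal (exp (- (1 * real m))))" by simp
  also have "\<dots> \<le> ennreal (exp (-1)) * ennreal (2 / 1)" by (intro mult_left_mono suminf_exp_le) auto
  also have "\<dots> = ennreal (exp (-1) * (2 / 1))" by (rule ennreal_mult[symmetric]) auto
  also have "\<dots> \<le> ennreal 1"
    using exp_ge_add_one_self[of 1] by (intro ennreal_leI) (simp add: exp_minus divide_simps)
  finally show ?thesis by simp
qed

definition gap_cost :: "real \<Rightarrow> int \<Rightarrow> real" where
  "gap_cost l n = (if n \<ge> 0 then l * real_of_int n else - real_of_int n)"

lemma gap_cost_int: "gap_cost l (int m) = l * real m"
  by (simp add: gap_cost_def)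

lemma gap_cost_neg: "gap_cost l (- 1 - int m) = 1 + real m"
  by (simp add: gap_cost_def)

text \<open>Forward displacement contributes at most 2 / l and backward displacement at most 1: each
  direction of I costs one factor of order 1 / l in the weighted count of gaps.\<close>

lemma nn_integral_gap_cost:
  assumes "0 < l" "l \<le> 1"
  shows "(\<integral>\<^sup>+n. ennreal (exp (- gap_cost l n)) \<partial>count_space UNIV) \<le> ennreal (3 / l)"
proof -
  have "(\<integral>\<^sup>+n. ennreal (exp (- gap_cost l n)) \<partial>count_space UNIV)
     = (\<Sum>m. ennreal (exp (- (l * real m)))) + (\<Sum>m. ennreal (exp (- (1 + real m))))"
    unfolding nn_integral_int_split gap_cost_int gap_cost_neg ..
  also have "\<dots> \<le> ennreal (2 / l) + ennreal 1"
    unfolding ennreal_1 by (rule add_mono[OF suminf_exp_le[OF assms] suminf_exp_Suc_le])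
  also have "\<dots> = ennreal (2 / l + 1)" using assms by simp
  also have "\<dots> \<le> ennreal (3 / l)" using assms by (intro ennreal_leI) (simp add: field_simps)
  finally show ?thesis .
qed

text \<open>Below k the forward part has only k terms, each at most 1. A short coordinate thus
  contributes order k instead of order 1 / l, and this saving l * k pays for the reward given to bad
  gaps.\<close>

lemma nn_integral_gap_cost_bad:
  assumes "0 < l" "k \<ge> 1"
  shows "(\<integral>\<^sup>+n. (if n < k then ennreal (exp (- gap_cost l n)) else 0) \<partial>count_space UNIV) \<le> ennreal (2 * real_of_int k)"
proof -
  have "(\<integral>\<^sup>+n. (if n < k then ennreal (exp (- gap_cost l n)) else 0) \<partial>count_space UNIV)
     = (\<Sum>m. if int m < k then ennreal (exp (- gap_cost l (int m))) else 0) + (\<Sum>m. ennreal (exp (- (1 + real m))))"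
  proof -
    have "(- 1 - int m < k) = True" for m using assms by simp
    then show ?thesis unfolding nn_integral_int_split by (simp only: gap_cost_neg if_True)
  qed
  also have "\<dots> \<le> ennreal (real_of_int k) + ennreal 1"
    unfolding ennreal_1
  proof (rule add_mono[OF _ suminf_exp_Suc_le])
    have "(\<Sum>m. if int m < k then ennreal (exp (- gap_cost l (int m))) else 0)
       = (\<Sum>m<nat k. if int m < k then ennreal (exp (- gap_cost l (int m))) else 0)"
      by (rule suminf_finite) auto
    also have "\<dots> \<le> (\<Sum>m<nat k. 1)"
      using assms by (intro sum_mono) (simp add: gap_cost_int)
    also have "\<dots> = ennreal (real_of_int k)"
      using assms by (simp add: ennreal_of_nat_eq_real_of_nat)
    finally show "(\<Sum>m. if int m < k then ennreal (exp (- gap_cost l (int m))) else 0) \<le> ennreal (real_of_int k)" .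
  qed
  also have "\<dots> = ennreal (real_of_int k + 1)" using assms by simp
  also have "\<dots> \<le> ennreal (2 * real_of_int k)" using assms by (intro ennreal_leI) simp
  finally show ?thesis .
qed


context coarse begin

text \<open>On I moving forward is cheap and moving backward is not, since a path that gains must use at least
  as many open edges as backward and transversal steps.\<close>

definition vcost :: "real \<Rightarrow> int list \<Rightarrow> real" where
  "vcost l v = (\<Sum>i<d. gap_cost (if i \<in> I then l else 1) (v ! i))"

text \<open>Union bound over the direction i of I in which the gap is short. Restricting that
  coordinate replaces one factor 3 / l of the unrestricted product by 2 * k i, that is, multiplies
  the product by at most l * k i.\<close>

lemma nn_integral_vcost:
  assumes l: "0 < l" "l \<le> 1"
  shows "(\<integral>\<^sup>+v. (if length v = d then ennreal (exp (1 - vcost l v + t * of_bool (bad_gap v))) else 0) \<partial>count_space UNIV)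
    \<le> ennreal (exp 1 * 3 ^ d * (1 / l) ^ card I * (1 + exp t * l * (\<Sum>i\<in>I. real_of_int (k i))))"
proof -
  define f where "f i n = ennreal (exp (- gap_cost (if i \<in> I then l else 1) n))" for i n
  define g where "g i j n = (if j = i \<and> n \<ge> k i then 0 else f j n)" for i j n
  have fv: "(\<Prod>j<d. f j (v ! j)) = ennreal (exp (- vcost l v))" for v
    by (simp add: f_def vcost_def prod_ennreal exp_sum sum_negf[symmetric])
  have pt: "ennreal (exp (1 - vcost l v + t * of_bool (bad_gap v)))
    \<le> ennreal (exp 1) * ((\<Prod>j<d. f j (v ! j)) + (\<Sum>i\<in>I. ennreal (exp t) * (\<Prod>j<d. g i j (v ! j))))" for v
  proof (cases "bad_gap v")
    case False
    have "ennreal (exp (1 - vcost l v)) = ennreal (exp 1) * (\<Prod>j<d. f j (v ! j))"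
      unfolding fv by (simp add: exp_diff exp_minus divide_inverse ennreal_mult)
    also have "\<dots> \<le> ennreal (exp 1) * ((\<Prod>j<d. f j (v ! j)) + (\<Sum>i\<in>I. ennreal (exp t) * (\<Prod>j<d. g i j (v ! j))))"
      by (intro mult_left_mono) auto
    finally show ?thesis using False by simp
  next
    case True
    then obtain i where i: "i \<in> I" "v ! i < k i" by (auto simp: bad_gap_def)
    have gi: "(\<Prod>j<d. g i j (v ! j)) = (\<Prod>j<d. f j (v ! j))"
      by (rule prod.cong) (use i in \<open>auto simp: g_def\<close>)
    have "ennreal (exp (1 - vcost l v + t)) = ennreal (exp 1) * (ennreal (exp t) * (\<Prod>j<d. g i j (v ! j)))"
      unfolding gi fv by (simp add: exp_add exp_diff exp_minus divide_inverse ennreal_mult mult_ac)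
    also have "\<dots> \<le> ennreal (exp 1) * (\<Sum>i\<in>I. ennreal (exp t) * (\<Prod>j<d. g i j (v ! j)))"
      by (intro mult_left_mono member_le_sum i) auto
    also have "\<dots> \<le> ennreal (exp 1) * ((\<Prod>j<d. f j (v ! j)) + (\<Sum>i\<in>I. ennreal (exp t) * (\<Prod>j<d. g i j (v ! j))))"
      by (intro mult_left_mono) auto
    finally show ?thesis using True by simp
  qed
  define F where "F i = (\<integral>\<^sup>+n. f i n \<partial>count_space UNIV)" for i
  define c where "c i = 3 * (if i \<in> I then 1 / l else 1)" for i
  have c0: "c i \<ge> 0" for i using l by (simp add: c_def)
  have F: "F i \<le> ennreal (c i)" for i
    unfolding F_def f_def c_def using nn_integral_gap_cost[OF l] nn_integral_gap_cost[of 1] by simp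
  have G: "(\<integral>\<^sup>+n. g i j n \<partial>count_space UNIV) \<le> ennreal (if j = i then 2 * real_of_int (k i) else c j)" if "i \<in> I" for i j
  proof (cases "j = i")
    case True
    have "(\<integral>\<^sup>+n. g i j n \<partial>count_space UNIV) = (\<integral>\<^sup>+n. (if n < k i then ennreal (exp (- gap_cost l n)) else 0) \<partial>count_space UNIV)"
      by (intro nn_integral_cong) (use True that in \<open>auto simp: g_def f_def\<close>)
    then show ?thesis using True nn_integral_gap_cost_bad[OF l(1) k_pos, of i] by simp
  next
    case False
    then show ?thesis using F[of j] by (simp add: g_def F_def)
  qed
  have pc: "(\<Prod>j<d. c j) = 3 ^ d * (1 / l) ^ card I"
  proof -
    have "(\<Prod>j<d. c j) = 3 ^ d * (\<Prod>j<d. if j \<in> I then 1 / l else 1)"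
      unfolding c_def by (simp add: prod.distrib)
    also have "(\<Prod>j<d. if j \<in> I then 1 / l else 1) = (\<Prod>j\<in>{..<d} \<inter> I. 1 / l)"
      by (rule prod.inter_restrict[symmetric]) simp
    also have "{..<d} \<inter> I = I" using I_sub by blast
    finally show ?thesis by simp
  qed
  have pG: "(\<Prod>j<d. if j = i then 2 * real_of_int (k i) else c j) \<le> (\<Prod>j<d. c j) * (l * real_of_int (k i))" if "i \<in> I" for i
  proof -
    have i: "i < d" using that I_sub by auto
    define R where "R = (\<Prod>j\<in>{..<d} - {i}. c j)"
    have e1: "(\<Prod>j<d. if j = i then 2 * real_of_int (k i) else c j) = 2 * real_of_int (k i) * R"
    proof -
      have "(\<Prod>j\<in>{..<d} - {i}. if j = i then 2 * real_of_int (k i) else c j) = R"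
        unfolding R_def by (rule prod.cong) auto
      then show ?thesis using prod.remove[of "{..<d}" i "\<lambda>j. if j = i then 2 * real_of_int (k i) else c j"] i by simp
    qed
    have "(\<Prod>j<d. c j) = c i * R" unfolding R_def using i by (intro prod.remove) auto
    moreover have "c i * l = 3" using that l by (simp add: c_def)
    ultimately have e2: "(\<Prod>j<d. c j) * (l * real_of_int (k i)) = 3 * real_of_int (k i) * R"
      by (simp add: mult_ac)
    have "R \<ge> 0" unfolding R_def by (intro prod_nonneg) (use c0 in auto)
    then show ?thesis unfolding e1 e2 using k_pos[of i] by (intro mult_right_mono) auto
  qed
  define P where "P v = (if length v = d then \<Prod>j<d. f j (v ! j) else 0)" for v
  define Q where "Q i v = (if length v = d then \<Prod>j<d. g i j (v ! j) else 0)" for i v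
  have "(\<integral>\<^sup>+v. (if length v = d then ennreal (exp (1 - vcost l v + t * of_bool (bad_gap v))) else 0) \<partial>count_space UNIV)
    \<le> (\<integral>\<^sup>+v. ennreal (exp 1) * (P v + (\<Sum>i\<in>I. ennreal (exp t) * Q i v)) \<partial>count_space UNIV)"
  proof (intro nn_integral_mono)
    fix v
    show "(if length v = d then ennreal (exp (1 - vcost l v + t * of_bool (bad_gap v))) else 0)
       \<le> ennreal (exp 1) * (P v + (\<Sum>i\<in>I. ennreal (exp t) * Q i v))"
      using pt[of v] by (cases "length v = d") (simp_all only: P_def Q_def if_True if_False zero_le refl)
  qed
  also have "\<dots> = ennreal (exp 1) * ((\<integral>\<^sup>+v. P v \<partial>count_space UNIV) + (\<Sum>i\<in>I. ennreal (exp t) * (\<integral>\<^sup>+v. Q i v \<partial>count_space UNIV)))"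
    by (simp add: nn_integral_cmult nn_integral_add nn_integral_sum)
  also have "\<dots> = ennreal (exp 1) * ((\<Prod>j<d. F j) + (\<Sum>i\<in>I. ennreal (exp t) * (\<Prod>j<d. \<integral>\<^sup>+n. g i j n \<partial>count_space UNIV)))"
    unfolding P_def Q_def nn_integral_vectors F_def ..
  also have "\<dots> \<le> ennreal (exp 1) * ((\<Prod>j<d. ennreal (c j)) + (\<Sum>i\<in>I. ennreal (exp t) * (\<Prod>j<d. ennreal (if j = i then 2 * real_of_int (k i) else c j))))"
    by (intro mult_left_mono add_mono prod_mono_ennreal sum_mono F G) auto
  also have "\<dots> = ennreal (exp 1 * ((\<Prod>j<d. c j) + (\<Sum>i\<in>I. exp t * (\<Prod>j<d. if j = i then 2 * real_of_int (k i) else c j))))"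
  proof -
    have k0: "real_of_int (k i) \<ge> 0" for i using k_pos[of i] by simp
    define B where "B i = (\<Prod>j<d. if j = i then 2 * real_of_int (k i) else c j)" for i
    define A where "A = (\<Prod>j<d. c j)"
    have 1: "(\<Prod>j<d. ennreal (if j = i then 2 * real_of_int (k i) else c j)) = ennreal (B i)" for i
      unfolding B_def by (rule prod_ennreal) (use c0 k0 in auto)
    have 2: "(\<Prod>j<d. ennreal (c j)) = ennreal A" unfolding A_def by (rule prod_ennreal) (use c0 in auto)
    have B0: "B i \<ge> 0" for i
      unfolding B_def by (rule prod_nonneg) (use c0 k0 in auto)
    have A0: "A \<ge> 0" unfolding A_def by (rule prod_nonneg) (use c0 in auto)
    have 3: "(\<Sum>i\<in>I. ennreal (exp t) * ennreal (B i)) = ennreal (\<Sum>i\<in>I. exp t * B i)"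
    proof -
      have "(\<Sum>i\<in>I. ennreal (exp t) * ennreal (B i)) = (\<Sum>i\<in>I. ennreal (exp t * B i))"
        by (intro sum.cong refl ennreal_mult[symmetric] B0) auto
      also have "\<dots> = ennreal (\<Sum>i\<in>I. exp t * B i)" by (rule sum_ennreal) (use B0 in auto)
      finally show ?thesis .
    qed
    have S0: "(\<Sum>i\<in>I. exp t * B i) \<ge> 0" by (intro sum_nonneg mult_nonneg_nonneg B0) auto
    have "ennreal (exp 1) * (ennreal A + ennreal (\<Sum>i\<in>I. exp t * B i)) = ennreal (exp 1 * (A + (\<Sum>i\<in>I. exp t * B i)))"
      using A0 S0 by (subst ennreal_plus[symmetric]) (auto simp only: ennreal_mult exp_ge_zero add_nonneg_nonneg)
    then show ?thesis unfolding 1 2 3 unfolding A_def B_def .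
  qed
  also have "\<dots> \<le> ennreal (exp 1 * ((\<Prod>j<d. c j) + (\<Sum>i\<in>I. exp t * ((\<Prod>j<d. c j) * (l * real_of_int (k i))))))"
    by (intro ennreal_leI mult_left_mono add_left_mono sum_mono pG) auto
  also have "exp 1 * ((\<Prod>j<d. c j) + (\<Sum>i\<in>I. exp t * ((\<Prod>j<d. c j) * (l * real_of_int (k i)))))
     = exp 1 * 3 ^ d * (1 / l) ^ card I * (1 + exp t * l * (\<Sum>i\<in>I. real_of_int (k i)))"
    unfolding pc by (simp add: sum_distrib_left algebra_simps)
  finally show ?thesis .
qed

end

section \<open>Comparison of gains at two scales\<close>

lemma prod_list_ennreal_exp:
  assumes "\<And>a. a \<in> set c \<Longrightarrow> g a = ennreal (e * exp (f a))" "e \<ge> 0"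
  shows "prod_list (map g c) = ennreal (e ^ length c * exp (\<Sum>a\<leftarrow>c. f a))"
  using assms(1)
proof (induction c)
  case (Cons a c)
  then have IH: "prod_list (map g c) = ennreal (e ^ length c * exp (\<Sum>a\<leftarrow>c. f a))" by simp
  have "prod_list (map g (a # c)) = ennreal (e * exp (f a)) * ennreal (e ^ length c * exp (\<Sum>a\<leftarrow>c. f a))"
    using Cons.prems[of a] IH by simp
  also have "\<dots> = ennreal (e * exp (f a) * (e ^ length c * exp (\<Sum>a\<leftarrow>c. f a)))"
    using assms(2) by (intro ennreal_mult[symmetric]) auto
  also have "e * exp (f a) * (e ^ length c * exp (\<Sum>a\<leftarrow>c. f a)) = e ^ length (a # c) * exp (\<Sum>a\<leftarrow>a # c. f a)"
    by (simp add: exp_add mult_ac)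
  finally show ?case .
qed simp

lemma length_chain_edges [simp]: "length (chain_edges d c) = length c"
  by (induction d c rule: chain_edges.induct) auto

context coarse begin

text \<open>The exponent of a tilted count. The summand 1 per open edge offsets the gap costs, whose
  total along an optimal path is at most the number of open edges plus l times the height; t is the
  reward for a bad gap.\<close>

definition gap_weight :: "real \<Rightarrow> real \<Rightarrow> int list \<times> nat \<times> bool \<Rightarrow> real" where
  "gap_weight l t = (\<lambda>(v, j, s). 1 - vcost l v + t * of_bool (bad_gap v))"

text \<open>The sum over all chains dominates the term of the unknown chain of an optimal path and,
  unlike that term, has an expectation that factorizes.\<close>

definition chain_sum :: "real \<Rightarrow> real \<Rightarrow> (int list \<times> nat \<Rightarrow> nat) \<Rightarrow> ennreal" where
  "chain_sum l t \<tau> = (\<integral>\<^sup>+c. (if chain_for \<tau> UNIV c then ennreal (exp (\<Sum>a\<leftarrow>c. gap_weight l t a)) else 0) \<partial>count_space UNIV)"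

text \<open>The edges of a fixed chain are distinct, so all of them are open with probability
  eps^length, and the weight is a product over the entries. An entry is a gap with one of d axes and
  one of two orientations, whence the factor 2 * d; the smallness hypothesis makes the total weight
  of an entry at most 1/2.\<close>

lemma chain_sum_expectation:
  assumes eps: "0 \<le> eps" "eps \<le> 1" and l: "0 < l" "l \<le> 1"
    and small: "2 * real d * eps * (exp 1 * 3 ^ d * (1 / l) ^ card I * (1 + exp t * l * (\<Sum>i\<in>I. real_of_int (k i)))) \<le> 1 / 2"
  shows "(\<integral>\<^sup>+u. chain_sum l t (thresh eps u) \<partial>unif_env d) \<le> 2"
proof -
  define V where "V a = (length (fst a) = d \<and> fst (snd a) < d)" for a :: "int list \<times> nat \<times> bool"
  define g where "g a = (if V a then ennreal (eps * exp (gap_weight l t a)) else 0)" for a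
  define w where "w c = ennreal (exp (\<Sum>a\<leftarrow>c. gap_weight l t a))" for c
  \<comment> \<open>The part of \<open>chain_for\<close> that does not depend on the labels; what
    remains is an event about finitely many of them.\<close>
  define st where "st c \<longleftrightarrow> (\<forall>a\<in>set c. V a) \<and> distinct (chain_edges d c) \<and> set (chain_edges d c) \<subseteq> edge_set d" for c
  have cf: "chain_for (thresh eps u) UNIV c \<longleftrightarrow> st c \<and> (\<forall>e\<in>set (chain_edges d c). u e \<in> {..<eps})" for u c
    unfolding chain_for_def st_def V_def thresh_def by (auto split: if_splits)
  have ev: "{u \<in> space (unif_env d). \<forall>e\<in>set (chain_edges d c). u e \<in> {..<eps}} \<in> sets (unif_env d)" if "st c" for c
  proof (rule sets.sets_Collect_finite_All)
    fix e assume "e \<in> set (chain_edges d c)"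
    then have "e \<in> edge_set d" using that by (auto simp: st_def)
    then have "(\<lambda>u. u e) \<in> measurable (unif_env d) unif01"
      unfolding unif_env_def by (rule measurable_component_singleton)
    from measurable_sets[OF this, of "{..<eps}"]
    show "{u \<in> space (unif_env d). u e \<in> {..<eps}} \<in> sets (unif_env d)"
      by (simp add: vimage_def Int_def conj_commute)
  qed simp
  have f: "(if chain_for (thresh eps u) UNIV c then w c else 0)
      = (if st c then w c * indicator {u \<in> space (unif_env d). \<forall>e\<in>set (chain_edges d c). u e \<in> {..<eps}} u else 0)"
    if "u \<in> space (unif_env d)" for u c
    using that by (auto simp: cf indicator_def)
  have single: "(\<integral>\<^sup>+u. (if chain_for (thresh eps u) UNIV c then w c else 0) \<partial>unif_env d) \<le> prod_list (map g c)" for c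
  proof (cases "st c")
    case False then show ?thesis by (simp add: cf)
  next
    case True
    have "(\<integral>\<^sup>+u. (if chain_for (thresh eps u) UNIV c then w c else 0) \<partial>unif_env d)
      = (\<integral>\<^sup>+u. w c * indicator {u \<in> space (unif_env d). \<forall>e\<in>set (chain_edges d c). u e \<in> {..<eps}} u \<partial>unif_env d)"
      by (intro nn_integral_cong) (use f True in auto)
    also have "\<dots> = w c * emeasure (unif_env d) {u \<in> space (unif_env d). \<forall>e\<in>set (chain_edges d c). u e \<in> {..<eps}}"
      by (rule nn_integral_cmult_indicator[OF ev[OF True]])
    also have "emeasure (unif_env d) {u \<in> space (unif_env d). \<forall>e\<in>set (chain_edges d c). u e \<in> {..<eps}} = (\<Prod>e\<in>set (chain_edges d c). emeasure unif01 {..<eps})"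
      unfolding unif_env_def using True by (intro unif_prod.emeasure_PiM_Collect) (auto simp: st_def)
    also have "\<dots> = ennreal (eps ^ length c)"
      using True distinct_card[of "chain_edges d c"] eps by (simp add: emeasure_unif01_less ennreal_power st_def)
    also have "w c * ennreal (eps ^ length c) = prod_list (map g c)"
      using True eps unfolding w_def
      by (subst prod_list_ennreal_exp[of c g eps "gap_weight l t"]) (auto simp: g_def st_def mult.commute ennreal_mult)
    finally show ?thesis by simp
  qed
  have W: "(\<integral>\<^sup>+a. g a \<partial>count_space UNIV) \<le> ennreal (1/2)"
  proof -
    define h where "h v = (if length v = d then ennreal (exp (1 - vcost l v + t * of_bool (bad_gap v))) else 0)" for v
    have "(\<integral>\<^sup>+a. g a \<partial>count_space UNIV) = (\<integral>\<^sup>+v. \<integral>\<^sup>+q. g (v, q) \<partial>count_space UNIV \<partial>count_space UNIV)"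
      by (rule nn_integral_fst_count_space[symmetric])
    also have "\<dots> = (\<integral>\<^sup>+v. (ennreal eps * h v) * ennreal (2 * real d) \<partial>count_space UNIV)"
    proof (rule nn_integral_cong)
      fix v
      have "(\<integral>\<^sup>+q. g (v, q) \<partial>count_space UNIV) = (\<integral>\<^sup>+q. (ennreal eps * h v) * indicator ({..<d} \<times> (UNIV :: bool set)) q \<partial>count_space UNIV)"
        by (intro nn_integral_cong) (use eps in \<open>auto simp: g_def h_def V_def gap_weight_def indicator_def ennreal_mult\<close>)
      also have "\<dots> = (ennreal eps * h v) * emeasure (count_space UNIV) ({..<d} \<times> (UNIV :: bool set))"
        by (rule nn_integral_cmult_indicator) simp
      also have "emeasure (count_space UNIV) ({..<d} \<times> (UNIV :: bool set)) = ennreal (2 * real d)"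
        by (subst emeasure_count_space_finite) (auto simp: card_cartesian_product ennreal_of_nat_eq_real_of_nat mult.commute)
      finally show "(\<integral>\<^sup>+q. g (v, q) \<partial>count_space UNIV) = (ennreal eps * h v) * ennreal (2 * real d)" .
    qed
    also have "\<dots> = ennreal eps * (\<integral>\<^sup>+v. h v \<partial>count_space UNIV) * ennreal (2 * real d)"
      by (simp add: nn_integral_multc nn_integral_cmult)
    also have "\<dots> \<le> ennreal eps * ennreal (exp 1 * 3 ^ d * (1 / l) ^ card I * (1 + exp t * l * (\<Sum>i\<in>I. real_of_int (k i)))) * ennreal (2 * real d)"
      unfolding h_def by (intro mult_right_mono mult_left_mono nn_integral_vcost l) auto
    also have "\<dots> = ennreal (eps * (exp 1 * 3 ^ d * (1 / l) ^ card I * (1 + exp t * l * (\<Sum>i\<in>I. real_of_int (k i)))) * (2 * real d))"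
    proof -
      have "0 \<le> (\<Sum>i\<in>I. real_of_int (k i))" by (intro sum_nonneg) (use k_pos in \<open>smt (verit) of_int_0_le_iff\<close>)
      then have "0 \<le> exp 1 * 3 ^ d * (1 / l) ^ card I * (1 + exp t * l * (\<Sum>i\<in>I. real_of_int (k i)))"
        using l by (intro mult_nonneg_nonneg add_nonneg_nonneg) auto
      then show ?thesis using eps
        by (subst ennreal_mult[symmetric], simp, simp, subst ennreal_mult[symmetric]) auto
    qed
    also have "\<dots> \<le> ennreal (1/2)" using small by (intro ennreal_leI) (simp only: mult_ac)
    finally show ?thesis .
  qed
  have "(\<integral>\<^sup>+u. chain_sum l t (thresh eps u) \<partial>unif_env d)
    = (\<integral>\<^sup>+c. \<integral>\<^sup>+u. (if chain_for (thresh eps u) UNIV c then w c else 0) \<partial>unif_env d \<partial>count_space UNIV)"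
    unfolding chain_sum_def w_def[symmetric]
  proof (rule nn_integral_count_space_nn_integral)
    fix c
    have "(\<lambda>u. if st c then w c * indicator {u \<in> space (unif_env d). \<forall>e\<in>set (chain_edges d c). u e \<in> {..<eps}} u else 0) \<in> borel_measurable (unif_env d)"
    proof (cases "st c")
      case True
      show ?thesis unfolding if_P[OF True]
        by (intro borel_measurable_times_ennreal borel_measurable_const borel_measurable_indicator ev True)
    qed simp
    then show "(\<lambda>u. if chain_for (thresh eps u) UNIV c then w c else 0) \<in> borel_measurable (unif_env d)"
      by (subst measurable_cong[OF f]) auto
  qed simp
  also have "\<dots> \<le> (\<integral>\<^sup>+c. prod_list (map g c) \<partial>count_space UNIV)"
    by (intro nn_integral_mono single)
  also have "\<dots> \<le> 2" by (rule nn_integral_lists_le[OF W])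
  finally show ?thesis .
qed

section \<open>Coarse edges as blocks of parallel fine edges, and the pathwise comparison\<close>

definition cell_vertices :: "int list \<Rightarrow> int list set" where
  "cell_vertices X = {x. length x = d \<and> cell x = X}"

text \<open>An edge belongs to the cell of its lower end, even if its upper end lies in the same
  cell. This gives all blocks, in every direction, the volume of a cell as their size and makes them
  disjoint, so the coarse environment is i.i.d. with a single parameter.\<close>

definition cell_edges :: "int list \<times> nat \<Rightarrow> (int list \<times> nat) set" where
  "cell_edges e = (\<lambda>x. (x, snd e)) ` cell_vertices (fst e)"

definition cell_size :: nat where
  "cell_size = (\<Prod>i<d. nat (k i))"

lemma cell_vertices_card:
  assumes "length X = d"
  shows "finite (cell_vertices X)" "card (cell_vertices X) = cell_size"
proof -
  define A where "A i = {X ! i * k i ..< X ! i * k i + k i}" for i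
  have div: "n div k i = X ! i \<longleftrightarrow> n \<in> A i" for n i
  proof
    assume "n div k i = X ! i"
    then have "n = X ! i * k i + n mod k i" by (metis div_mult_mod_eq)
    then show "n \<in> A i" using k_pos[of i] pos_mod_bound[of "k i" n] pos_mod_sign[of "k i" n]
      unfolding A_def by (metis atLeastLessThan_iff add_strict_left_mono le_add_same_cancel1 less_le_trans zero_less_one)
  next
    assume "n \<in> A i"
    then show "n div k i = X ! i" unfolding A_def using k_pos[of i]
      by (intro int_div_pos_eq[of n "k i" "X ! i" "n - X ! i * k i"]) (auto simp: mult.commute)
  qed
  have bij: "bij_betw (\<lambda>f. map f [0..<d]) (PiE {..<d} A) (cell_vertices X)"
  proof (rule bij_betwI[where g = "\<lambda>x. restrict (\<lambda>i. x ! i) {..<d}"])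
    show "(\<lambda>f. map f [0..<d]) \<in> PiE {..<d} A \<rightarrow> cell_vertices X"
    proof
      fix f assume f: "f \<in> PiE {..<d} A"
      have "cell (map f [0..<d]) = X"
        by (rule nth_equalityI) (use f assms div in \<open>auto simp: PiE_iff\<close>)
      then show "map f [0..<d] \<in> cell_vertices X" by (simp add: cell_vertices_def)
    qed
    show "(\<lambda>x. restrict (\<lambda>i. x ! i) {..<d}) \<in> cell_vertices X \<rightarrow> PiE {..<d} A"
    proof
      fix x assume x: "x \<in> cell_vertices X"
      then have "cell x ! i = X ! i" for i by (simp add: cell_vertices_def)
      then have "x ! i \<in> A i" if "i < d" for i using that div by (metis nth_cell)
      then show "restrict (\<lambda>i. x ! i) {..<d} \<in> PiE {..<d} A" by auto
    qed
    show "restrict (\<lambda>i. map f [0..<d] ! i) {..<d} = f" if "f \<in> PiE {..<d} A" for f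
      using that by (auto simp: fun_eq_iff PiE_iff extensional_def)
    show "map (restrict (\<lambda>i. x ! i) {..<d}) [0..<d] = x" if "x \<in> cell_vertices X" for x
      by (rule nth_equalityI) (use that in \<open>auto simp: cell_vertices_def\<close>)
  qed
  have fin: "finite (PiE {..<d} A)" by (rule finite_PiE) (auto simp: A_def)
  then show "finite (cell_vertices X)" using bij_betw_finite[OF bij] by simp
  have "card (cell_vertices X) = card (PiE {..<d} A)" using bij_betw_same_card[OF bij] by simp
  also have "\<dots> = cell_size" by (simp add: card_PiE A_def cell_size_def)
  finally show "card (cell_vertices X) = cell_size" .
qed

lemma cell_edges_props:
  assumes "e \<in> edge_set d"
  shows "cell_edges e \<subseteq> edge_set d \<and> finite (cell_edges e) \<and> card (cell_edges e) = cell_size"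
proof -
  have l: "length (fst e) = d" "snd e < d" using assms by (auto simp: edge_set_def)
  have "inj_on (\<lambda>x. (x, snd e)) (cell_vertices (fst e))" by (auto simp: inj_on_def)
  then show ?thesis using cell_vertices_card[OF l(1)] l
    by (auto simp: cell_edges_def card_image cell_vertices_def edge_set_def)
qed

lemma cell_edges_disjoint: "disjoint_family_on cell_edges (edge_set d)"
  by (auto simp: disjoint_family_on_def cell_edges_def cell_vertices_def prod_eq_iff)

text \<open>The difference of \<open>vnorm\<close> and \<open>height\<close> counts transversal
  displacement once and backward displacement along I twice, hence dominates the expensive part of
  the cost. Forward displacement is covered by l times \<open>vnorm\<close>.\<close>

lemma vcost_le:
  assumes l: "0 < l" and v: "length v = d"
  shows "vcost l v \<le> l * real_of_int (vnorm v) + real_of_int (vnorm v) - real_of_int (height v)"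
proof -
  have h: "height v = (\<Sum>i<d. if i \<in> I then v ! i else 0)"
  proof -
    have "{..<d} \<inter> I = I" using I_sub by blast
    then show ?thesis unfolding height_def using sum.inter_restrict[of "{..<d}" "\<lambda>i. v ! i" I] by simp
  qed
  have "vcost l v \<le> (\<Sum>i<d. l * real_of_int \<bar>v ! i\<bar> + real_of_int \<bar>v ! i\<bar> - real_of_int (if i \<in> I then v ! i else 0))"
    unfolding vcost_def
  proof (rule sum_mono)
    fix i
    have "0 \<le> l * real_of_int \<bar>v ! i\<bar>" using l by simp
    then show "gap_cost (if i \<in> I then l else 1) (v ! i) \<le> l * real_of_int \<bar>v ! i\<bar> + real_of_int \<bar>v ! i\<bar> - real_of_int (if i \<in> I then v ! i else 0)"
      by (auto simp: gap_cost_def)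
  qed
  then show ?thesis unfolding h vnorm_def v by (simp add: sum.distrib sum_subtractf sum_distrib_left)
qed

lemma height_nonneg_eq_dist1:
  assumes "length y = d" "\<And>i. i < d \<Longrightarrow> y ! i \<ge> 0" "\<And>i. i < d \<Longrightarrow> i \<notin> I \<Longrightarrow> y ! i = 0"
  shows "dist1 (origin d) y = height y"
proof -
  have "dist1 (origin d) y = (\<Sum>i<d. y ! i)" unfolding dist1_def by (rule sum.cong) (use assms in auto)
  also have "\<dots> = height y" unfolding height_def
    by (rule sum.mono_neutral_right) (use assms I_sub in auto)
  finally show ?thesis .
qed

lemma height_diff_le_dist1:
  assumes "length x = d" "length y = d"
  shows "height y - height x \<le> dist1 x y"
proof -
  have "height y - height x = (\<Sum>i\<in>I. y ! i - x ! i)" by (simp add: height_def sum_subtractf)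
  also have "\<dots> \<le> (\<Sum>i\<in>I. \<bar>x ! i - y ! i\<bar>)" by (rule sum_mono) linarith
  also have "\<dots> \<le> (\<Sum>i<d. \<bar>x ! i - y ! i\<bar>)" by (rule sum_mono2) (use I_sub in auto)
  finally show ?thesis by (simp add: dist1_def assms)
qed

text \<open>For fixed labels, take the chain of a simple optimal path. Its gaps have total length at
  most the passage time, hence at most the height of y; as each open step raises the height by at
  most one, gap lengths exceed gap heights by at most the number of open edges. So the costs, net of
  1 per open edge, sum to at most l times the height, and the rest of the chain weight is t times
  the number of bad gaps, which bounds the loss.\<close>

lemma gain_comparison:
  assumes l: "0 < l" and t: "t \<ge> 0"
    and y: "length y = d" "\<And>i. i < d \<Longrightarrow> y ! i \<ge> 0" "\<And>i. i < d \<Longrightarrow> i \<notin> I \<Longrightarrow> y ! i = 0"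
  shows "ennreal (t * (real_of_int (height y) - real (passage_time d (thresh eps u) (origin d) y)
      - (real_of_int (height (cell y)) - real (passage_time d (block_open cell_edges eps u) (origin d) (cell y))) - 2)
      - l * real_of_int (height y)) \<le> chain_sum l t (thresh eps u)"
proof -
  define \<tau> where "\<tau> = thresh eps u"
  define \<tau>' where "\<tau>' = block_open cell_edges eps u"
  define T where "T X = passage_time d \<tau>' (origin d) X" for X
  have edge: "T v \<le> T w + \<tau>' (edge_between w v)" if "adjacent d w v" for v w
    using passage_time_triangle[of "origin d" d w v \<tau>'] passage_time_edge[OF that, of \<tau>'] adjacent_length[OF that]
    unfolding T_def by (simp add: le_trans)
  have T1: "T (step_up X j) \<le> T X + 1 \<and> T X \<le> T (step_up X j) + 1" if "length X = d" "j < d" for X j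
    using edge[OF adjacent_step_up[OF that]] edge[OF adjacent_sym[OF adjacent_step_up[OF that]]]
      block_open_le[of cell_edges eps u "(X, j)"] that unfolding \<tau>'_def by simp
  have T2: "T (step_up (cell z) j) = T (cell z)" if z: "length z = d" "j < d" "\<tau> (z, j) = 0" for z j
  proof -
    have "u (z, j) < eps" using z(3) by (simp add: \<tau>_def thresh_def split: if_splits)
    moreover have "(z, j) \<in> cell_edges (cell z, j)" using z by (simp add: cell_edges_def cell_vertices_def)
    ultimately have "\<tau>' (cell z, j) = 0" unfolding \<tau>'_def block_open_def by auto
    moreover have "length (cell z) = d" by simp
    ultimately show ?thesis
      using edge[OF adjacent_step_up[of "cell z" d j]] edge[OF adjacent_sym[OF adjacent_step_up[of "cell z" d j]]] z(2)
      by simp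
  qed
  obtain p where p: "is_path d (origin d) y p" "distinct p" "passage_time d \<tau> (origin d) y = path_time \<tau> p"
    using passage_time_simple_path[of "origin d" d y \<tau>] y by auto
  have \<tau>1: "\<tau> e \<le> 1" for e unfolding \<tau>_def by (rule thresh_le)
  have T0: "T (origin d) = 0" by (simp add: T_def)
  from chain_exists[where \<tau> = \<tau> and T = T, OF \<tau>1 T0 T1 T2 p(1,2)] obtain c S where
    c: "chain_for \<tau> (set p) c"
    and sm: "(\<Sum>(v, j, s)\<leftarrow>c. vnorm v) + dist1 (chain_end d c) y \<le> int (path_time \<tau> p)"
    and tr: "tracks T S (chain_end d c) y (height y - int (path_time \<tau> p) - int (bad_count c))" by blast
  have D: "height y - int (path_time \<tau> p) - int (bad_count c) \<le> height (cell y) - int (T (cell y)) + 2"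
    by (rule cell_gain_bound[OF tr y(1) T1])
  have pt: "int (path_time \<tau> p) \<le> height y"
    using passage_time_le_dist1[of "origin d" d y \<tau>] \<tau>1 y(1) height_nonneg_eq_dist1[OF y] p(3) by simp
  have valid: "\<forall>(v, j, s)\<in>set c. length v = d \<and> j < d" using c by (simp add: chain_for_def)
  have hc: "height (chain_end d c) \<le> (\<Sum>(v, j, s)\<leftarrow>c. height v) + int (length c)"
    by (rule height_chain_end[OF valid])
  have hd: "height y - height (chain_end d c) \<le> dist1 (chain_end d c) y"
    by (rule height_diff_le_dist1) (use y in auto)
  have sv: "(\<Sum>(v, j, s)\<leftarrow>c. vcost l v) \<le> l * real_of_int (\<Sum>(v, j, s)\<leftarrow>c. vnorm v) + real_of_int (\<Sum>(v, j, s)\<leftarrow>c. vnorm v) - real_of_int (\<Sum>(v, j, s)\<leftarrow>c. height v)"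
    using valid
  proof (induction c)
    case (Cons a c)
    obtain v j s where a: "a = (v, j, s)" by (cases a)
    show ?case using Cons vcost_le[OF l, of v] by (simp add: a algebra_simps)
  qed simp
  have d0: "dist1 (chain_end d c) y \<ge> 0" by (simp add: dist1_def sum_nonneg)
  have "(\<Sum>(v, j, s)\<leftarrow>c. vnorm v) \<le> height y" using sm pt d0 by linarith
  then have "l * real_of_int (\<Sum>(v, j, s)\<leftarrow>c. vnorm v) \<le> l * real_of_int (height y)" using l by simp
  moreover have "real_of_int (\<Sum>(v, j, s)\<leftarrow>c. vnorm v) - real_of_int (\<Sum>(v, j, s)\<leftarrow>c. height v) \<le> real (length c)"
    using sm pt hc hd by linarith
  ultimately have sv2: "(\<Sum>(v, j, s)\<leftarrow>c. vcost l v) \<le> l * real_of_int (height y) + real (length c)"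
    using sv by linarith
  have gw: "(\<Sum>a\<leftarrow>c. gap_weight l t a) = real (length c) - (\<Sum>(v, j, s)\<leftarrow>c. vcost l v) + t * real (bad_count c)"
    by (induction c) (auto simp: gap_weight_def bad_count_def algebra_simps)
  define D' where "D' = real_of_int (height y) - real (passage_time d \<tau> (origin d) y)
      - (real_of_int (height (cell y)) - real (T (cell y))) - 2"
  have "D' \<le> real (bad_count c)" unfolding D'_def p(3) using D by linarith
  then have "t * D' \<le> t * real (bad_count c)" using t by (rule mult_left_mono)
  then have "t * D' - l * real_of_int (height y) \<le> (\<Sum>a\<leftarrow>c. gap_weight l t a)" using sv2 unfolding gw by linarith
  \<comment> \<open>Since only the mean loss is wanted, the crude bound of a number by its
    exponential is enough; the exponential then is one term of the chain sum.\<close>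
  also have "\<dots> \<le> exp (\<Sum>a\<leftarrow>c. gap_weight l t a)"
    using exp_ge_add_one_self[of "\<Sum>a\<leftarrow>c. gap_weight l t a"] by linarith
  finally have "ennreal (t * D' - l * real_of_int (height y)) \<le> ennreal (exp (\<Sum>a\<leftarrow>c. gap_weight l t a))"
    by (rule ennreal_leI)
  also have "\<dots> = (if chain_for \<tau> UNIV c then ennreal (exp (\<Sum>a\<leftarrow>c. gap_weight l t a)) else 0)"
    using chain_for_mono[OF c, of UNIV] by simp
  also have "\<dots> \<le> chain_sum l t \<tau>"
    unfolding chain_sum_def by (rule nn_integral_ge_point) simp
  finally show ?thesis unfolding D'_def T_def \<tau>_def \<tau>'_def .
qed

text \<open>The pointwise bound is integrated. As \<open>ennreal\<close> cuts off negative values,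
  it controls the positive part, whose mean lies above the mean itself.\<close>

lemma mean_gain_comparison:
  assumes eps: "0 \<le> eps" "eps \<le> 1" and l: "0 < l" "l \<le> 1" and t: "t \<ge> 0" and d: "d > 0"
    and small: "2 * real d * eps * (exp 1 * 3 ^ d * (1 / l) ^ card I * (1 + exp t * l * (\<Sum>i\<in>I. real_of_int (k i)))) \<le> 1 / 2"
    and y: "length y = d" "\<And>i. i < d \<Longrightarrow> y ! i \<ge> 0" "\<And>i. i < d \<Longrightarrow> i \<notin> I \<Longrightarrow> y ! i = 0"
  shows "t * (real_of_int (height y) - mean_time0 d eps y
      - (real_of_int (height (cell y)) - mean_time0 d (1 - (1 - eps) ^ cell_size) (cell y)) - 2)
      \<le> l * real_of_int (height y) + 2"
proof -
  define f where "f u = t * (real_of_int (height y) - real (passage_time d (thresh eps u) (origin d) y)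
      - (real_of_int (height (cell y)) - real (passage_time d (block_open cell_edges eps u) (origin d) (cell y))) - 2)
      - l * real_of_int (height y)" for u
  have L: "cell_edges e \<subseteq> edge_set d \<and> finite (cell_edges e)" if "e \<in> edge_set d" for e
    using cell_edges_props[OF that] by simp
  have i1: "integrable (unif_env d) (\<lambda>u. real (passage_time d (thresh eps u) (origin d) y))"
    by (rule passage_thresh_integrable) (use y in auto)
  have i2: "integrable (unif_env d) (\<lambda>u. real (passage_time d (block_open cell_edges eps u) (origin d) (cell y)))"
    by (rule passage_block_integrable[OF L]) auto
  have int: "integrable (unif_env d) f" unfolding f_def using i1 i2 by simp
  have "(\<integral>u. f u \<partial>unif_env d) \<le> (\<integral>u. max 0 (f u) \<partial>unif_env d)"
    by (rule integral_mono) (use int in auto)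
  also have "\<dots> \<le> 2"
  proof -
    have "ennreal (\<integral>u. max 0 (f u) \<partial>unif_env d) = (\<integral>\<^sup>+u. ennreal (max 0 (f u)) \<partial>unif_env d)"
      by (rule nn_integral_eq_integral[symmetric]) (use int in auto)
    also have "\<dots> \<le> (\<integral>\<^sup>+u. chain_sum l t (thresh eps u) \<partial>unif_env d)"
    proof (rule nn_integral_mono)
      fix u
      have "ennreal (max 0 (f u)) = ennreal (f u)" by (simp add: max_def ennreal_neg)
      then show "ennreal (max 0 (f u)) \<le> chain_sum l t (thresh eps u)"
        using gain_comparison[OF l(1) t y, of eps u] by (simp add: f_def)
    qed
    also have "\<dots> \<le> ennreal 2" using chain_sum_expectation[OF eps l small] by simp
    finally show ?thesis by (subst (asm) ennreal_le_iff) auto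
  qed
  also have "(\<integral>u. f u \<partial>unif_env d) = t * (real_of_int (height y) - mean_time0 d eps y
      - (real_of_int (height (cell y)) - (\<integral>u. real (passage_time d (block_open cell_edges eps u) (origin d) (cell y)) \<partial>unif_env d)) - 2)
      - l * real_of_int (height y)"
    unfolding f_def mean_time_def using i1 i2 by (simp add: unif_env.prob_space)
  also have "(\<integral>u. real (passage_time d (block_open cell_edges eps u) (origin d) (cell y)) \<partial>unif_env d)
     = mean_time0 d (1 - (1 - eps) ^ cell_size) (cell y)"
  proof -
    have "0 \<le> (1 - eps) ^ cell_size" "(1 - eps) ^ cell_size \<le> 1" using eps by (auto intro: power_le_one)
    then show ?thesis
      using block_expect[OF eps d cell_edges_props cell_edges_disjoint, of "origin d" "cell y"]
        env_expect[of "1 - (1 - eps) ^ cell_size" d "origin d" "cell y"] d by simp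
  qed
  finally show ?thesis by linarith
qed

end

section \<open>Scaling of the time constant\<close>

lemma l1norm_sum: "length z = d \<Longrightarrow> l1norm z = (\<Sum>i<d. \<bar>z ! i\<bar>)"
  by (simp add: l1norm_def sum_list_sum_nth atLeast0LessThan)

context coarse begin

lemma height_nvec_bounds:
  assumes z: "length z = d" "\<And>i. i < d \<Longrightarrow> z ! i \<ge> 0" "\<And>i. i < d \<Longrightarrow> i \<notin> I \<Longrightarrow> z ! i = 0"
  shows "real_of_int (height (nvec n z)) \<le> real n * l1norm z"
    "real n * l1norm z - real d \<le> real_of_int (height (nvec n z))"
proof -
  have e: "l1norm z = (\<Sum>i\<in>I. z ! i)"
  proof -
    have "l1norm z = (\<Sum>i<d. z ! i)" unfolding l1norm_sum[OF z(1)] by (rule sum.cong) (use z in auto)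
    also have "\<dots> = (\<Sum>i\<in>I. z ! i)" by (rule sum.mono_neutral_right) (use z I_sub in auto)
    finally show ?thesis .
  qed
  have h: "real_of_int (height (nvec n z)) = (\<Sum>i\<in>I. real_of_int \<lfloor>real n * z ! i\<rfloor>)"
    unfolding height_def of_int_sum by (rule sum.cong) (use z I_sub in auto)
  show "real_of_int (height (nvec n z)) \<le> real n * l1norm z"
    unfolding h e sum_distrib_left by (rule sum_mono) simp
  have "(\<Sum>i\<in>I. real n * z ! i - 1) \<le> (\<Sum>i\<in>I. real_of_int \<lfloor>real n * z ! i\<rfloor>)"
    by (rule sum_mono) linarith
  moreover have "card I \<le> d" using card_mono[OF _ I_sub] by simp
  ultimately show "real n * l1norm z - real d \<le> real_of_int (height (nvec n z))"
    unfolding h e by (simp add: sum_subtractf sum_distrib_left)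
qed

text \<open>After division by n the additive constants disappear, and of the expected loss the term
  l * |z| / t remains.\<close>

lemma time_const_comparison:
  assumes eps: "0 \<le> eps" "eps \<le> 1" "real cell_size * eps \<le> eps'" "eps' \<le> 1"
    and l: "0 < l" "l \<le> 1" and t: "t > 0" and d: "d > 0"
    and small: "2 * real d * eps * (exp 1 * 3 ^ d * (1 / l) ^ card I * (1 + exp t * l * (\<Sum>i\<in>I. real_of_int (k i)))) \<le> 1 / 2"
    and z: "length z = d" "\<And>i. i < d \<Longrightarrow> z ! i \<ge> 0" "\<And>i. i < d \<Longrightarrow> i \<notin> I \<Longrightarrow> z ! i = 0"
  defines "z' \<equiv> map (\<lambda>i. z ! i / real_of_int (k i)) [0..<d]"
  shows "l1norm z - time_const d eps z \<le> l1norm z' - time_const d eps' z' + l * l1norm z / t"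
proof -
  define e where "e = 1 - (1 - eps) ^ cell_size"
  have e: "0 \<le> e" "e \<le> 1" using eps by (auto simp: e_def intro: power_le_one)
  \<comment> \<open>Bernoulli's inequality puts the exact coarse parameter below cell_size * eps,
    hence below eps'; raising it to eps' can only increase the gain.\<close>
  have "1 + real cell_size * (- eps) \<le> (1 + (- eps)) ^ cell_size" using eps by (intro Bernoulli_inequality) auto
  then have e': "e \<le> eps'" using eps(3) by (simp add: e_def)
  have z': "length z' = d" "\<And>i. i < d \<Longrightarrow> z' ! i \<ge> 0" "\<And>i. i < d \<Longrightarrow> i \<notin> I \<Longrightarrow> z' ! i = 0"
    using z k_pos by (auto simp: z'_def intro!: divide_nonneg_nonneg) (smt (verit) k_pos)
  \<comment> \<open>Integer parts nest: dividing a rounded value by an integer and rounding again is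
    the same as rounding the quotient. The coarse end point is therefore hit exactly, for every
    n.\<close>
  have cell: "cell (nvec n z) = nvec n z'" for n
  proof (rule nth_equalityI)
    fix i assume "i < length (cell (nvec n z))"
    then have i: "i < d" by simp
    have "\<lfloor>real n * z ! i / real_of_int (k i)\<rfloor> = \<lfloor>real n * z ! i\<rfloor> div k i"
      using k_pos[of i] by (intro floor_divide_real_eq_div) auto
    then show "cell (nvec n z) ! i = nvec n z' ! i" using i z by (simp add: z'_def)
  qed (simp add: z'_def)
  have "mean_time0 d e (nvec n z') \<le> mean_time0 d eps (nvec n z) + (l1norm z' - l1norm z + l * l1norm z / t) * real n + (real d + 2 + 2 / t)" for n
  proof -
    have "t * (real_of_int (height (nvec n z)) - mean_time0 d eps (nvec n z)
      - (real_of_int (height (nvec n z')) - mean_time0 d e (nvec n z')) - 2) \<le> l * real_of_int (height (nvec n z)) + 2"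
      unfolding e_def cell[symmetric]
      by (rule mean_gain_comparison[OF eps(1,2) l _ d small]) (use t z in auto)
    also have "\<dots> \<le> l * (real n * l1norm z) + 2"
      using height_nvec_bounds[OF z, of n] l by simp
    finally have "real_of_int (height (nvec n z)) - mean_time0 d eps (nvec n z)
      - (real_of_int (height (nvec n z')) - mean_time0 d e (nvec n z')) - 2 \<le> (l * (real n * l1norm z) + 2) / t"
      using t by (simp add: pos_le_divide_eq mult.commute)
    then show ?thesis
      using height_nvec_bounds[OF z, of n] height_nvec_bounds[OF z', of n] by (simp add: algebra_simps add_divide_distrib)
  qed
  from LIMSEQ_linear_le[OF time_const_LIMSEQ[OF e d z'(1)] time_const_LIMSEQ[OF eps(1,2) d z(1)] this]
  have "time_const d e z' \<le> time_const d eps z + (l1norm z' - l1norm z + l * l1norm z / t)" .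
  moreover have "time_const d eps' z' \<le> time_const d e z'"
    by (rule time_const_antimono[OF e(1) e' eps(4) d z'(1)])
  ultimately show ?thesis by linarith
qed

end

section \<open>The gain, and its comparison through anisotropic boxes\<close>

definition gain :: "nat \<Rightarrow> real \<Rightarrow> real list \<Rightarrow> real" where
  "gain d eps z = l1norm z - time_const d eps z"

lemma gain_lipschitz:
  assumes eps: "0 \<le> eps" "eps \<le> 1" and d: "d > 0" and z: "length z = d" "length w = d"
  shows "gain d eps w \<le> gain d eps z + 2 * (\<Sum>i<d. \<bar>z ! i - w ! i\<bar>)"
proof -
  have "l1norm w \<le> l1norm z + (\<Sum>i<d. \<bar>z ! i - w ! i\<bar>)"
    unfolding l1norm_sum[OF z(1)] l1norm_sum[OF z(2)] sum.distrib[symmetric] by (rule sum_mono) linarith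
  moreover have "time_const d eps z \<le> time_const d eps w + (\<Sum>i<d. \<bar>w ! i - z ! i\<bar>)"
    by (rule time_const_lipschitz[OF eps d z(2,1)])
  ultimately show ?thesis by (simp add: gain_def abs_minus_commute)
qed

lemma gain_nat_scale:
  assumes eps: "0 \<le> eps" "eps \<le> 1" and d: "d > 0" and z: "length z = d" and m: "m > 0"
  shows "gain d eps (map (\<lambda>t. real m * t) z) = real m * gain d eps z"
proof -
  have "l1norm (map (\<lambda>t. real m * t) z) = real m * l1norm z"
    using z by (simp add: l1norm_sum[of _ d] abs_mult sum_distrib_left)
  then show ?thesis using time_const_nat_scale[OF assms] by (simp add: gain_def algebra_simps)
qed

definition pos_on :: "nat \<Rightarrow> nat set \<Rightarrow> real list \<Rightarrow> bool" where
  "pos_on d I z \<longleftrightarrow> length z = d \<and> (\<forall>i\<in>I. z ! i > 0) \<and> (\<forall>i<d. i \<notin> I \<longrightarrow> z ! i = 0)"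

text \<open>Fixed by the smallness condition of the chain sum: for l = gap_const d * eps^(1/m) and a
  bad-gap term of at most 1, the weight of an entry is at most 4 * d * e * 3^d * (gap_const d)^(-m),
  and 4 * d * e * 3^d is half of \<open>gap_const d\<close>.\<close>

definition gap_const :: "nat \<Rightarrow> real" where
  "gap_const d = 8 * real d * exp 1 * 3 ^ d"

lemma gap_const_ge_1: "d > 0 \<Longrightarrow> gap_const d \<ge> 1"
proof -
  assume d: "d > 0"
  have "1 * 1 * 1 * 1 \<le> 8 * real d * exp 1 * 3 ^ d"
    using d by (intro mult_mono) auto
  then show ?thesis by (simp add: gap_const_def)
qed

text \<open>Boxes whose sides are the integer parts of N * z_i / w_i turn z approximately into w /
  N. The coarse gain is thus that of w divided by N, up to a rounding error controlled by Lipschitz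
  continuity. The ratios z_i / w_i allow any two directions positive on I to be compared, while N
  sets the scale.\<close>

lemma gain_scaling_bound:
  assumes I: "I \<subseteq> {..<d}" "I \<noteq> {}" and zw: "pos_on d I z" "pos_on d I w"
    and eps: "0 < eps" "eps \<le> 1" "0 < eps'" "eps' \<le> 1"
    and N: "N > 0" "\<And>i. i \<in> I \<Longrightarrow> real N * z ! i / w ! i \<ge> 1"
    and vol: "real N ^ card I * (\<Prod>i\<in>I. z ! i / w ! i) * eps \<le> eps'"
    and l: "gap_const d * eps powr (1 / real (card I)) \<le> 1"
    and t: "t > 0" "exp t * (gap_const d * eps powr (1 / real (card I)) * (real N * (\<Sum>i\<in>I. z ! i / w ! i))) \<le> 1"
  shows "gain d eps z \<le> (gain d eps' w + 2 * (\<Sum>i\<in>I. \<bar>w ! i - real N * (z ! i / real_of_int \<lfloor>real N * z ! i / w ! i\<rfloor>)\<bar>)) / real N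
     + gap_const d * eps powr (1 / real (card I)) * l1norm z / t"
proof -
  define k where "k i = (if i \<in> I then \<lfloor>real N * z ! i / w ! i\<rfloor> else 1)" for i
  have d: "d > 0" using I by (cases d) auto
  have k1: "k i \<ge> 1" for i using N(2)[of i] by (auto simp: k_def le_floor_iff)
  interpret coarse d I k
    by unfold_locales (use I k1 in \<open>auto simp: k_def\<close>)
  have lz: "length z = d" "length w = d" using zw by (auto simp: pos_on_def)
  have zp: "z ! i > 0" "w ! i > 0" if "i \<in> I" for i using zw that by (auto simp: pos_on_def)
  have z0: "z ! i = 0" "w ! i = 0" if "i < d" "i \<notin> I" for i using zw that by (auto simp: pos_on_def)
  have zn: "z ! i \<ge> 0" if "i < d" for i using zp[of i] z0[of i] that by (cases "i \<in> I") auto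
  define m where "m = card I"
  have m: "m > 0" using I by (simp add: m_def card_gt_0_iff)
  have kle: "real_of_int (k i) \<le> real N * (z ! i / w ! i)" if "i \<in> I" for i
    using that by (simp add: k_def)
  have cs: "real cell_size \<le> real N ^ m * (\<Prod>i\<in>I. z ! i / w ! i)"
  proof -
    have "cell_size = (\<Prod>i\<in>I. nat (k i))"
      unfolding cell_size_def by (rule prod.mono_neutral_right) (use I in \<open>auto simp: k_def\<close>)
    then have "real cell_size = (\<Prod>i\<in>I. real (nat (k i)))" by simp
    also have "\<dots> \<le> (\<Prod>i\<in>I. real N * (z ! i / w ! i))"
    proof (rule prod_mono)
      fix i assume "i \<in> I"
      then show "0 \<le> real (nat (k i)) \<and> real (nat (k i)) \<le> real N * (z ! i / w ! i)"
        using kle[of i] k1[of i] by simp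
    qed
    also have "\<dots> = real N ^ m * (\<Prod>i\<in>I. z ! i / w ! i)" by (simp only: prod.distrib prod_constant m_def)
    finally show ?thesis .
  qed
  have cs': "real cell_size * eps \<le> eps'"
  proof -
    have "real cell_size * eps \<le> real N ^ m * (\<Prod>i\<in>I. z ! i / w ! i) * eps"
      using eps by (intro mult_right_mono cs) auto
    also have "\<dots> \<le> eps'" using vol by (simp only: m_def)
    finally show ?thesis .
  qed
  define \<Lambda> where "\<Lambda> = gap_const d"
  have \<Lambda>: "\<Lambda> \<ge> 1" using gap_const_ge_1[OF d] by (simp add: \<Lambda>_def)
  define l where "l = \<Lambda> * eps powr (1 / real m)"
  have l0: "0 < l" "l \<le> 1" using \<Lambda> eps l by (auto simp: l_def \<Lambda>_def m_def)
  \<comment> \<open>This is where the exponent 1/m comes from: the weighted count of gaps grows like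
    l^(-m) and has to be compensated by the density eps of open edges.\<close>
  have lm: "(1 / l) ^ m * eps = (1 / \<Lambda>) ^ m"
  proof -
    have "(eps powr (1 / real m)) ^ m = eps" using eps m by (simp add: powr_realpow[symmetric] powr_powr)
    then have "l ^ m = \<Lambda> ^ m * eps" by (simp add: l_def power_mult_distrib)
    then show ?thesis using eps \<Lambda> by (simp add: power_one_over field_simps)
  qed
  have "exp t * l * (\<Sum>i\<in>I. real_of_int (k i)) \<le> exp t * l * (\<Sum>i\<in>I. real N * (z ! i / w ! i))"
    using l0 by (intro mult_left_mono sum_mono kle) auto
  also have "\<dots> \<le> 1" using t by (simp add: l_def \<Lambda>_def m_def sum_distrib_left mult_ac)
  finally have tk: "exp t * l * (\<Sum>i\<in>I. real_of_int (k i)) \<le> 1" .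
  have small: "2 * real d * eps * (exp 1 * 3 ^ d * (1 / l) ^ card I * (1 + exp t * l * (\<Sum>i\<in>I. real_of_int (k i)))) \<le> 1 / 2"
  proof -
    have "2 * real d * eps * (exp 1 * 3 ^ d * (1 / l) ^ card I * (1 + exp t * l * (\<Sum>i\<in>I. real_of_int (k i))))
      = (2 * real d * exp 1 * 3 ^ d) * ((1 / l) ^ m * eps) * (1 + exp t * l * (\<Sum>i\<in>I. real_of_int (k i)))"
      by (simp add: m_def)
    also have "\<dots> \<le> (2 * real d * exp 1 * 3 ^ d) * ((1 / l) ^ m * eps) * 2"
      using tk l0 eps by (intro mult_left_mono) auto
    also have "\<dots> = (\<Lambda> / 2) * (1 / \<Lambda>) ^ m" unfolding lm by (simp add: \<Lambda>_def gap_const_def)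
    also have "\<dots> \<le> (\<Lambda> / 2) * (1 / \<Lambda>) ^ 1"
      using \<Lambda> m by (intro mult_left_mono power_decreasing) auto
    also have "\<dots> = 1 / 2" using \<Lambda> by simp
    finally show ?thesis .
  qed
  define z' where "z' = map (\<lambda>i. z ! i / real_of_int (k i)) [0..<d]"
  have lz': "length z' = d" by (simp add: z'_def)
  have "gain d eps z \<le> gain d eps' z' + l * l1norm z / t"
    unfolding gain_def z'_def
    by (rule time_const_comparison[OF _ eps(2) cs' eps(4) l0 t(1) d small]) (use eps lz zn z0 in auto)
  moreover have "gain d eps' z' = gain d eps' (map (\<lambda>t. real N * t) z') / real N"
    using gain_nat_scale[of eps' d z' N] eps d lz' N by simp
  moreover have "gain d eps' (map (\<lambda>t. real N * t) z') \<le> gain d eps' w + 2 * (\<Sum>i<d. \<bar>w ! i - map (\<lambda>t. real N * t) z' ! i\<bar>)"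
    by (rule gain_lipschitz) (use eps d lz lz' in auto)
  moreover have "(\<Sum>i<d. \<bar>w ! i - map (\<lambda>t. real N * t) z' ! i\<bar>) = (\<Sum>i\<in>I. \<bar>w ! i - real N * (z ! i / real_of_int \<lfloor>real N * z ! i / w ! i\<rfloor>)\<bar>)"
  proof (rule sum.mono_neutral_cong_right)
    show "\<forall>i\<in>{..<d} - I. \<bar>w ! i - map (\<lambda>t. real N * t) z' ! i\<bar> = 0" using z0 by (auto simp: z'_def)
    fix i assume "i \<in> I"
    then show "\<bar>w ! i - map (\<lambda>t. real N * t) z' ! i\<bar> = \<bar>w ! i - real N * (z ! i / real_of_int \<lfloor>real N * z ! i / w ! i\<rfloor>)\<bar>"
      using I by (auto simp: z'_def k_def)
  qed (use I in auto)
  ultimately show ?thesis unfolding l_def \<Lambda>_def m_def using N(1)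
    by (smt (verit, best) divide_right_mono of_nat_0_le_iff)
qed

section \<open>Convergence of the rescaled gain\<close>

text \<open>A quantitative form of limsup f \<le> liminf g that does not presuppose boundedness.\<close>

definition asymp_le :: "(real \<Rightarrow> real) \<Rightarrow> (real \<Rightarrow> real) \<Rightarrow> bool" where
  "asymp_le f g \<longleftrightarrow> (\<exists>e. (e \<longlongrightarrow> 0) (at_right 0) \<and>
     (\<forall>\<^sub>F x in at_right 0. 0 \<le> e x \<and> (\<forall>\<eta>>0. \<forall>\<^sub>F y in at_right 0. f y \<le> g x + e x + \<eta>)))"

text \<open>The limit is the infimum of f + e near 0. A point x at which f + e is almost minimal
  bounds f from above at all small y, and since e tends to 0, f cannot stay below the infimum.
  Nonnegativity of f makes the infimum finite.\<close>

lemma asymp_le_refl_convergent: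
  assumes "asymp_le f f" and nn: "\<forall>\<^sub>F x in at_right 0. 0 \<le> f x"
  shows "\<exists>C. (f \<longlongrightarrow> C) (at_right 0)"
proof -
  obtain e where e: "(e \<longlongrightarrow> 0) (at_right 0)"
    and ev: "\<forall>\<^sub>F x in at_right 0. 0 \<le> e x \<and> (\<forall>\<eta>>0. \<forall>\<^sub>F y in at_right 0. f y \<le> f x + e x + \<eta>)"
    using assms(1) by (auto simp: asymp_le_def)
  have "\<forall>\<^sub>F x in at_right 0. 0 \<le> f x \<and> 0 \<le> e x \<and> (\<forall>\<eta>>0. \<forall>\<^sub>F y in at_right 0. f y \<le> f x + e x + \<eta>)"
    using nn ev by eventually_elim auto
  then obtain b where b: "b > 0"
    "\<And>x. 0 < x \<Longrightarrow> x < b \<Longrightarrow> 0 \<le> f x \<and> 0 \<le> e x \<and> (\<forall>\<eta>>0. \<forall>\<^sub>F y in at_right 0. f y \<le> f x + e x + \<eta>)"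
    unfolding eventually_at_right_field by auto
  define S where "S = (\<lambda>x. f x + e x) ` {0<..<b}"
  define L where "L = Inf S"
  have ne: "S \<noteq> {}" using b(1) by (auto simp: S_def)
  have bdd: "bdd_below S" unfolding S_def using b(2) by (intro bdd_belowI[of _ 0]) force
  have "(f \<longlongrightarrow> L) (at_right 0)"
  proof (rule tendstoI)
    fix \<eta> :: real assume \<eta>: "\<eta> > 0"
    obtain s where "s \<in> S" "s < L + \<eta> / 2" using cInf_lessD[OF ne, of "L + \<eta> / 2"] \<eta> by (auto simp: L_def)
    then obtain x where x: "0 < x" "x < b" "f x + e x < L + \<eta> / 2" by (auto simp: S_def)
    have "\<forall>\<^sub>F y in at_right 0. f y \<le> f x + e x + \<eta> / 2" using b(2)[OF x(1,2)] \<eta> by simp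
    moreover have "\<forall>\<^sub>F y in at_right 0. e y < \<eta>" using order_tendstoD(2)[OF e \<eta>] .
    moreover have "\<forall>\<^sub>F y in at_right 0. y \<in> {0<..<b}" using eventually_at_right_real[OF b(1)] .
    ultimately show "\<forall>\<^sub>F y in at_right 0. dist (f y) L < \<eta>"
    proof eventually_elim
      case (elim y)
      have "L \<le> f y + e y" unfolding L_def using elim bdd by (intro cInf_lower) (auto simp: S_def)
      then show ?case using elim x(3) by (simp add: dist_real_def abs_less_iff)
    qed
  qed
  then show ?thesis ..
qed

text \<open>For the upper bound, f at all small y is compared with g at one x close to 0. For the
  lower bound, y is held fixed and g at points tending to 0 is compared with f y, which puts C
  itself below f y up to a small error.\<close>

lemma asymp_le_antisym_tendsto:
  assumes "asymp_le f g" "asymp_le g f" and g: "(g \<longlongrightarrow> C) (at_right 0)"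
  shows "(f \<longlongrightarrow> C) (at_right 0)"
proof (rule tendstoI)
  fix \<eta> :: real assume \<eta>: "\<eta> > 0"
  obtain e where e: "(e \<longlongrightarrow> 0) (at_right 0)"
    and ev: "\<forall>\<^sub>F x in at_right 0. 0 \<le> e x \<and> (\<forall>\<eta>>0. \<forall>\<^sub>F y in at_right 0. f y \<le> g x + e x + \<eta>)"
    using assms(1) by (auto simp: asymp_le_def)
  obtain e' where e': "(e' \<longlongrightarrow> 0) (at_right 0)"
    and ev': "\<forall>\<^sub>F x in at_right 0. 0 \<le> e' x \<and> (\<forall>\<eta>>0. \<forall>\<^sub>F y in at_right 0. g y \<le> f x + e' x + \<eta>)"
    using assms(2) by (auto simp: asymp_le_def)
  have "\<forall>\<^sub>F x in at_right 0. e x < \<eta> / 3" "\<forall>\<^sub>F x in at_right 0. g x < C + \<eta> / 3"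
    using order_tendstoD(2)[OF e, of "\<eta> / 3"] order_tendstoD(2)[OF g, of "C + \<eta> / 3"] \<eta> by auto
  then have "\<forall>\<^sub>F x in at_right 0. g x + e x < C + 2 * \<eta> / 3 \<and> (\<forall>\<eta>>0. \<forall>\<^sub>F y in at_right 0. f y \<le> g x + e x + \<eta>)"
    using ev by eventually_elim auto
  then obtain x where x: "g x + e x < C + 2 * \<eta> / 3" "\<forall>\<eta>>0. \<forall>\<^sub>F y in at_right 0. f y \<le> g x + e x + \<eta>"
    using eventually_happens'[OF trivial_limit_at_right_real] by blast
  have "\<forall>\<^sub>F y in at_right 0. f y \<le> g x + e x + \<eta> / 3" using x(2) \<eta> by simp
  moreover have "\<forall>\<^sub>F y in at_right 0. e' y < \<eta> / 2" using order_tendstoD(2)[OF e', of "\<eta> / 2"] \<eta> by auto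
  ultimately show "\<forall>\<^sub>F y in at_right 0. dist (f y) C < \<eta>"
    using ev'
  proof eventually_elim
    case (elim y)
    have "\<forall>\<^sub>F v in at_right 0. g v \<le> f y + e' y + \<eta> / 2" using elim(3) \<eta> by simp
    then have "C \<le> f y + e' y + \<eta> / 2"
      by (rule tendsto_upperbound[OF g]) simp
    then show ?case using elim x(1) by (simp add: dist_real_def abs_less_iff)
  qed
qed

lemma tendsto_div_nat_floor: "((\<lambda>X::real. X / real (nat \<lfloor>X\<rfloor>)) \<longlongrightarrow> 1) at_top"
  by real_asymp

lemma filterlim_nat_floor: "filterlim (\<lambda>X::real. real (nat \<lfloor>X\<rfloor>)) at_top at_top"
  by real_asymp

lemma tendsto_div_floor: "a > 0 \<Longrightarrow> b > 0 \<Longrightarrow> ((\<lambda>X::real. X * (a / real_of_int \<lfloor>X * a / b\<rfloor>)) \<longlongrightarrow> b) at_top"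
  by real_asymp

text \<open>While eps' is held fixed and eps tends to 0, N tends to infinity and the rounding errors
  disappear. The factor eps^(-r) becomes (R / eps')^r because N is close to (eps' / (R * eps))^r.
  The number q bounds the product of l with the sum of the box sides uniformly in eps, which leaves
  a loss of order 1 / log(1 / q).\<close>

lemma gain_scaling_eventually:
  assumes I: "I \<subseteq> {..<d}" "I \<noteq> {}" and zw: "pos_on d I z" "pos_on d I w"
    and eps': "0 < eps'" "eps' \<le> 1" and \<eta>: "\<eta> > 0"
  defines "r \<equiv> 1 / real (card I)" and "R \<equiv> (\<Prod>i\<in>I. z ! i / w ! i)"
  defines "q \<equiv> gap_const d * (\<Sum>i\<in>I. z ! i / w ! i) * (eps' / R) powr r"
  assumes q: "q < 1"
  shows "\<forall>\<^sub>F eps in at_right 0. gain d eps z * eps powr (- r)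
     \<le> (R / eps') powr r * gain d eps' w + gap_const d * l1norm z / (- ln q) + \<eta>"
proof -
  have fin: "finite I" using I finite_subset by blast
  have d: "d > 0" using I by (cases d) auto
  define m where "m = card I"
  have m: "m > 0" using I fin by (simp add: m_def card_gt_0_iff)
  have r: "r > 0" using m by (simp add: r_def m_def)
  have zp: "z ! i > 0" "w ! i > 0" if "i \<in> I" for i using zw that by (auto simp: pos_on_def)
  have R: "R > 0" unfolding R_def using zp by (intro prod_pos) auto
  define S where "S = (\<Sum>i\<in>I. z ! i / w ! i)"
  have S: "S > 0" unfolding S_def using zp I fin by (intro sum_pos) auto
  define \<Lambda> where "\<Lambda> = gap_const d"
  have \<Lambda>: "\<Lambda> \<ge> 1" using gap_const_ge_1[OF d] by (simp add: \<Lambda>_def)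
  have q0: "q > 0" using \<Lambda> S R eps' by (simp add: q_def S_def[symmetric] \<Lambda>_def[symmetric])
  \<comment> \<open>The largest t with exp t * q \<le> 1.\<close>
  define t where "t = - ln q"
  have t: "t > 0" "exp t = 1 / q" using q q0 by (auto simp: t_def exp_minus field_simps)
  \<comment> \<open>The solution of X^m * R * eps = eps', that is, the real scale at which the
    volume condition is sharp; its integer part is the admissible N.\<close>
  define X where "X eps = (eps' / (R * eps)) powr r" for eps
  have Xlim: "filterlim X at_top (at_right 0)"
    unfolding X_def using eps'(1) R r by real_asymp
  \<comment> \<open>The bound of \<open>gain_scaling_bound\<close> multiplied by eps^(-r) and
    written as a function of the real scale alone, so that its limit at infinity can be taken factor
    by factor.\<close>
  define h where "h Y = Y / real (nat \<lfloor>Y\<rfloor>) * (R / eps') powr r * (gain d eps' w +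
      2 * (\<Sum>i\<in>I. \<bar>w ! i - real (nat \<lfloor>Y\<rfloor>) * (z ! i / real_of_int \<lfloor>real (nat \<lfloor>Y\<rfloor>) * z ! i / w ! i\<rfloor>)\<bar>)) + \<Lambda> * l1norm z / t" for Y
  have hl: "(h \<longlongrightarrow> 1 * (R / eps') powr r * (gain d eps' w + 2 * (\<Sum>i\<in>I. \<bar>w ! i - w ! i\<bar>)) + \<Lambda> * l1norm z / t) at_top"
    unfolding h_def
    by (intro tendsto_intros tendsto_div_nat_floor filterlim_compose[OF tendsto_div_floor filterlim_nat_floor]) (use zp in auto)
  then have "((\<lambda>eps. h (X eps)) \<longlongrightarrow> (R / eps') powr r * gain d eps' w + \<Lambda> * l1norm z / t) (at_right 0)"
    using filterlim_compose[OF hl Xlim] by simp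
  then have "\<forall>\<^sub>F eps in at_right 0. h (X eps) < (R / eps') powr r * gain d eps' w + \<Lambda> * l1norm z / t + \<eta>"
    using \<eta> by (intro order_tendstoD(2)) auto
  moreover have "\<forall>\<^sub>F eps in at_right 0. X eps \<ge> 1"
    using Xlim by (auto simp: filterlim_at_top)
  moreover have "\<forall>\<^sub>F eps in at_right 0. \<forall>i\<in>I. real (nat \<lfloor>X eps\<rfloor>) \<ge> w ! i / z ! i"
    using filterlim_compose[OF filterlim_nat_floor Xlim] fin
    by (intro eventually_ball_finite) (auto simp: filterlim_at_top)
  moreover have "\<forall>\<^sub>F eps in at_right 0. eps < (1 / \<Lambda>) powr (1 / r)"
    using \<Lambda> by (intro order_tendstoD(2)[OF tendsto_ident_at]) auto
  moreover have "\<forall>\<^sub>F eps in at_right (0::real). eps \<in> {0<..<1}" using eventually_at_right_real[of 0 1] by simp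
  ultimately show ?thesis
  proof eventually_elim
    case (elim eps)
    have eps: "0 < eps" "eps < 1" using elim by auto
    define N where "N = nat \<lfloor>X eps\<rfloor>"
    have N: "N > 0" "real N \<le> X eps" using elim(2) by (auto simp: N_def)
    have el: "\<Lambda> * eps powr r \<le> 1"
    proof -
      have "eps powr r \<le> ((1 / \<Lambda>) powr (1 / r)) powr r" using elim eps r by (intro powr_mono2) auto
      also have "\<dots> = 1 / \<Lambda>" using r \<Lambda> by (simp add: powr_powr)
      finally show ?thesis using \<Lambda> by (simp add: field_simps)
    qed
    have XR: "X eps = (eps' / R) powr r / eps powr r" "eps powr (- r) = X eps * (R / eps') powr r"
      using eps eps' R by (simp_all add: X_def powr_divide powr_mult powr_minus field_simps)
    have Xm: "X eps ^ m = eps' / (R * eps)"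
    proof -
      have "X eps ^ m = X eps powr real m" using elim(2) by (simp add: powr_realpow)
      also have "\<dots> = eps' / (R * eps)" using m eps eps' R by (simp add: X_def powr_powr r_def m_def)
      finally show ?thesis .
    qed
    have "gain d eps z \<le> (gain d eps' w + 2 * (\<Sum>i\<in>I. \<bar>w ! i - real N * (z ! i / real_of_int \<lfloor>real N * z ! i / w ! i\<rfloor>)\<bar>)) / real N
      + gap_const d * eps powr (1 / real (card I)) * l1norm z / t"
    proof (rule gain_scaling_bound[OF I zw])
      show "1 \<le> real N * z ! i / w ! i" if "i \<in> I" for i
      proof -
        have "w ! i / z ! i \<le> real N" using elim(3) that by (simp add: N_def)
        then show ?thesis using zp[OF that] by (simp add: field_simps)
      qed
      have "real N ^ card I * R * eps \<le> X eps ^ m * R * eps"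
        unfolding m_def using N R eps by (intro mult_right_mono power_mono) auto
      also have "\<dots> = eps'" unfolding Xm using R eps by simp
      finally show "real N ^ card I * (\<Prod>i\<in>I. z ! i / w ! i) * eps \<le> eps'" by (simp add: R_def)
      show "gap_const d * eps powr (1 / real (card I)) \<le> 1" using el by (simp add: \<Lambda>_def r_def)
      have "\<Lambda> * eps powr r * (real N * S) \<le> \<Lambda> * eps powr r * (X eps * S)"
        using \<Lambda> N S by (intro mult_left_mono mult_right_mono) auto
      also have "\<dots> = q" unfolding XR(1) using eps by (simp add: q_def S_def \<Lambda>_def)
      finally have "exp t * (\<Lambda> * eps powr r * (real N * S)) \<le> exp t * q" by simp
      also have "\<dots> = 1" using t q0 by simp
      finally show "exp t * (gap_const d * eps powr (1 / real (card I)) * (real N * (\<Sum>i\<in>I. z ! i / w ! i))) \<le> 1"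
        by (simp add: \<Lambda>_def r_def S_def)
    qed (use eps eps' N t in auto)
    then have "gain d eps z * eps powr (- r) \<le> ((gain d eps' w + 2 * (\<Sum>i\<in>I. \<bar>w ! i - real N * (z ! i / real_of_int \<lfloor>real N * z ! i / w ! i\<rfloor>)\<bar>)) / real N
      + \<Lambda> * eps powr r * l1norm z / t) * eps powr (- r)"
      by (intro mult_right_mono) (auto simp: \<Lambda>_def r_def)
    also have "\<dots> = (gain d eps' w + 2 * (\<Sum>i\<in>I. \<bar>w ! i - real N * (z ! i / real_of_int \<lfloor>real N * z ! i / w ! i\<rfloor>)\<bar>)) / real N * eps powr (- r)
      + \<Lambda> * l1norm z / t * (eps powr r * eps powr (- r))"
      by (simp add: algebra_simps)
    also have "eps powr r * eps powr (- r) = 1" using eps by (simp flip: powr_add)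
    also have "(gain d eps' w + 2 * (\<Sum>i\<in>I. \<bar>w ! i - real N * (z ! i / real_of_int \<lfloor>real N * z ! i / w ! i\<rfloor>)\<bar>)) / real N * eps powr (- r)
      + \<Lambda> * l1norm z / t * 1 = h (X eps)"
      unfolding XR(2) h_def N_def[symmetric] by simp
    finally show ?case using elim(1) by (simp add: \<Lambda>_def t_def)
  qed
qed

definition geo_mean :: "nat set \<Rightarrow> real list \<Rightarrow> real" where
  "geo_mean I z = (\<Prod>i\<in>I. (z ! i) powr (1 / real (card I)))"

definition scaled_gain :: "nat \<Rightarrow> nat set \<Rightarrow> real list \<Rightarrow> real \<Rightarrow> real" where
  "scaled_gain d I z eps = gain d eps z * eps powr (- (1 / real (card I))) / geo_mean I z"

lemma geo_mean_pos: "pos_on d I z \<Longrightarrow> geo_mean I z > 0"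
  unfolding geo_mean_def by (rule prod_pos) (auto simp: pos_on_def)

lemma prod_powr_real:
  fixes f :: "'a \<Rightarrow> real"
  assumes "\<And>i. i \<in> A \<Longrightarrow> f i \<ge> 0"
  shows "(\<Prod>i\<in>A. f i) powr a = (\<Prod>i\<in>A. f i powr a)"
  using assms by (induction A rule: infinite_finite_induct) (auto simp: powr_mult prod_nonneg)

text \<open>The volume ratio satisfies R^r = geo_mean I z / geo_mean I w, so division by the
  geometric mean is exactly what cancels the leading factors; this is the origin of the geometric
  mean in the limit. The error vanishes since q x tends to 0, at a logarithmic rate.\<close>

lemma scaled_gain_asymp_le:
  assumes I: "I \<subseteq> {..<d}" "I \<noteq> {}" and zw: "pos_on d I z" "pos_on d I w"
  shows "asymp_le (scaled_gain d I z) (scaled_gain d I w)"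
proof -
  have fin: "finite I" using I finite_subset by blast
  have d: "d > 0" using I by (cases d) auto
  define r where "r = 1 / real (card I)"
  have r: "r > 0" using I fin by (simp add: r_def card_gt_0_iff)
  define R where "R = (\<Prod>i\<in>I. z ! i / w ! i)"
  have zp: "z ! i > 0" "w ! i > 0" if "i \<in> I" for i using zw that by (auto simp: pos_on_def)
  have R: "R > 0" unfolding R_def using zp by (intro prod_pos) auto
  define B where "B = gap_const d * (\<Sum>i\<in>I. z ! i / w ! i)"
  have B: "B > 0" unfolding B_def using gap_const_ge_1[OF d] zp I fin by (intro mult_pos_pos sum_pos) auto
  define q where "q x = B * (x / R) powr r" for x
  define e where "e x = gap_const d * l1norm z / (- ln (q x)) / geo_mean I z" for x
  note g = geo_mean_pos[OF zw(1)] geo_mean_pos[OF zw(2)]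
  have lz: "l1norm z \<ge> 0" unfolding l1norm_def by (rule sum_list_nonneg) auto
  have "filterlim (\<lambda>x. - ln (q x)) at_top (at_right 0)" unfolding q_def using B R r by real_asymp
  then have "((\<lambda>x. gap_const d * l1norm z / (- ln (q x))) \<longlongrightarrow> 0) (at_right 0)"
    by (rule real_tendsto_divide_at_top[OF tendsto_const])
  then have e: "(e \<longlongrightarrow> 0) (at_right 0)" unfolding e_def by (rule tendsto_divide_zero)
  have "(q \<longlongrightarrow> 0) (at_right 0)" unfolding q_def using B R r by real_asymp
  then have "\<forall>\<^sub>F x in at_right 0. q x < 1" by (rule order_tendstoD) simp
  moreover have "\<forall>\<^sub>F x in at_right (0::real). x \<in> {0<..<1}" using eventually_at_right_real[of 0 1] by simp
  ultimately have "\<forall>\<^sub>F x in at_right 0. 0 \<le> e x \<and> (\<forall>\<eta>>0. \<forall>\<^sub>F y in at_right 0. scaled_gain d I z y \<le> scaled_gain d I w x + e x + \<eta>)"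
  proof eventually_elim
    case (elim x)
    have x: "0 < x" "x \<le> 1" using elim by auto
    have q0: "q x > 0" using B R x by (simp add: q_def)
    have "0 \<le> e x" unfolding e_def using lz gap_const_ge_1[OF d] g elim q0 by (intro divide_nonneg_nonneg mult_nonneg_nonneg) auto
    moreover have "\<forall>\<^sub>F y in at_right 0. scaled_gain d I z y \<le> scaled_gain d I w x + e x + \<eta>" if \<eta>: "\<eta> > 0" for \<eta>
    proof -
      have Rr: "R powr r = geo_mean I z / geo_mean I w"
      proof -
        have "R powr r = (\<Prod>i\<in>I. (z ! i / w ! i) powr r)" unfolding R_def
          by (rule prod_powr_real) (use zp in \<open>auto simp: less_imp_le\<close>)
        also have "\<dots> = (\<Prod>i\<in>I. (z ! i) powr r / (w ! i) powr r)"
          by (rule prod.cong) (use zp in \<open>auto simp: powr_divide less_imp_le\<close>)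
        finally show ?thesis by (simp add: prod_dividef geo_mean_def r_def)
      qed
      have "\<forall>\<^sub>F y in at_right 0. gain d y z * y powr (- r) \<le> (R / x) powr r * gain d x w + gap_const d * l1norm z / (- ln (q x)) + \<eta> * geo_mean I z"
        unfolding r_def R_def q_def B_def
        by (rule gain_scaling_eventually[OF I zw x])
          (use elim \<eta> g in \<open>auto simp: q_def B_def R_def r_def\<close>)
      then show ?thesis
      proof eventually_elim
        case (elim y)
        have "scaled_gain d I z y \<le> ((R / x) powr r * gain d x w + gap_const d * l1norm z / (- ln (q x)) + \<eta> * geo_mean I z) / geo_mean I z"
          unfolding scaled_gain_def r_def[symmetric] using elim g by (intro divide_right_mono) auto
        also have "\<dots> = (R / x) powr r * gain d x w / geo_mean I z + e x + \<eta>"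
          using g by (simp add: add_divide_distrib diff_divide_distrib e_def)
        also have "(R / x) powr r * gain d x w / geo_mean I z = scaled_gain d I w x"
          using R x g by (simp add: powr_divide Rr scaled_gain_def r_def[symmetric] powr_minus field_simps)
        finally show ?case .
      qed
    qed
    ultimately show ?case by blast
  qed
  then show ?thesis using e by (auto simp: asymp_le_def)
qed

section \<open>Positivity and conclusion\<close>

definition unit_on :: "nat \<Rightarrow> nat set \<Rightarrow> real list" where
  "unit_on d I = map (\<lambda>i. if i \<in> I then 1 else 0) [0..<d]"

lemma pos_on_unit: "I \<subseteq> {..<d} \<Longrightarrow> pos_on d I (unit_on d I)"
  by (auto simp: pos_on_def unit_on_def)

text \<open>A cube of side M along I contains the lower ends of M^(card I) edges of one chosen
  direction. If one of them is open, a monotone path through it from the origin to the opposite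
  corner saves one unit of time, and subadditivity repeats this cube after cube.\<close>

lemma gain_unit_lower_bound:
  assumes I: "I \<subseteq> {..<d}" "I \<noteq> {}" and eps: "0 \<le> eps" "eps \<le> 1" and M: "M > 0"
  shows "gain d eps (unit_on d I) \<ge> (1 - (1 - eps) ^ (M ^ card I)) / real M"
proof -
  have d: "d > 0" using I by (cases d) auto
  define k where "k i = (if i \<in> I then int M else 1)" for i
  interpret coarse d I k
    by unfold_locales (use I M in \<open>auto simp: k_def\<close>)
  obtain i0 where i0: "i0 \<in> I" "i0 < d" using I by auto
  define y where "y = map (\<lambda>i. if i \<in> I then int M else 0) [0..<d]"
  have y: "length y = d" "\<And>i. i < d \<Longrightarrow> y ! i = (if i \<in> I then int M else 0)" by (simp_all add: y_def)
  define e where "e = (origin d, i0)"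
  have e: "e \<in> edge_set d" using i0 by (simp add: e_def edge_set_def)
  define D where "D = dist1 (origin d) y"
  have T: "real (passage_time d (thresh eps u) (origin d) y) \<le> real_of_int D - 1 + real (block_open cell_edges eps u e)" for u
  proof (cases "\<exists>f\<in>cell_edges e. u f < eps")
    case False
    have "int (passage_time d (thresh eps u) (origin d) y) \<le> D"
      unfolding D_def by (rule passage_time_le_dist1) (use y in \<open>auto simp: thresh_def\<close>)
    then show ?thesis using False by (simp add: block_open_def)
  next
    case True
    then obtain x where x: "length x = d" "cell x = origin d" "u (x, i0) < eps"
      by (auto simp: cell_edges_def cell_vertices_def e_def)
    define \<tau> where "\<tau> = thresh eps u"
    have \<tau>1: "\<tau> f \<le> 1" for f unfolding \<tau>_def by (rule thresh_le)
    have xi: "0 \<le> x ! i \<and> x ! i < k i" if "i < d" for i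
    proof -
      have "x ! i div k i = 0" using arg_cong[OF x(2), of "\<lambda>v. v ! i"] that by simp
      then show ?thesis using k_pos[of i] pos_mod_bound[of "k i" "x ! i"] pos_mod_sign[of "k i" "x ! i"]
        by (metis add.left_neutral div_mult_mod_eq mult_zero_left zero_less_one less_le_trans)
    qed
    have "passage_time d \<tau> (origin d) y \<le> passage_time d \<tau> (origin d) x + passage_time d \<tau> x (step_up x i0) + passage_time d \<tau> (step_up x i0) y"
      using passage_time_triangle[of "origin d" d x y \<tau>] passage_time_triangle[of x d "step_up x i0" y \<tau>] x y by simp
    moreover have "passage_time d \<tau> x (step_up x i0) = 0"
      using passage_time_edge[OF adjacent_step_up[OF x(1) i0(2)], of \<tau>] x i0 by (simp add: \<tau>_def thresh_def)
    moreover have "int (passage_time d \<tau> (origin d) x) \<le> dist1 (origin d) x"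
      by (rule passage_time_le_dist1) (use x \<tau>1 in auto)
    moreover have "int (passage_time d \<tau> (step_up x i0) y) \<le> dist1 (step_up x i0) y"
      by (rule passage_time_le_dist1) (use x y \<tau>1 in auto)
    \<comment> \<open>The coordinates of x on I lie between 0 and M - 1, so a step along i0 does not
      overshoot y and the path through the open edge stays monotone.\<close>
    moreover have "dist1 (origin d) x + dist1 (step_up x i0) y = D - 1"
    proof -
      have "dist1 (origin d) x + dist1 (step_up x i0) y = (\<Sum>i<d. \<bar>origin d ! i - y ! i\<bar> - (if i = i0 then 1 else 0))"
        unfolding dist1_def length_origin length_step x(1) sum.distrib[symmetric]
      proof (rule sum.cong[OF refl])
        fix i assume "i \<in> {..<d}"
        then have i: "i < d" by simp
        show "\<bar>origin d ! i - x ! i\<bar> + \<bar>step_up x i0 ! i - y ! i\<bar> = \<bar>origin d ! i - y ! i\<bar> - (if i = i0 then 1 else 0)"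
          using xi[OF i] y(2)[OF i] i x(1) i0 by (auto simp: nth_step_up k_def)
      qed
      then show ?thesis using i0 by (simp add: sum_subtractf D_def dist1_def)
    qed
    ultimately show ?thesis unfolding \<tau>_def by linarith
  qed
  have L: "cell_edges e \<subseteq> edge_set d \<and> finite (cell_edges e) \<and> card (cell_edges e) = cell_size"
    by (rule cell_edges_props[OF e])
  define A where "A = {u \<in> space (unif_env d). \<forall>f\<in>cell_edges e. u f \<in> {eps..}}"
  have A: "A \<in> sets (unif_env d)" unfolding A_def
  proof (rule sets.sets_Collect_finite_All)
    fix f assume "f \<in> cell_edges e"
    then have "f \<in> edge_set d" using L by blast
    then have "(\<lambda>u. u f) \<in> measurable (unif_env d) unif01"
      unfolding unif_env_def by (rule measurable_component_singleton)
    from measurable_sets[OF this, of "{eps..}"]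
    show "{u \<in> space (unif_env d). u f \<in> {eps..}} \<in> sets (unif_env d)"
      by (simp add: vimage_def Int_def conj_commute)
  qed (use L in simp)
  have "emeasure (unif_env d) A = (\<Prod>f\<in>cell_edges e. emeasure unif01 {eps..})"
    unfolding A_def unif_env_def using L by (intro unif_prod.emeasure_PiM_Collect) auto
  also have "\<dots> = ennreal ((1 - eps) ^ cell_size)"
    using L eps by (simp add: emeasure_unif01_ge ennreal_power)
  finally have mA: "measure (unif_env d) A = (1 - eps) ^ cell_size"
    using eps by (simp add: measure_def)
  have cs: "cell_size = M ^ card I"
  proof -
    have "cell_size = (\<Prod>i\<in>I. nat (k i))"
      unfolding cell_size_def by (rule prod.mono_neutral_right) (use I in \<open>auto simp: k_def\<close>)
    then show ?thesis by (simp add: k_def)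
  qed
  have "mean_time0 d eps y \<le> (\<integral>u. real_of_int D - 1 + indicator A u \<partial>unif_env d)"
    unfolding mean_time_def
  proof (rule integral_mono)
    show "integrable (unif_env d) (\<lambda>u. real (passage_time d (thresh eps u) (origin d) y))"
      by (rule passage_thresh_integrable) (use y in auto)
    show "integrable (unif_env d) (\<lambda>u. real_of_int D - 1 + indicator A u)"
      using A by (simp add: unif_env.emeasure_eq_measure)
    fix u assume "u \<in> space (unif_env d)"
    then have "real (block_open cell_edges eps u e) \<le> indicator A u"
      unfolding block_open_def A_def by (auto simp: indicator_def not_less)
    then show "real (passage_time d (thresh eps u) (origin d) y) \<le> real_of_int D - 1 + indicator A u"
      using T[of u] by linarith
  qed
  also have "\<dots> = real_of_int D - 1 + (1 - eps) ^ (M ^ card I)"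
    using A by (simp add: unif_env.prob_space unif_env.emeasure_eq_measure mA cs)
  finally have mt: "mean_time0 d eps y \<le> real_of_int D - 1 + (1 - eps) ^ (M ^ card I)" .
  have yu: "map real_of_int y = map (\<lambda>t. real M * t) (unit_on d I)"
    by (rule nth_equalityI) (auto simp: y_def unit_on_def)
  have lu: "length (unit_on d I) = d" by (simp add: unit_on_def)
  have "real M * time_const d eps (unit_on d I) \<le> mean_time0 d eps y"
    using time_const_le_mean_time[OF eps d y(1)] time_const_nat_scale[OF eps d lu M] unfolding yu by simp
  moreover have "real_of_int D = real M * l1norm (unit_on d I)"
    unfolding l1norm_sum[OF lu] D_def dist1_def length_origin sum_distrib_left of_int_sum
    by (rule sum.cong) (auto simp: y unit_on_def)
  ultimately have "1 - (1 - eps) ^ (M ^ card I) \<le> real M * gain d eps (unit_on d I)"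
    using mt by (simp add: gain_def algebra_simps)
  then show ?thesis using M by (simp add: divide_le_eq mult.commute)
qed

text \<open>A cube whose side is eps^(-1/m) rounded up offers at least 1 / eps edges, so one of them
  is open with probability at least 1 - 1/e. As eps^(-1/m) \<ge> 1, rounding up costs at most a
  factor 2.\<close>

lemma scaled_gain_unit_lower_bound:
  assumes I: "I \<subseteq> {..<d}" "I \<noteq> {}"
  shows "\<forall>\<^sub>F eps in at_right 0. scaled_gain d I (unit_on d I) eps \<ge> (1 - exp (-1)) / 2"
proof -
  have fin: "finite I" using I finite_subset by blast
  define m where "m = card I"
  have m: "m > 0" using I fin by (simp add: m_def card_gt_0_iff)
  have "\<forall>\<^sub>F x in at_right (0::real). x \<in> {0<..<1}" using eventually_at_right_real[of 0 1] by simp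
  then show ?thesis
  proof eventually_elim
    case (elim eps)
    have eps: "0 < eps" "eps < 1" using elim by auto
    define X where "X = eps powr (- (1 / real m))"
    have X1: "X \<ge> 1" unfolding X_def using eps m by (simp add: powr_minus one_le_inverse_iff powr_le1)
    define M where "M = nat \<lceil>X\<rceil>"
    have M: "M > 0" "X \<le> real M" "real M \<le> 2 * X" using X1 unfolding M_def by linarith+
    have "X ^ m = X powr real m" using X1 by (simp add: powr_realpow)
    also have "\<dots> = eps powr (- 1)" unfolding X_def powr_powr using m by simp
    finally have "X ^ m = 1 / eps" using eps by (simp add: powr_minus_divide)
    moreover have "eps * X ^ m \<le> eps * real (M ^ m)"
      unfolding of_nat_power using M X1 eps by (intro mult_left_mono power_mono) auto
    ultimately have "1 \<le> eps * real (M ^ m)" using eps by simp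
    have "(1 - eps) ^ (M ^ m) \<le> exp (- eps) ^ (M ^ m)"
      using exp_ge_add_one_self[of "- eps"] eps by (intro power_mono) auto
    also have "\<dots> = exp (- (eps * real (M ^ m)))" by (simp flip: exp_of_nat_mult add: mult.commute)
    also have "\<dots> \<le> exp (-1)" using \<open>1 \<le> eps * real (M ^ m)\<close> by simp
    finally have 1: "1 - exp (-1) \<le> 1 - (1 - eps) ^ (M ^ m)" by linarith
    have "(1 - exp (-1)) / (2 * X) \<le> (1 - exp (-1)) / real M"
      using M X1 by (intro divide_left_mono) auto
    also have "\<dots> \<le> (1 - (1 - eps) ^ (M ^ m)) / real M" using 1 by (intro divide_right_mono) auto
    also have "\<dots> \<le> gain d eps (unit_on d I)"
      using gain_unit_lower_bound[OF I _ _ M(1), of eps] eps by (simp add: m_def)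
    finally have "(1 - exp (-1)) / 2 \<le> gain d eps (unit_on d I) * X" using X1 by (simp add: field_simps)
    moreover have "geo_mean I (unit_on d I) = 1"
      unfolding geo_mean_def by (rule prod.neutral) (use I in \<open>auto simp: unit_on_def\<close>)
    ultimately show ?case by (simp add: scaled_gain_def X_def m_def)
  qed
qed

text \<open>The all-ones vector on I is the reference: comparison with itself gives convergence and
  the cube bound gives a positive limit. Any other vector is compared with it in both directions and
  inherits the limit.\<close>

lemma scaled_gain_limit:
  assumes I: "I \<subseteq> {..<d}" "I \<noteq> {}"
  shows "\<exists>C>0. \<forall>z. pos_on d I z \<longrightarrow> (scaled_gain d I z \<longlongrightarrow> C) (at_right 0)"
proof -
  have d: "d > 0" using I by (cases d) auto
  define o1 where "o1 = unit_on d I"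
  have p: "pos_on d I o1" unfolding o1_def by (rule pos_on_unit[OF I(1)])
  have lb: "\<forall>\<^sub>F eps in at_right 0. scaled_gain d I o1 eps \<ge> (1 - exp (-1)) / 2"
    unfolding o1_def by (rule scaled_gain_unit_lower_bound[OF I])
  have pos: "(1 - exp (-1)) / 2 > (0::real)" by simp
  have "\<forall>\<^sub>F eps in at_right 0. 0 \<le> scaled_gain d I o1 eps"
    using lb by eventually_elim (use pos in linarith)
  then obtain C where C: "(scaled_gain d I o1 \<longlongrightarrow> C) (at_right 0)"
    using asymp_le_refl_convergent[OF scaled_gain_asymp_le[OF I p p]] by blast
  have "(1 - exp (-1)) / 2 \<le> C" using C lb by (rule tendsto_lowerbound) simp
  then have "C > 0" using pos by linarith
  moreover have "(scaled_gain d I z \<longlongrightarrow> C) (at_right 0)" if "pos_on d I z" for z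
    by (rule asymp_le_antisym_tendsto[OF scaled_gain_asymp_le[OF I that p] scaled_gain_asymp_le[OF I p that] C])
  ultimately show ?thesis by blast
qed

text \<open>Moves the support to an initial segment of the axes, so that the constant depends on the
  support only through its size.\<close>

lemma sorting_permutation:
  fixes d :: nat
  assumes "I \<subseteq> {..<d}"
  shows "\<exists>\<sigma>. bij_betw \<sigma> {..<d} {..<d} \<and> (\<forall>i<d. \<sigma> i \<in> I \<longleftrightarrow> i < card I)"
proof -
  have fin: "finite I" using assms finite_subset by blast
  have le: "card I \<le> d" using card_mono[OF _ assms] by simp
  have "\<exists>f. bij_betw f {..<card I} I" using fin by (intro finite_same_card_bij) auto
  moreover have "\<exists>g. bij_betw g {card I..<d} ({..<d} - I)"
    using fin assms by (intro finite_same_card_bij) (auto simp: card_Diff_subset)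
  ultimately obtain f g where f: "bij_betw f {..<card I} I" and g: "bij_betw g {card I..<d} ({..<d} - I)" by blast
  define \<sigma> where "\<sigma> i = (if i < card I then f i else g i)" for i
  have f': "bij_betw \<sigma> {..<card I} I" using f by (rule bij_betw_cong[THEN iffD1, rotated]) (auto simp: \<sigma>_def)
  have g': "bij_betw \<sigma> {card I..<d} ({..<d} - I)" using g by (rule bij_betw_cong[THEN iffD1, rotated]) (auto simp: \<sigma>_def)
  have "bij_betw \<sigma> ({..<card I} \<union> {card I..<d}) (I \<union> ({..<d} - I))"
    by (rule bij_betw_combine[OF f' g']) auto
  moreover have "{..<card I} \<union> {card I..<d} = {..<d}" "I \<union> ({..<d} - I) = {..<d}" using le assms by auto
  ultimately have "bij_betw \<sigma> {..<d} {..<d}" by simp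
  moreover have "\<sigma> i \<in> I \<longleftrightarrow> i < card I" if "i < d" for i
    using f' g' that by (cases "i < card I") (auto simp: bij_betw_def)
  ultimately show ?thesis by blast
qed

text \<open>Taking absolute values and permuting is a single signed permutation for the given z, and
  the inverse one leads back; each gives one inequality.\<close>

lemma time_const_abs_permutation:
  assumes eps: "0 \<le> eps" "eps \<le> 1" and d: "d > 0" and z: "length z = d" and \<sigma>: "bij_betw \<sigma> {..<d} {..<d}"
  shows "time_const d eps (map (\<lambda>i. \<bar>z ! \<sigma> i\<bar>) [0..<d]) = time_const d eps z"
proof (rule antisym)
  define w where "w = map (\<lambda>i. \<bar>z ! \<sigma> i\<bar>) [0..<d]"
  define sg where "sg x = (if x < 0 then -1 else 1 :: int)" for x :: real
  have sg: "\<bar>sg x\<bar> = 1" "real_of_int (sg x) * x = \<bar>x\<bar>" "real_of_int (sg x) * \<bar>x\<bar> = x" for x by (auto simp: sg_def)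
  have \<sigma>d: "\<sigma> i < d" if "i < d" for i using \<sigma> that by (auto simp: bij_betw_def)
  have "w = map (\<lambda>i. real_of_int (sg (z ! \<sigma> i)) * z ! \<sigma> i) [0..<d]" by (simp add: w_def sg)
  then show "time_const d eps w \<le> time_const d eps z"
    using time_const_signed_permutation_le[OF eps d z _ \<sigma>, of "\<lambda>i. sg (z ! \<sigma> i)"] sg by simp
  define \<rho> where "\<rho> = inv_into {..<d} \<sigma>"
  have \<rho>: "bij_betw \<rho> {..<d} {..<d}" unfolding \<rho>_def by (rule bij_betw_inv_into[OF \<sigma>])
  have \<sigma>\<rho>: "\<sigma> (\<rho> i) = i" "\<rho> i < d" if "i < d" for i
    using bij_betw_inv_into_right[OF \<sigma>, of i] \<rho> that by (auto simp: \<rho>_def bij_betw_def)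
  have "z = map (\<lambda>i. real_of_int (sg (z ! i)) * w ! \<rho> i) [0..<d]"
    by (rule nth_equalityI) (use z \<sigma>\<rho> sg in \<open>auto simp: w_def\<close>)
  then show "time_const d eps z \<le> time_const d eps w"
    using time_const_signed_permutation_le[OF eps d _ _ \<rho>, of w "\<lambda>i. sg (z ! i)"] sg by (simp add: w_def)
qed

theorem theorem1:
  shows "\<exists>C :: nat \<Rightarrow> nat \<Rightarrow> real.
    (\<forall>d1 d2. d1 \<ge> 1 \<longrightarrow> C d1 d2 > 0) \<and>
    (\<forall>d::nat. \<forall>z::real list. d \<ge> 2 \<and> length z = d \<and> z \<noteq> replicate d 0 \<longrightarrow>
       (\<lambda>eps. time_const d eps z
              - (l1norm z - C (dim1 z) (dim2 z) * gamma_fac z * eps powr (1 / real (dim1 z))))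
       \<in> smallo (at_right (0::real)) (\<lambda>eps. eps powr (1 / real (dim1 z))))"
proof -
  \<comment> \<open>The constant is read off in dimension d1 + d2 for the first d1 axes; at d1 = 0
    its value is arbitrary.\<close>
  have "\<forall>d1 d2. \<exists>C. d1 \<ge> 1 \<longrightarrow> C > 0 \<and> (\<forall>z. pos_on (d1 + d2) {..<d1} z \<longrightarrow> (scaled_gain (d1 + d2) {..<d1} z \<longlongrightarrow> C) (at_right 0))"
  proof (intro allI)
    fix d1 d2 :: nat
    show "\<exists>C. d1 \<ge> 1 \<longrightarrow> C > 0 \<and> (\<forall>z. pos_on (d1 + d2) {..<d1} z \<longrightarrow> (scaled_gain (d1 + d2) {..<d1} z \<longlongrightarrow> C) (at_right 0))"
    proof (cases "d1 \<ge> 1")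
      case True
      then have "{..<d1} \<subseteq> {..<d1 + d2}" "{..<d1} \<noteq> {}" by (auto simp: lessThan_empty_iff)
      from scaled_gain_limit[OF this] show ?thesis by blast
    qed simp
  qed
  then obtain C where C: "\<And>d1 d2. d1 \<ge> 1 \<Longrightarrow> C d1 d2 > 0"
    "\<And>d1 d2 z. d1 \<ge> 1 \<Longrightarrow> pos_on (d1 + d2) {..<d1} z \<Longrightarrow> (scaled_gain (d1 + d2) {..<d1} z \<longlongrightarrow> C d1 d2) (at_right 0)"
    by metis
  show ?thesis
  proof (intro exI[of _ C] conjI allI impI)
    fix d1 d2 :: nat assume "d1 \<ge> 1" then show "C d1 d2 > 0" by (rule C)
  next
    fix d :: nat and z :: "real list"
    assume a: "d \<ge> 2 \<and> length z = d \<and> z \<noteq> replicate d 0"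
    then have z: "length z = d" and d: "d > 0" by auto
    define I where "I = {i. i < length z \<and> z ! i \<noteq> 0}"
    have I: "I \<subseteq> {..<d}" using z by (auto simp: I_def)
    have fin: "finite I" using I finite_subset by blast
    have "I \<noteq> {}"
    proof
      assume "I = {}"
      then have "z = replicate d 0" by (intro nth_equalityI) (use z in \<open>auto simp: I_def\<close>)
      then show False using a by simp
    qed
    then have m: "card I \<ge> 1" using fin by (simp add: Suc_le_eq card_gt_0_iff)
    have le: "card I \<le> d" using card_mono[OF _ I] by simp
    have dims: "dim1 z = card I" "dim2 z = d - card I" by (simp_all add: dim1_def dim2_def I_def z)
    define m where "m = card I"
    obtain \<sigma> where \<sigma>: "bij_betw \<sigma> {..<d} {..<d}" "\<And>i. i < d \<Longrightarrow> \<sigma> i \<in> I \<longleftrightarrow> i < m"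
      using sorting_permutation[OF I] unfolding m_def by blast
    have \<sigma>d: "\<sigma> i < d" if "i < d" for i using \<sigma>(1) that by (auto simp: bij_betw_def)
    define w where "w = map (\<lambda>i. \<bar>z ! \<sigma> i\<bar>) [0..<d]"
    have \<sigma>I: "bij_betw \<sigma> {..<m} I"
    proof (rule bij_betw_imageI)
      show "inj_on \<sigma> {..<m}" using \<sigma>(1) le by (auto simp: bij_betw_def m_def intro: inj_on_subset)
      show "\<sigma> ` {..<m} = I"
      proof (intro equalityI subsetI)
        fix j assume "j \<in> \<sigma> ` {..<m}" then show "j \<in> I" using \<sigma>(2) le by (auto simp: m_def)
      next
        fix j assume j: "j \<in> I"
        then have "j \<in> \<sigma> ` {..<d}" using \<sigma>(1) I by (auto simp: bij_betw_def)
        then show "j \<in> \<sigma> ` {..<m}" using \<sigma>(2) j by auto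
      qed
    qed
    have pw: "pos_on d {..<m} w"
      unfolding pos_on_def w_def using \<sigma>(2) \<sigma>d z le by (auto simp: I_def m_def)
    have gw: "geo_mean {..<m} w = gamma_fac z"
    proof -
      have "geo_mean {..<m} w = (\<Prod>i<m. \<bar>z ! \<sigma> i\<bar> powr (1 / real m))"
        unfolding geo_mean_def by (rule prod.cong) (use le in \<open>auto simp: w_def m_def\<close>)
      also have "\<dots> = (\<Prod>i\<in>I. \<bar>z ! i\<bar> powr (1 / real m))" by (rule prod.reindex_bij_betw[OF \<sigma>I])
      finally show ?thesis by (simp add: gamma_fac_def dims m_def I_def[symmetric])
    qed
    have lw: "l1norm w = l1norm z"
    proof -
      have "l1norm w = (\<Sum>i<d. \<bar>z ! \<sigma> i\<bar>)" by (subst l1norm_sum[of _ d]) (auto simp: w_def)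
      also have "\<dots> = l1norm z" unfolding l1norm_sum[OF z] by (rule sum.reindex_bij_betw[OF \<sigma>(1)])
      finally show ?thesis .
    qed
    define c where "c = C m (d - m)"
    have "(scaled_gain (m + (d - m)) {..<m} w \<longlongrightarrow> C m (d - m)) (at_right 0)"
      by (rule C(2)) (use m pw le in \<open>auto simp: m_def\<close>)
    then have lim: "(scaled_gain d {..<m} w \<longlongrightarrow> c) (at_right 0)" using le by (simp add: m_def c_def)
    have g0: "gamma_fac z > 0" using geo_mean_pos[OF pw] gw by simp
    \<comment> \<open>This expression is exactly the error of the expansion divided by eps^(1/m), so
      the convergence of the scaled gain is the little-o claim.\<close>
    have "((\<lambda>eps. (c - scaled_gain d {..<m} w eps) * gamma_fac z) \<longlongrightarrow> (c - c) * gamma_fac z) (at_right 0)"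
      by (intro tendsto_intros lim)
    then have lim0: "((\<lambda>eps. (c - scaled_gain d {..<m} w eps) * gamma_fac z) \<longlongrightarrow> 0) (at_right 0)" by simp
    have ev: "\<forall>\<^sub>F x in at_right (0::real). x \<in> {0<..<1}" using eventually_at_right_real[of 0 1] by simp
    show "(\<lambda>eps. time_const d eps z
        - (l1norm z - C (dim1 z) (dim2 z) * gamma_fac z * eps powr (1 / real (dim1 z))))
       \<in> smallo (at_right (0::real)) (\<lambda>eps. eps powr (1 / real (dim1 z)))"
    proof (rule smalloI_tendsto)
      show "\<forall>\<^sub>F eps in at_right (0::real). eps powr (1 / real (dim1 z)) \<noteq> 0"
        using ev by eventually_elim auto
      have "\<forall>\<^sub>F eps in at_right 0. (c - scaled_gain d {..<m} w eps) * gamma_fac z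
         = (time_const d eps z - (l1norm z - C (dim1 z) (dim2 z) * gamma_fac z * eps powr (1 / real (dim1 z)))) / eps powr (1 / real (dim1 z))"
        using ev
      proof eventually_elim
        case (elim eps)
        have eps: "0 < eps" "eps < 1" using elim by auto
        have tc: "time_const d eps w = time_const d eps z"
          unfolding w_def by (rule time_const_abs_permutation) (use eps d z \<sigma> in auto)
        have "scaled_gain d {..<m} w eps * gamma_fac z = (l1norm z - time_const d eps z) * eps powr (- (1 / real m))"
          unfolding scaled_gain_def gw gain_def tc lw using g0 by simp
        then have "(c - scaled_gain d {..<m} w eps) * gamma_fac z = c * gamma_fac z - (l1norm z - time_const d eps z) / eps powr (1 / real m)"
          by (simp add: left_diff_distrib powr_minus divide_inverse)
        then show ?case using eps unfolding dims m_def[symmetric] c_def[symmetric] by (simp add: field_simps)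
      qed
      from Lim_transform_eventually[OF lim0 this]
      show "((\<lambda>eps. (time_const d eps z - (l1norm z - C (dim1 z) (dim2 z) * gamma_fac z * eps powr (1 / real (dim1 z)))) / eps powr (1 / real (dim1 z))) \<longlongrightarrow> 0) (at_right 0)" .
    qed
  qed
qed

end
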